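(* Let $0<p\le\infty$, $\omega\in\Omega$, and $u\in\mathcal{R}(p)$. Then there exists a constant $C=C(\omega,u,p)$ such that for every integer $n\ge1$, every trigonometric polynomial $T_n$ of degree at most $n$, and every measurable set $E\subset\mathbb{T}$ of positive measure $|E|\le 1$, $$\|T_n\|_{L_p(\omega u)}\le \exp(Cn|E|)\,\|T_n\|_{L_p(\omega u,\,\mathbb{T}\setminus E)}.$$
   Context: $\mathbb{T}=\mathbb{R}/2\pi\mathbb{Z}$; $|E|$ is Lebesgue measure. A weight is a nonnegative integrable function on $\mathbb{T}$. For a weight $w$ and measurable $E\subset\mathbb{T}$: $\|f\|_{L_p(w,E)}=\left(\int_E|f|^pw\right)^{1/p}$ if $0<p<\infty$, $\|f\|_{L_\infty(w,E)}=\operatorname{ess\,sup}_{t\in E}|f(t)w(t)|$, and $\|f\|_{L_p(w)}=\|f\|_{L_p(w,\mathbb{T})}$. Class $\mathcal{R}(p)$, $0<p\le\infty$: a weight $u$ belongs to $\mathcal{R}(p)$ if there is $C=C(p,u)>0$ such that for every $n\ge1$ and every trigonometric polynomial $T_n$ of degree at most $n$, $\|T_n\|_{L_p(u,\mathbb{T})}\le\exp(Cn|E|)\|T_n\|_{L_p(u,\mathbb{T}\setminus E)}$ for all measurable sets $E\subset\mathbb{T}$ with $|E|\le1$. Class $\Omega$: $\omega\in\Omega$ if $\omega(t)=\exp(-F(g(t)))$, $t\in\mathbb{T}$ (with $\omega(t)=0$ where $g(t)=0$), where for some $A>0$: - $g:\mathbb{T}\to[-A,A]$ is real analytic, i.e.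 for some $D>0$, $|g^{(n)}(t)|\le D^n n!$ for all $t\in\mathbb{T}$, $n\ge 1$; each zero of $g$ has multiplicity one; and $g$ has at least one zero on $\mathbb{T}$; - $F:[-A,A]\setminus\{0\}\to(0,\infty)$ is even, $C^\infty$ on $(0,A]$, and satisfies: (F1) $F(x)\to\infty$ as $x\to0+$; (F2) $F$ is decreasing on $(0,A]$; (F3) for some $B>0$, $|F^{(n)}(x)|\le B^n n^n F(x)/x^n$ for $x\in(0,A]$, $n=1,2,\dots$; (F4) there exist $A_1,A_2>0$ with $A_2\le |F'(x)|x/F(x)\le A_1$ for $x\in(0,A]$. *)

theory Defs
  imports "HOL-Analysis.Analysis" "HOL-Probability.Essential_Supremum"
begin

text \<open>
  The circle is represented by the fundamental domain \<open>[0, 2\<pi>)\<close>: a function on the circle is a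
  \<open>2\<pi>\<close>-periodic function on the real line, a subset of the circle is a subset of \<open>[0, 2\<pi>)\<close>.
  Measurability is Lebesgue measurability throughout.
\<close>

definition circle :: "real set" where
  "circle = {0..<2 * pi}"

definition periodic_2pi :: "(real \<Rightarrow> 'a) \<Rightarrow> bool" where
  "periodic_2pi f \<longleftrightarrow> (\<forall>t. f (t + 2 * pi) = f t)"

definition weight :: "(real \<Rightarrow> real) \<Rightarrow> bool" where
  "weight w \<longleftrightarrow> periodic_2pi w \<and> (\<forall>t. 0 \<le> w t) \<and> set_integrable lebesgue circle w"

definition trig_poly :: "nat \<Rightarrow> (real \<Rightarrow> complex) \<Rightarrow> bool" where
  "trig_poly n T \<longleftrightarrow>
     (\<exists>c :: int \<Rightarrow> complex. \<forall>t. T t = (\<Sum>k = - int n..int n. c k * cis (of_int k * t)))"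

definition ennreal_powr :: "ennreal \<Rightarrow> real \<Rightarrow> ennreal" where
  "ennreal_powr x a = (if x = \<infinity> then \<infinity> else ennreal (enn2real x powr a))"

text \<open>
  The (quasi)norm takes values in \<open>[0, \<infinity>]\<close>, since for \<open>p = \<infinity>\<close> it may be infinite even for a
  trigonometric polynomial, a weight being merely integrable. For \<open>p = \<infinity>\<close> the weight multiplies
  the function inside the essential supremum.
\<close>

definition Lp_norm :: "ennreal \<Rightarrow> (real \<Rightarrow> real) \<Rightarrow> real set \<Rightarrow> (real \<Rightarrow> complex) \<Rightarrow> ennreal" where
  "Lp_norm p w E f =
     (if p = \<infinity> then esssup (lebesgue_on E) (\<lambda>t. ennreal (norm (f t) * w t))
      else ennreal_powr (\<integral>\<^sup>+t\<in>E. ennreal (norm (f t) powr enn2real p * w t) \<partial>lebesgue)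
             (1 / enn2real p))"

definition class_R :: "ennreal \<Rightarrow> (real \<Rightarrow> real) set" where
  "class_R p = {u. weight u \<and>
     (\<exists>C>0. \<forall>n\<ge>1. \<forall>T. trig_poly n T \<longrightarrow>
        (\<forall>E. E \<in> sets lebesgue \<and> E \<subseteq> circle \<and> measure lebesgue E \<le> 1 \<longrightarrow>
           Lp_norm p u circle T
             \<le> ennreal (exp (C * real n * measure lebesgue E)) * Lp_norm p u (circle - E) T))}"

text \<open>
  \<open>d n\<close> is the \<open>n\<close>-th derivative of \<open>f\<close> on \<open>S\<close>, for all \<open>n\<close>; derivatives are taken within \<open>S\<close>,
  hence one-sided at an end point of an interval. On a nondegenerate interval the family is
  uniquely determined on \<open>S\<close>, and its existence says that \<open>f\<close> is infinitely differentiable there.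
\<close>

definition derivatives_on :: "real set \<Rightarrow> (real \<Rightarrow> real) \<Rightarrow> (nat \<Rightarrow> real \<Rightarrow> real) \<Rightarrow> bool" where
  "derivatives_on S f d \<longleftrightarrow>
     (\<forall>x\<in>S. d 0 x = f x) \<and>
     (\<forall>n. \<forall>x\<in>S. (d n has_real_derivative d (Suc n) x) (at x within S))"

definition Omega_inner :: "real \<Rightarrow> (real \<Rightarrow> real) \<Rightarrow> bool" where
  "Omega_inner A g \<longleftrightarrow>
     periodic_2pi g \<and> (\<forall>t. g t \<in> {-A..A}) \<and>
     (\<exists>d. derivatives_on UNIV g d \<and>
        (\<exists>D>0. \<forall>t. \<forall>n\<ge>1. \<bar>d n t\<bar> \<le> D ^ n * fact n) \<and>
        (\<forall>t. g t = 0 \<longrightarrow> d 1 t \<noteq> 0)) \<and>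
     (\<exists>t. g t = 0)"

text \<open>Only the values of \<open>F\<close> on \<open>[-A, A] - {0}\<close> are constrained.\<close>

definition Omega_outer :: "real \<Rightarrow> (real \<Rightarrow> real) \<Rightarrow> bool" where
  "Omega_outer A F \<longleftrightarrow>
     (\<forall>x\<in>{-A..A} - {0}. 0 < F x \<and> F (- x) = F x) \<and>
     filterlim F at_top (at_right 0) \<and>
     antimono_on {0<..A} F \<and>
     (\<exists>d. derivatives_on {0<..A} F d \<and>
        (\<exists>B>0. \<forall>x\<in>{0<..A}. \<forall>n\<ge>1. \<bar>d n x\<bar> \<le> B ^ n * real n ^ n * F x / x ^ n) \<and>
        (\<exists>A1>0. \<exists>A2>0. \<forall>x\<in>{0<..A}. A2 \<le> \<bar>d 1 x\<bar> * x / F x \<and> \<bar>d 1 x\<bar> * x / F x \<le> A1))"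

definition class_Omega :: "(real \<Rightarrow> real) set" where
  "class_Omega = {\<omega>. \<exists>A>0. \<exists>g F. Omega_inner A g \<and> Omega_outer A F \<and>
     (\<forall>t. \<omega> t = (if g t = 0 then 0 else exp (- F (g t))))}"

end

(*
  Write omega = f^p with f = exp (-F(g)) (f = omega if p is infinite) and let delta solve
  F(delta) = n delta. Near a point at distance x from the zeros of g the function f extends
  holomorphically to a disc of radius comparable to x, with modulus at most exp (-F(x)/2), so Cauchy's
  estimates and an iterated Jackson approximation give, for every N, trigonometric polynomials of
  degree O(n) that approximate f up to exp (-N n delta). On the other hand, the set where
  f < exp (-n delta) has measure O(delta), so removing it costs only a factor exp (O(n delta)) in the
  Remez inequality for u. For p finite, |T|^p omega is therefore compared with |T Q|^p u, where Q is
  such an approximation; constant factors do no harm because the inequality for u bounds the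
  contribution of E by (exp (C n |E|) - 1) times the rest. For p infinite a constant factor would be
  fatal for tiny E; there Q is corrected by a trigonometric polynomial of degree one so that |Q| does
  not exceed f, where f is not too small, and touches it at a prescribed point. Sets of measure
  at least 1/2 are treated separately, since then any factor exp (O(n)) is admissible.
*)

theory Submission
  imports Defs "HOL-Complex_Analysis.Complex_Analysis"
begin

subsection \<open>Trigonometric polynomials\<close>

text \<open>The choice \<open>F \<delta> = n * \<delta>\<close> balances two quantities: removing
  the set \<open>|g| \<le> \<delta>\<close> costs \<open>exp (O(n * \<delta>))\<close>, and
  \<open>f\<close> on it is at most \<open>exp (- F \<delta>)\<close>. The obstacle is that
  \<open>n * |E|\<close> may be far smaller than \<open>n * \<delta>\<close>, so that such a cost is
  not admissible in the final estimate and has to be outweighed by the accuracy of an approximant.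
  This looks circular, since accuracy determines the degree and the degree determines the cost. Two
  approximants break the circle. A coarse one, accurate to \<open>exp (- 2 * n * \<delta>)\<close>
  and made positive by an added constant, fixes the loss \<open>exp (D * n * \<delta>)\<close> once
  and for all. A fine one follows \<open>f\<close> down to \<open>exp (- M * n * \<delta>)\<close>,
  with \<open>M\<close> chosen after \<open>D\<close>; its degree enters only the coefficient of
  \<open>n * |E|\<close>. Where \<open>f\<close> lies below that level, both \<open>f\<close> and
  the fine approximant are dominated by a tiny multiple of the coarse one, and the tiny factor
  cancels the loss.\<close>

lemma trig_poly_monomial:
  assumes "\<bar>k\<bar> \<le> int n"
  shows "trig_poly n (\<lambda>t. a * cis (of_int k * t))"
proof -
  have "(\<Sum>j = - int n..int n. (if j = k then a else 0) * cis (of_int j * t)) = a * cis (of_int k * t)" for t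
  proof -
    have "(\<Sum>j = - int n..int n. (if j = k then a else 0) * cis (of_int j * t)) =
      (\<Sum>j = - int n..int n. if j = k then a * cis (of_int k * t) else 0)"
      by (intro sum.cong) auto
    also have "\<dots> = a * cis (of_int k * t)"
      using assms by (subst sum.delta) auto
    finally show ?thesis .
  qed
  then show ?thesis unfolding trig_poly_def by metis
qed

lemma trig_poly_const: "trig_poly n (\<lambda>t. a)"
  using trig_poly_monomial[of 0 n a] by simp

lemma trig_poly_add:
  assumes "trig_poly n S" "trig_poly n T"
  shows "trig_poly n (\<lambda>t. S t + T t)"
proof -
  obtain c d where "\<forall>t. S t = (\<Sum>k = - int n..int n. c k * cis (of_int k * t))"
    "\<forall>t. T t = (\<Sum>k = - int n..int n. d k * cis (of_int k * t))"
    using assms unfolding trig_poly_def by blast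
  then show ?thesis unfolding trig_poly_def
    by (intro exI[of _ "\<lambda>k. c k + d k"]) (simp add: distrib_right sum.distrib)
qed

lemma trig_poly_sum:
  assumes "\<And>i. i \<in> I \<Longrightarrow> trig_poly n (S i)"
  shows "trig_poly n (\<lambda>t. \<Sum>i\<in>I. S i t)"
  using assms
proof (induction I rule: infinite_finite_induct)
  case (infinite A)
  then show ?case using trig_poly_const[of n 0] by simp
next
  case empty
  then show ?case using trig_poly_const[of n 0] by simp
next
  case (insert x F)
  then show ?case by (simp add: trig_poly_add)
qed

lemma trig_poly_mult:
  assumes "trig_poly n S" "trig_poly m T"
  shows "trig_poly (n + m) (\<lambda>t. S t * T t)"
proof -
  obtain c d where c: "\<And>t. S t = (\<Sum>k = - int n..int n. c k * cis (of_int k * t))"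
    and d: "\<And>t. T t = (\<Sum>k = - int m..int m. d k * cis (of_int k * t))"
    using assms unfolding trig_poly_def by blast
  have "S t * T t = (\<Sum>k = - int n..int n. \<Sum>l = - int m..int m. (c k * d l) * cis (of_int (k + l) * t))" for t
    unfolding c d sum_product by (intro sum.cong refl) (simp add: cis_mult algebra_simps flip: cis_mult)
  moreover have "trig_poly (n + m) (\<lambda>t. \<Sum>k = - int n..int n. \<Sum>l = - int m..int m. (c k * d l) * cis (of_int (k + l) * t))"
    by (intro trig_poly_sum trig_poly_monomial) auto
  ultimately show ?thesis by simp
qed

lemma trig_poly_mono:
  assumes "trig_poly n S" "n \<le> m"
  shows "trig_poly m S"
  using trig_poly_mult[OF assms(1) trig_poly_const[of "m - n" 1]] assms(2) by simp

lemma trig_poly_power: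
  assumes "trig_poly n S"
  shows "trig_poly (k * n) (\<lambda>t. S t ^ k)"
proof (induction k)
  case 0
  then show ?case using trig_poly_const[of 0 1] by simp
next
  case (Suc k)
  then show ?case using trig_poly_mult[OF assms Suc] by simp
qed

lemma trig_poly_cmult: "trig_poly n S \<Longrightarrow> trig_poly n (\<lambda>t. a * S t)"
  using trig_poly_mult[OF trig_poly_const[of 0 a]] by force

lemma trig_poly_diff:
  assumes "trig_poly n S" "trig_poly n T"
  shows "trig_poly n (\<lambda>t. S t - T t)"
  using trig_poly_add[OF assms(1) trig_poly_cmult[OF assms(2), of "-1"]] by simp

lemma trig_poly_cnj:
  assumes "trig_poly n S"
  shows "trig_poly n (\<lambda>t. cnj (S t))"
proof -
  obtain c where c: "\<And>t. S t = (\<Sum>k = - int n..int n. c k * cis (of_int k * t))"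
    using assms unfolding trig_poly_def by blast
  have "cnj (S t) = (\<Sum>k = - int n..int n. cnj (c k) * cis (of_int (- k) * t))" for t
    unfolding c by (simp add: cis_cnj)
  moreover have "trig_poly n (\<lambda>t. \<Sum>k = - int n..int n. cnj (c k) * cis (of_int (- k) * t))"
    by (intro trig_poly_sum trig_poly_monomial) auto
  ultimately show ?thesis by simp
qed

lemma trig_poly_norm_sq:
  assumes "trig_poly n S"
  shows "trig_poly (2 * n) (\<lambda>t. complex_of_real (norm (S t) ^ 2))"
  using trig_poly_mult[OF assms trig_poly_cnj[OF assms]]
  by (simp only: complex_norm_square mult_2)

lemma trig_poly_cos: "trig_poly 1 (\<lambda>t. complex_of_real (cos (t - r)))"
  and trig_poly_sin: "trig_poly 1 (\<lambda>t. complex_of_real (sin (t - r)))"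
proof -
  have 1: "trig_poly 1 (\<lambda>t. cis (t - r))"
    using trig_poly_monomial[of 1 1 "cis (- r)"] by (simp add: cis_mult)
  have "trig_poly 1 (\<lambda>t. (1/2) * (cis (t - r) + cnj (cis (t - r))))"
    by (intro trig_poly_cmult trig_poly_add trig_poly_cnj 1)
  then show "trig_poly 1 (\<lambda>t. complex_of_real (cos (t - r)))"
    by (simp add: complex_add_cnj)
  have "trig_poly 1 (\<lambda>t. (1/(2*\<i>)) * (cis (t - r) - cnj (cis (t - r))))"
    by (intro trig_poly_cmult trig_poly_diff trig_poly_cnj 1)
  then show "trig_poly 1 (\<lambda>t. complex_of_real (sin (t - r)))"
    by (simp add: complex_diff_cnj mult.assoc[symmetric] mult.commute[of _ \<i>])
qed

lemma trig_poly_continuous: "trig_poly n T \<Longrightarrow> continuous_on S T"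
  unfolding trig_poly_def
  by (elim exE, subst continuous_on_cong[OF refl]) (auto intro!: continuous_intros)

subsection \<open>Periodic functions\<close>

lemma integral_periodic_shift:
  fixes h :: "real \<Rightarrow> 'a::euclidean_space"
  assumes h: "continuous_on UNIV h" and per: "periodic_2pi h"
  shows "integral {a..a + 2 * pi} h = integral {b..b + 2 * pi} h"
proof -
  have *: "integral {a..a + 2 * pi} h = integral {b..b + 2 * pi} h" if "a \<le> b" for a b
  proof -
    have int: "h integrable_on {x..y}" for x y
      by (rule integrable_continuous_real) (rule continuous_on_subset[OF h], simp)
    have 1: "integral {a..b} h + integral {b..b + 2 * pi} h = integral {a..b + 2 * pi} h"
      by (rule Henstock_Kurzweil_Integration.integral_combine) (use that int in auto)
    have 2: "integral {a..a + 2 * pi} h + integral {a + 2 * pi..b + 2 * pi} h = integral {a..b + 2 * pi} h"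
      by (rule Henstock_Kurzweil_Integration.integral_combine) (use that int in auto)
    have 3: "integral {a + 2 * pi..b + 2 * pi} h = integral {a..b} h"
      unfolding integral_shift_Icc_real[symmetric]
      using per by (simp add: periodic_2pi_def comp_def add.commute)
    show ?thesis using 1 2 3 by (metis add.commute add_right_cancel)
  qed
  show ?thesis using *[of a b] *[of b a] by (metis linear)
qed

lemma periodic_2pi_of_int:
  assumes "periodic_2pi f"
  shows "f (t + 2 * pi * of_int k) = f t"
proof -
  have p: "f (t + 2 * pi) = f t" for t using assms by (simp add: periodic_2pi_def)
  have n: "f (t + 2 * pi * real n) = f t" for t n
  proof (induction n)
    case (Suc n)
    have "f (t + 2 * pi * real (Suc n)) = f ((t + 2 * pi * real n) + 2 * pi)" by (simp add: algebra_simps)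
    then show ?case using Suc p by simp
  qed simp
  show ?thesis
  proof (cases "k \<ge> 0")
    case True
    then show ?thesis using n[of t "nat k"] by simp
  next
    case False
    then show ?thesis using n[of "t + 2 * pi * of_int k" "nat (- k)"] by (simp add: algebra_simps)
  qed
qed

subsection \<open>The Jackson kernel\<close>

text \<open>Jordan's inequality: sine is concave on this interval and lies above its chord.\<close>

lemma jordan_sin_ge:
  assumes "0 \<le> x" "x \<le> pi / 2"
  shows "2 / pi * x \<le> sin x"
proof -
  have "concave_on {0..pi / 2} sin"
    by (rule f''_le0_imp_concave[where f' = cos and f'' = "\<lambda>x. - sin x"])
       (auto intro!: derivative_eq_intros sin_ge_zero)
  then have "(1 - 2 / pi * x) * sin 0 + 2 / pi * x * sin (pi / 2) \<le>
      sin ((1 - 2 / pi * x) *\<^sub>R 0 + (2 / pi * x) *\<^sub>R (pi / 2))"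
    by (rule concave_onD) (use assms in \<open>auto simp: field_simps\<close>)
  then show ?thesis by simp
qed

text \<open>A one-sided Dirichlet sum. \<open>|geo N t|^2\<close> is \<open>N\<close> times the
  Fejer kernel, and the fourth power of the modulus, normalised, is the Jackson kernel.\<close>

definition geo :: "nat \<Rightarrow> real \<Rightarrow> complex" where
  "geo N t = (\<Sum>j<N. cis (real j * t))"

lemma trig_poly_geo: "trig_poly N (geo N)"
  unfolding geo_def
  by (intro trig_poly_sum) (use trig_poly_monomial[of "int j" N 1 for j] in force)

text \<open>The geometric series gives \<open>(1 - cis t) * geo N t = 1 - cis (N * t)\<close>, of
  modulus at most 2, while \<open>|1 - cis t| = 2 * |sin (t / 2)|\<close> is at least
  \<open>2 * |t| / pi\<close>. The product form includes \<open>t = 0\<close>.\<close>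

lemma norm_geo_decay:
  assumes "\<bar>t\<bar> \<le> pi"
  shows "\<bar>t\<bar> * norm (geo N t) \<le> pi"
proof -
  have "(1 - cis t) * geo N t = 1 - cis (real N * t)"
    unfolding geo_def using one_diff_power_eq[of "cis t" N] by (simp add: Complex.DeMoivre)
  then have "norm (1 - cis t) * norm (geo N t) = norm (1 - cis (real N * t))"
    by (metis norm_mult)
  also have "\<dots> \<le> 2" using norm_triangle_ineq4[of 1 "cis (real N * t)"] by simp
  finally have 1: "norm (1 - cis t) * norm (geo N t) \<le> 2" .
  have "norm (1 - cis t) = 2 * \<bar>sin (t / 2)\<bar>"
    using norm_exp_i_times dist_exp_i_1[of t] by (simp add: cis_conv_exp norm_minus_commute)
  moreover have "\<bar>sin (t / 2)\<bar> \<ge> \<bar>t\<bar> / pi"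
  proof -
    have "\<bar>sin (t / 2)\<bar> = \<bar>sin (\<bar>t\<bar> / 2)\<bar>" by (simp add: abs_if)
    moreover have "sin (\<bar>t\<bar> / 2) \<ge> 2 / pi * (\<bar>t\<bar> / 2)"
      using jordan_sin_ge[of "\<bar>t\<bar> / 2"] assms by auto
    ultimately show ?thesis by simp
  qed
  ultimately have "2 * \<bar>t\<bar> / pi \<le> norm (1 - cis t)" by simp
  then have "2 * \<bar>t\<bar> / pi * norm (geo N t) \<le> 2"
    using 1 mult_right_mono[of "2 * \<bar>t\<bar> / pi" "norm (1 - cis t)" "norm (geo N t)"] by simp
  then show ?thesis by (simp add: field_simps)
qed

lemma periodic_geo: "periodic_2pi (geo N)"
proof -
  have "cis (real j * (t + 2 * pi)) = cis (real j * t)" for j t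
    using cis_multiple_2pi[of "real j"] by (simp add: distrib_left mult.commute flip: cis_mult)
  then show ?thesis by (simp add: periodic_2pi_def geo_def)
qed

lemma continuous_on_geo [continuous_intros]:
  "continuous_on S g \<Longrightarrow> continuous_on S (\<lambda>x. geo N (g x))"
  unfolding geo_def by (intro continuous_intros)

lemma integral_complex_of_real:
  "f integrable_on S \<Longrightarrow> integral S (\<lambda>x. complex_of_real (f x)) = complex_of_real (integral S f)"
  using integral_linear[OF _ bounded_linear_of_real, of f S] by (simp add: comp_def)

lemma integral_cis:
  assumes "k \<noteq> 0"
  shows "integral {- pi..pi} (\<lambda>t. cis (of_int k * t)) = 0"
proof -
  have "((\<lambda>t. cis (of_int k * t)) has_integral
      (cis (of_int k * pi) / (\<i> * of_int k) - cis (of_int k * (- pi)) / (\<i> * of_int k))) {- pi..pi}"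
    by (rule fundamental_theorem_of_calculus)
       (use assms in \<open>auto simp: cis_conv_exp mult_ac intro!: derivative_eq_intros has_vector_derivative_real_field\<close>)
  moreover have "cis (of_int k * pi) = cis (of_int k * (- pi))"
    using cis_multiple_2pi[of "of_int k"] cis_mult[of "of_int k * (- pi)" "2 * pi * of_int k"]
    by (simp add: algebra_simps)
  ultimately show ?thesis by (simp add: integral_unique)
qed

text \<open>Parseval: only the \<open>N\<close> diagonal terms of the double sum survive
  integration.\<close>

lemma integral_norm_geo_sq: "integral {- pi..pi} (\<lambda>t. norm (geo N t) ^ 2) = 2 * pi * real N"
proof -
  have eq: "complex_of_real (norm (geo N t) ^ 2) = (\<Sum>a<N. \<Sum>b<N. cis (of_int (int a - int b) * t))" for t
    unfolding complex_norm_square geo_def cnj_sum sum_product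
    by (intro sum.cong refl) (simp add: cis_cnj cis_mult algebra_simps)
  have int: "(\<lambda>t. cis (of_int k * t)) integrable_on {- pi..pi}" for k
    by (intro integrable_continuous_real continuous_intros)
  have ab: "integral {- pi..pi} (\<lambda>t. cis (of_int (int a - int b) * t)) = (if a = b then of_real (2 * pi) else 0)" for a b
    using integral_cis[of "int a - int b"] by (auto simp: scaleR_conv_of_real)
  have "complex_of_real (integral {- pi..pi} (\<lambda>t. norm (geo N t) ^ 2)) =
      integral {- pi..pi} (\<lambda>t. complex_of_real (norm (geo N t) ^ 2))"
    by (intro integral_complex_of_real[symmetric] integrable_continuous_real continuous_intros)
  also have "\<dots> = (\<Sum>a<N. \<Sum>b<N. integral {- pi..pi} (\<lambda>t. cis (of_int (int a - int b) * t)))"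
    unfolding eq by (simp add: integral_sum int integrable_sum del: of_int_diff)
  also have "\<dots> = (\<Sum>a<N. of_real (2 * pi))"
    unfolding ab by (simp add: sum.delta')
  also have "\<dots> = of_real (2 * pi * real N)" by simp
  finally show ?thesis by (simp only: of_real_eq_iff)
qed

definition jackson_mass :: "nat \<Rightarrow> real" where
  "jackson_mass N = integral {- pi..pi} (\<lambda>t. norm (geo N t) ^ 4)"

text \<open>For \<open>|t| \<le> 1 / N\<close> all angles \<open>j * t\<close> have modulus at most
  1, so every cosine is at least 1/2 and \<open>|geo N t| \<ge> N / 2\<close>. The fourth power,
  integrated over an interval of length \<open>2 / N\<close>, gives \<open>N^3 / 8\<close>.\<close>

lemma jackson_mass_ge:
  assumes "N \<ge> 1"
  shows "real N ^ 3 / 8 \<le> jackson_mass N"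
proof -
  have N: "1 / real N \<le> 1" "0 < 1 / real N" using assms by auto
  have ge: "(real N / 2) ^ 4 \<le> norm (geo N t) ^ 4" if "t \<in> {- (1 / real N)..1 / real N}" for t
  proof -
    have "1/2 \<le> cos (real j * t)" if "j < N" for j
    proof -
      have "\<bar>real j * t\<bar> \<le> real N * (1 / real N)"
        unfolding abs_mult using \<open>t \<in> _\<close> that by (intro mult_mono) auto
      then have "\<bar>real j * t\<bar> \<le> 1" using assms by simp
      then have "(real j * t)^2 \<le> 1" by (simp add: abs_square_le_1)
      moreover have "1 - (real j * t)^2 / 2 \<le> cos (real j * t)"
        using cos_double_sin[of "real j * t / 2"] abs_sin_x_le_abs_x[of "real j * t / 2"]
          power_mono[of "\<bar>sin (real j * t / 2)\<bar>" "\<bar>real j * t / 2\<bar>" 2]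
        by (simp add: power_divide)
      ultimately show ?thesis by simp
    qed
    then have "(\<Sum>j<N. 1/2) \<le> (\<Sum>j<N. cos (real j * t))" by (intro sum_mono) auto
    also have "\<dots> = Re (geo N t)" by (simp add: geo_def)
    also have "\<dots> \<le> norm (geo N t)" by (rule complex_Re_le_cmod)
    finally show ?thesis by (intro power_mono) auto
  qed
  have "real N ^ 3 / 8 = integral {- (1 / real N)..1 / real N} (\<lambda>t. (real N / 2) ^ 4)"
    using assms by (simp add: field_simps eval_nat_numeral)
  also have "\<dots> \<le> integral {- (1 / real N)..1 / real N} (\<lambda>t. norm (geo N t) ^ 4)"
    by (intro integral_le ge integrable_continuous_real continuous_intros) 
  also have "\<dots> \<le> jackson_mass N"
    unfolding jackson_mass_def
    by (intro integral_subset_le integrable_continuous_real continuous_intros)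
       (use order_trans[OF N(1), of pi] pi_gt3 in auto)
  finally show ?thesis .
qed

definition jackson_kernel :: "nat \<Rightarrow> real \<Rightarrow> real" where
  "jackson_kernel N t = norm (geo N t) ^ 4 / jackson_mass N"

lemma continuous_on_jackson_kernel [continuous_intros]:
  "continuous_on S g \<Longrightarrow> continuous_on S (\<lambda>x. jackson_kernel N (g x))"
  unfolding jackson_kernel_def divide_inverse by (intro continuous_intros)

lemma periodic_jackson_kernel: "periodic_2pi (jackson_kernel N)"
  using periodic_geo[of N] by (simp add: periodic_2pi_def jackson_kernel_def)

lemma jackson_kernel_nonneg: "N \<ge> 1 \<Longrightarrow> 0 \<le> jackson_kernel N t"
  unfolding jackson_kernel_def using order_trans[OF _ jackson_mass_ge[of N], of 0] by simp

lemma trig_poly_jackson_kernel: "trig_poly (4 * N) (\<lambda>t. complex_of_real (jackson_kernel N t))"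
proof -
  have "trig_poly (2 * (2 * N)) (\<lambda>t. complex_of_real (norm (geo N t ^ 2) ^ 2))"
    by (intro trig_poly_norm_sq trig_poly_power trig_poly_geo)
  from trig_poly_cmult[OF this, of "1 / complex_of_real (jackson_mass N)"] show ?thesis
    by (simp add: jackson_kernel_def norm_power flip: power_mult)
qed

text \<open>The summand 1 belongs to the part of the first moment that is a multiple of the kernel
  itself; \<open>16 * pi ^ 3\<close> is \<open>2 * pi ^ 3\<close> from the second moment times the 8
  of \<open>jackson_mass_ge\<close>.\<close>

definition jackson_const :: real where
  "jackson_const = 1 + 16 * pi ^ 3"

lemma jackson_const_ge_1: "1 \<le> jackson_const"
  by (simp add: jackson_const_def)

lemma integral_jackson_kernel:
  assumes "N \<ge> 1"
  shows "integral {- pi..pi} (jackson_kernel N) = 1"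
proof -
  have "jackson_mass N \<noteq> 0"
    using jackson_mass_ge[OF assms] assms by (auto simp: field_simps)
  then show ?thesis
    unfolding jackson_kernel_def using jackson_mass_def[of N] by simp
qed

text \<open>The first moment is dominated through \<open>\<bar>t\<bar> \<le> (1 + N\<^sup>2 t\<^sup>2) / (2 N)\<close>, and the second one through
  \<open>t\<^sup>2 \<bar>geo N t\<bar>\<^sup>4 \<le> \<pi>\<^sup>2 \<bar>geo N t\<bar>\<^sup>2\<close> and orthogonality.\<close>

lemma jackson_kernel_moment:
  assumes "N \<ge> 1"
  shows "integral {- pi..pi} (\<lambda>t. jackson_kernel N t * \<bar>t\<bar>) \<le> jackson_const / real N"
proof -
  have m: "jackson_mass N > 0" "real N ^ 3 \<le> 8 * jackson_mass N"
    using jackson_mass_ge[OF assms] assms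
    by (auto simp: field_simps intro: less_le_trans[of _ "real N ^ 3 / 8"])
  have le: "norm (geo N t) ^ 4 * \<bar>t\<bar> \<le> (1 / real N) * norm (geo N t) ^ 4 + real N * pi ^ 2 * norm (geo N t) ^ 2"
    if "t \<in> {- pi..pi}" for t
  proof -
    have 1: "\<bar>t\<bar> \<le> 1 / real N + real N * t ^ 2"
    proof -
      have "0 \<le> (real N * \<bar>t\<bar> - 1)^2" by simp
      then have "2 * (real N * \<bar>t\<bar>) \<le> 1 + real N ^ 2 * t ^ 2"
        by (simp add: power2_diff power_mult_distrib)
      then have "real N * \<bar>t\<bar> \<le> 1 + real N ^ 2 * t ^ 2"
        using mult_nonneg_nonneg[of "real N" "\<bar>t\<bar>"] by linarith
      then show ?thesis using assms by (simp add: field_simps power2_eq_square)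
    qed
    have "\<bar>t\<bar> * norm (geo N t) \<le> pi" using that by (intro norm_geo_decay) auto
    then have "(\<bar>t\<bar> * norm (geo N t)) ^ 2 \<le> pi ^ 2" by (intro power_mono) auto
    then have "(\<bar>t\<bar> * norm (geo N t)) ^ 2 * norm (geo N t) ^ 2 \<le> pi ^ 2 * norm (geo N t) ^ 2"
      by (intro mult_right_mono) auto
    then have 2: "t ^ 2 * norm (geo N t) ^ 4 \<le> pi ^ 2 * norm (geo N t) ^ 2"
      by (simp add: power_mult_distrib mult.assoc flip: power_add)
    have "norm (geo N t) ^ 4 * \<bar>t\<bar> \<le> norm (geo N t) ^ 4 * (1 / real N + real N * t ^ 2)"
      using 1 by (intro mult_left_mono) auto
    also have "\<dots> = (1 / real N) * norm (geo N t) ^ 4 + real N * (t ^ 2 * norm (geo N t) ^ 4)"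
      by (simp add: algebra_simps)
    also have "\<dots> \<le> (1 / real N) * norm (geo N t) ^ 4 + real N * (pi ^ 2 * norm (geo N t) ^ 2)"
      using 2 by (intro add_left_mono mult_left_mono) auto
    finally show ?thesis by simp
  qed
  have "integral {- pi..pi} (\<lambda>t. norm (geo N t) ^ 4 * \<bar>t\<bar>) \<le>
      integral {- pi..pi} (\<lambda>t. (1 / real N) * norm (geo N t) ^ 4 + real N * pi ^ 2 * norm (geo N t) ^ 2)"
    by (intro integral_le le integrable_continuous_real continuous_intros)
  also have "\<dots> = integral {- pi..pi} (\<lambda>t. (1 / real N) * norm (geo N t) ^ 4) +
      integral {- pi..pi} (\<lambda>t. real N * pi ^ 2 * norm (geo N t) ^ 2)"
    by (intro Henstock_Kurzweil_Integration.integral_add integrable_continuous_real continuous_intros)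
  also have "\<dots> = (1 / real N) * jackson_mass N + real N * pi ^ 2 * (2 * pi * real N)"
    by (simp add: jackson_mass_def integral_norm_geo_sq)
  also have "\<dots> = (jackson_mass N + 2 * pi ^ 3 * real N ^ 3) / real N"
    using assms by (simp add: field_simps power2_eq_square power3_eq_cube)
  also have "\<dots> \<le> (jackson_mass N + 2 * pi ^ 3 * (8 * jackson_mass N)) / real N"
    using m(2) by (intro divide_right_mono add_left_mono mult_left_mono) auto
  also have "\<dots> = jackson_const / real N * jackson_mass N"
    by (simp add: jackson_const_def algebra_simps add_divide_distrib)
  finally have "integral {- pi..pi} (\<lambda>t. norm (geo N t) ^ 4 * \<bar>t\<bar>) \<le> jackson_const / real N * jackson_mass N" .
  then show ?thesis using m(1)
    by (simp add: jackson_kernel_def pos_divide_le_eq)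
qed

subsection \<open>Iterated Jackson approximation\<close>

text \<open>The whole derivative family is carried along because the approximation below acts on all
  derivatives at once.\<close>

definition smooth_periodic :: "(nat \<Rightarrow> real \<Rightarrow> real) \<Rightarrow> bool" where
  "smooth_periodic d \<longleftrightarrow>
     (\<forall>i. periodic_2pi (d i)) \<and> (\<forall>i t. (d i has_real_derivative d (Suc i) t) (at t))"

lemma smooth_periodic_continuous: "smooth_periodic d \<Longrightarrow> continuous_on S (d i)"
  unfolding smooth_periodic_def
  by (meson DERIV_continuous_on has_field_derivative_at_within)

definition jackson_op :: "nat \<Rightarrow> (real \<Rightarrow> real) \<Rightarrow> real \<Rightarrow> real" where
  "jackson_op N f t = integral {- pi..pi} (\<lambda>s. jackson_kernel N s * f (t - s))"

text \<open>A reflection and a shift move \<open>t\<close> from the argument of \<open>f\<close>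
  into the kernel, and periodicity restores the interval \<open>[- pi, pi]\<close>. The translated
  kernel is a trigonometric polynomial in \<open>t\<close> whose coefficients depend on
  \<open>s\<close>.\<close>

lemma jackson_op_trig_poly:
  assumes f: "continuous_on UNIV f" "periodic_2pi f"
  shows "trig_poly (4 * N) (\<lambda>t. complex_of_real (jackson_op N f t))"
proof -
  have fc [continuous_intros]: "continuous_on S g \<Longrightarrow> continuous_on S (\<lambda>x. f (g x))" for S :: "real set" and g
    by (rule continuous_on_compose2[OF f(1)]) auto
  have sym: "jackson_op N f t = integral {- pi..pi} (\<lambda>s. jackson_kernel N (t - s) * f s)" for t
  proof -
    define h where "h = (\<lambda>x. jackson_kernel N (t - x) * f x)"
    have "jackson_op N f t = integral {- pi..pi} (\<lambda>s. h (t - s))"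
      by (simp add: jackson_op_def h_def)
    also have "\<dots> = integral {- pi..- (- pi)} (\<lambda>s. h (t - (- s)))"
      using Henstock_Kurzweil_Integration.integral_reflect_real[of "pi" "- pi" "\<lambda>s. h (t - (- s))"] by simp
    also have "\<dots> = integral {- pi + t..pi + t} h"
      using integral_shift_Icc_real[of "- pi" pi h t] by (simp add: comp_def)
    also have "\<dots> = integral {- pi + t..(- pi + t) + 2 * pi} h" by simp
    also have "\<dots> = integral {- pi..(- pi) + 2 * pi} h"
    proof (rule integral_periodic_shift)
      show "continuous_on UNIV h" unfolding h_def by (intro continuous_intros)
      have "jackson_kernel N (t - (x + 2 * pi)) = jackson_kernel N (t - x)" for x
        using periodic_2pi_of_int[OF periodic_jackson_kernel, of N "t - x" "-1"] by (simp add: algebra_simps)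
      then show "periodic_2pi h" using f(2) by (simp add: periodic_2pi_def h_def)
    qed
    finally show ?thesis by (simp add: h_def)
  qed
  obtain c where c: "\<And>t. complex_of_real (jackson_kernel N t) = (\<Sum>k = - int (4 * N)..int (4 * N). c k * cis (of_int k * t))"
    using trig_poly_jackson_kernel[of N] unfolding trig_poly_def by blast
  have int: "(\<lambda>s. c k * cis (- of_int k * s) * complex_of_real (f s)) integrable_on {- pi..pi}" for k
    by (intro integrable_continuous_real continuous_intros)
  have "complex_of_real (jackson_op N f t) =
      (\<Sum>k = - int (4 * N)..int (4 * N). integral {- pi..pi} (\<lambda>s. c k * cis (- of_int k * s) * complex_of_real (f s)) * cis (of_int k * t))" for t
  proof -
    have "complex_of_real (jackson_op N f t) = integral {- pi..pi} (\<lambda>s. complex_of_real (jackson_kernel N (t - s) * f s))"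
      unfolding sym by (intro integral_complex_of_real[symmetric] integrable_continuous_real continuous_intros)
    also have "\<dots> = integral {- pi..pi} (\<lambda>s. \<Sum>k = - int (4 * N)..int (4 * N). c k * cis (- of_int k * s) * complex_of_real (f s) * cis (of_int k * t))"
      unfolding of_real_mult c sum_distrib_right
      by (intro integral_cong sum.cong refl) (simp add: right_diff_distrib cis_divide[symmetric] cis_mult field_simps flip: cis_inverse)
    also have "\<dots> = (\<Sum>k = - int (4 * N)..int (4 * N). integral {- pi..pi} (\<lambda>s. c k * cis (- of_int k * s) * complex_of_real (f s) * cis (of_int k * t)))"
      by (intro integral_sum integrable_continuous_real continuous_intros) auto
    finally show ?thesis by simp
  qed
  then show ?thesis unfolding trig_poly_def by (intro exI allI)
qed

text \<open>With \<open>t\<close> in the argument of \<open>d i\<close>, differentiation under the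
  integral falls on \<open>d i\<close>: the operator commutes with differentiation.\<close>

lemma jackson_op_smooth_periodic:
  assumes d: "smooth_periodic d"
  shows "smooth_periodic (\<lambda>i. jackson_op N (d i))"
proof -
  have dc [continuous_intros]: "continuous_on S g \<Longrightarrow> continuous_on S (\<lambda>x. d i (g x))"
    for S :: "'b::topological_space set" and g i
    by (rule continuous_on_compose2[OF smooth_periodic_continuous[OF d]]) auto
  have der: "(d i has_real_derivative d (Suc i) t) (at t)" for i t
    using d by (simp add: smooth_periodic_def)
  have "periodic_2pi (jackson_op N (d i))" for i
  proof -
    have "d i (t + 2 * pi - s) = d i (t - s)" for t s
      using periodic_2pi_of_int[of "d i" "t - s" 1] d by (simp add: smooth_periodic_def algebra_simps)
    then show ?thesis by (simp add: periodic_2pi_def jackson_op_def)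
  qed
  moreover have "(jackson_op N (d i) has_real_derivative jackson_op N (d (Suc i)) t) (at t)" for i t
    unfolding jackson_op_def interval_cbox
    by (rule leibniz_rule_field_derivative[where U = UNIV, simplified])
       (auto intro!: derivative_eq_intros DERIV_chain2[OF der] continuous_intros integrable_continuous_real
         simp: split_beta interval_cbox[symmetric])
  ultimately show ?thesis unfolding smooth_periodic_def by blast
qed

text \<open>Since the kernel has integral 1, the error is the kernel average of
  \<open>d i t - d i (t - s)\<close>, which is at most \<open>M * |s|\<close> in modulus; the first
  moment of the kernel finishes.\<close>

lemma jackson_op_error:
  assumes d: "smooth_periodic d" and N: "N \<ge> 1" and M: "\<And>t. \<bar>d (Suc i) t\<bar> \<le> M"
  shows "\<bar>d i t - jackson_op N (d i) t\<bar> \<le> jackson_const / real N * M"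
proof -
  have dc [continuous_intros]: "continuous_on S g \<Longrightarrow> continuous_on S (\<lambda>x. d i (g x))"
    for S :: "real set" and g
    by (rule continuous_on_compose2[OF smooth_periodic_continuous[OF d]]) auto
  have der: "(d i has_real_derivative d (Suc i) t) (at t)" for t
    using d by (simp add: smooth_periodic_def)
  have lip: "\<bar>d i t - d i (t - s)\<bar> \<le> M * \<bar>s\<bar>" for s
    using field_differentiable_bound[of UNIV "d i" "d (Suc i)" M t "t - s"] der M by simp
  have "d i t = integral {- pi..pi} (\<lambda>s. jackson_kernel N s * d i t)"
    using integral_jackson_kernel[OF N] by simp
  then have "d i t - jackson_op N (d i) t =
      integral {- pi..pi} (\<lambda>s. jackson_kernel N s * d i t) - integral {- pi..pi} (\<lambda>s. jackson_kernel N s * d i (t - s))"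
    by (simp only: jackson_op_def)
  also have "\<dots> = integral {- pi..pi} (\<lambda>s. jackson_kernel N s * d i t - jackson_kernel N s * d i (t - s))"
    by (intro Henstock_Kurzweil_Integration.integral_diff[symmetric] integrable_continuous_real continuous_intros)
  also have "norm \<dots> \<le> integral {- pi..pi} (\<lambda>s. M * (jackson_kernel N s * \<bar>s\<bar>))"
  proof (intro integral_norm_bound_integral integrable_continuous_real continuous_intros)
    fix s
    have "norm (jackson_kernel N s * d i t - jackson_kernel N s * d i (t - s)) = jackson_kernel N s * \<bar>d i t - d i (t - s)\<bar>"
      using jackson_kernel_nonneg[OF N, of s] by (simp add: abs_mult flip: right_diff_distrib)
    also have "\<dots> \<le> jackson_kernel N s * (M * \<bar>s\<bar>)"
      by (intro mult_left_mono lip jackson_kernel_nonneg N)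
    finally show "norm (jackson_kernel N s * d i t - jackson_kernel N s * d i (t - s)) \<le> M * (jackson_kernel N s * \<bar>s\<bar>)"
      by (simp add: mult_ac)
  qed
  also have "\<dots> = M * integral {- pi..pi} (\<lambda>s. jackson_kernel N s * \<bar>s\<bar>)" by simp
  also have "\<dots> \<le> M * (jackson_const / real N)"
    using M[of 0] by (intro mult_left_mono jackson_kernel_moment N) auto
  finally show ?thesis by (simp add: mult.commute)
qed

text \<open>The family \<open>e\<close> is the \<open>k\<close>-fold application of identity minus
  \<open>jackson_op N\<close>. As this commutes with differentiation, each application trades one
  derivative for a factor \<open>jackson_const / N\<close>; as every correction has degree at most
  \<open>4 * N\<close>, the degree does not grow with \<open>k\<close>, and \<open>k\<close> may be
  chosen as large as the derivative bounds permit.\<close>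

lemma iterated_jackson:
  assumes d: "smooth_periodic d" and N: "N \<ge> 1"
  shows "\<exists>e. smooth_periodic e \<and> trig_poly (4 * N) (\<lambda>t. complex_of_real (d 0 t - e 0 t)) \<and>
    (\<forall>i M. (\<forall>t. \<bar>d (i + k) t\<bar> \<le> M) \<longrightarrow> (\<forall>t. \<bar>e i t\<bar> \<le> (jackson_const / real N) ^ k * M))"
proof (induction k)
  case 0
  show ?case using d trig_poly_const[of "4 * N" 0] by (intro exI[of _ d]) auto
next
  case (Suc k)
  then obtain e where e: "smooth_periodic e" "trig_poly (4 * N) (\<lambda>t. complex_of_real (d 0 t - e 0 t))"
    "\<And>i M t. (\<And>t. \<bar>d (i + k) t\<bar> \<le> M) \<Longrightarrow> \<bar>e i t\<bar> \<le> (jackson_const / real N) ^ k * M"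
    by blast
  let ?e = "\<lambda>i t. e i t - jackson_op N (e i) t"
  have "smooth_periodic ?e"
    using e(1) jackson_op_smooth_periodic[OF e(1), of N] unfolding smooth_periodic_def
    by (auto simp: periodic_2pi_def intro!: DERIV_diff)
  moreover have "trig_poly (4 * N) (\<lambda>t. complex_of_real (d 0 t - ?e 0 t))"
    using trig_poly_add[OF e(2) jackson_op_trig_poly[of "e 0" N]] e(1)
    by (simp add: smooth_periodic_continuous smooth_periodic_def algebra_simps)
  moreover have "\<bar>?e i t\<bar> \<le> (jackson_const / real N) ^ Suc k * M" if M: "\<And>t. \<bar>d (i + Suc k) t\<bar> \<le> M" for i M t
  proof -
    have "\<bar>e (Suc i) t\<bar> \<le> (jackson_const / real N) ^ k * M" for t
      by (rule e(3)) (use M in simp)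
    from jackson_op_error[OF e(1) N this, of t] show ?thesis by simp
  qed
  ultimately show ?case by (intro exI[of _ ?e]) blast
qed

subsection \<open>Holomorphic extension and Cauchy estimates\<close>

text \<open>\<open>k ^ k / fact k\<close> is a single term of the exponential series at
  \<open>k\<close>.\<close>

lemma power_self_le_exp_fact: "real k ^ k \<le> exp 1 ^ k * fact k"
proof -
  have "(\<Sum>n\<in>{k}. real k ^ n /\<^sub>R fact n) \<le> exp (real k)"
    unfolding exp_def by (intro sum_le_suminf summable_exp_generic) auto
  then show ?thesis
    by (simp add: field_simps flip: exp_of_nat_mult)
qed

text \<open>\<open>\<Phi>\<close> is the Taylor series at \<open>x0\<close>. The bounds on all of
  \<open>S\<close>, with constant \<open>K\<close>, force the remainder to vanish and identify
  \<open>\<Phi>\<close> with \<open>d 0\<close>; the bounds at \<open>x0\<close> alone, with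
  constant \<open>K0\<close>, control its size. The constants are kept apart because for the outer
  function the first one is \<open>F (x0 / 2)\<close>, while the size estimate has to be in terms of
  \<open>F x0\<close>.\<close>

lemma holomorphic_extension_of_derivative_bounds:
  fixes d :: "nat \<Rightarrow> real \<Rightarrow> real"
  assumes S: "convex S" "x0 \<in> S"
    and der: "\<And>i x. x \<in> S \<Longrightarrow> (d i has_real_derivative d (Suc i) x) (at x within S)"
    and K: "\<And>i x. x \<in> S \<Longrightarrow> \<bar>d i x\<bar> \<le> K * R ^ i * fact i"
    and K0: "\<And>i. i \<ge> 1 \<Longrightarrow> \<bar>d i x0\<bar> \<le> K0 * R ^ i * fact i"
    and R: "R > 0"
  obtains \<Phi> where "\<Phi> holomorphic_on ball (of_real x0) (1 / R)"
    and "\<And>y. y \<in> S \<Longrightarrow> \<bar>y - x0\<bar> < 1 / R \<Longrightarrow> \<Phi> (of_real y) = of_real (d 0 y)"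
    and "\<And>w. w \<in> ball (of_real x0) (1 / R) \<Longrightarrow>
      norm (\<Phi> w - of_real (d 0 x0)) \<le> K0 * (R * norm (w - of_real x0)) / (1 - R * norm (w - of_real x0))"
proof -
  define a where "a i = d i x0 / fact i" for i
  define \<Phi> where "\<Phi> w = (\<Sum>i. complex_of_real (a i) * (w - of_real x0) ^ i)" for w
  have a: "\<bar>a i\<bar> \<le> K * R ^ i" for i
    using K[OF S(2), of i] by (simp add: a_def abs_divide pos_divide_le_eq)
  have a0: "\<bar>a i\<bar> \<le> K0 * R ^ i" if "i \<ge> 1" for i
    using K0[OF that] by (simp add: a_def abs_divide pos_divide_le_eq)
  have q: "R * norm (w - of_real x0) < 1" if "w \<in> ball (of_real x0) (1 / R)" for w
    using that R by (simp add: dist_norm norm_minus_commute field_simps)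
  have sums: "(\<lambda>i. complex_of_real (a i) * (w - of_real x0) ^ i) sums \<Phi> w"
    if "w \<in> ball (of_real x0) (1 / R)" for w
    unfolding \<Phi>_def
  proof (rule summable_sums, rule summable_comparison_test)
    show "\<exists>N. \<forall>n\<ge>N. norm (complex_of_real (a n) * (w - of_real x0) ^ n) \<le> K * (R * norm (w - of_real x0)) ^ n"
      using a by (auto simp: norm_mult norm_power power_mult_distrib mult.assoc[symmetric] intro!: mult_right_mono)
    show "summable (\<lambda>n. K * (R * norm (w - of_real x0)) ^ n)"
      using q[OF that] R by (intro summable_mult summable_geometric) auto
  qed
  show thesis
  proof
    show "\<Phi> holomorphic_on ball (of_real x0) (1 / R)"
      by (rule power_series_holomorphic[OF sums])
    show "\<Phi> (of_real y) = of_real (d 0 y)" if y: "y \<in> S" "\<bar>y - x0\<bar> < 1 / R" for y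
    proof -
      define q where "q = R * \<bar>y - x0\<bar>"
      have q1: "0 \<le> q" "q < 1" using y(2) R by (auto simp: q_def field_simps)
      have "(\<lambda>i. a i * (y - x0) ^ i) sums d 0 y"
        unfolding sums_def_le
      proof (rule LIM_zero_cancel, rule Lim_null_comparison)
        show "\<forall>\<^sub>F n in sequentially. norm ((\<Sum>i\<le>n. a i * (y - x0) ^ i) - d 0 y) \<le> K * (real (Suc n) * q ^ Suc n)"
        proof (intro always_eventually allI)
          fix n
          \<comment> \<open>\<open>field_Taylor\<close> has \<open>fact n\<close> rather than
            \<open>fact (Suc n)\<close> in its remainder; the surplus factor \<open>Suc n\<close> is
            harmless, as \<open>n * q ^ n\<close> tends to 0.\<close>
          have "norm (d 0 y - (\<Sum>i\<le>n. d i x0 * (y - x0) ^ i / fact i)) \<le> (K * R ^ Suc n * fact (Suc n)) * norm (y - x0) ^ Suc n / fact n"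
            by (rule field_Taylor[OF S(1)]) (use der K S y in \<open>auto simp del: power_Suc fact_Suc\<close>)
          also have "\<dots> = K * (real (Suc n) * q ^ Suc n)"
            by (simp add: q_def power_mult_distrib field_simps)
          finally show "norm ((\<Sum>i\<le>n. a i * (y - x0) ^ i) - d 0 y) \<le> K * (real (Suc n) * q ^ Suc n)"
            by (simp add: a_def abs_minus_commute mult.commute)
        qed
        have "(\<lambda>n. real n * q ^ n) \<longlonglongrightarrow> 0"
          using powser_times_n_limit_0[of q] q1 by simp
        then show "(\<lambda>n. K * (real (Suc n) * q ^ Suc n)) \<longlonglongrightarrow> 0"
          by (intro tendsto_mult_right_zero LIMSEQ_Suc)
      qed
      then have "(\<lambda>i. complex_of_real (a i * (y - x0) ^ i)) sums of_real (d 0 y)" by (rule sums_of_real)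
      moreover have "(\<lambda>i. complex_of_real (a i * (y - x0) ^ i)) sums \<Phi> (of_real y)"
        using sums[of "of_real y"] y(2) by (simp add: dist_real_def abs_minus_commute)
      ultimately show ?thesis by (metis sums_unique2)
    qed
    show "norm (\<Phi> w - of_real (d 0 x0)) \<le> K0 * (R * norm (w - of_real x0)) / (1 - R * norm (w - of_real x0))"
      if w: "w \<in> ball (of_real x0) (1 / R)" for w
    proof -
      define q where "q = R * norm (w - of_real x0)"
      have q1: "0 \<le> q" "q < 1" using q[OF w] R by (auto simp: q_def)
      have "(\<Sum>i. complex_of_real (a (Suc i)) * (w - of_real x0) ^ Suc i) = \<Phi> w - of_real (d 0 x0)"
        using suminf_split_head[OF sums_summable[OF sums[OF w]]] by (simp add: \<Phi>_def a_def)
      moreover have "norm (\<Sum>i. complex_of_real (a (Suc i)) * (w - of_real x0) ^ Suc i) \<le> (\<Sum>i. K0 * q * q ^ i)"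
      proof (rule norm_suminf_le)
        fix i
        have "norm (complex_of_real (a (Suc i)) * (w - of_real x0) ^ Suc i) \<le> (K0 * R ^ Suc i) * norm (w - of_real x0) ^ Suc i"
          unfolding norm_mult norm_power norm_of_real by (intro mult_right_mono a0) auto
        also have "\<dots> = K0 * q * q ^ i" by (simp add: q_def power_mult_distrib)
        finally show "norm (complex_of_real (a (Suc i)) * (w - of_real x0) ^ Suc i) \<le> K0 * q * q ^ i" .
        show "summable (\<lambda>i. K0 * q * q ^ i)" using q1 by (intro summable_mult summable_geometric) auto
      qed
      moreover have "(\<Sum>i. K0 * q * q ^ i) = K0 * q / (1 - q)"
        using q1 by (subst suminf_mult) (auto simp: suminf_geometric summable_geometric divide_inverse)
      ultimately show ?thesis by (simp add: q_def)
    qed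
  qed
qed

text \<open>Cauchy's inequality bounds complex derivatives of \<open>H\<close>, whereas real
  derivatives of \<open>f\<close> are wanted. On the real axis they agree order by order: real and
  imaginary parts are differentiated separately, and the imaginary part is constantly 0.\<close>

lemma higher_deriv_of_real:
  fixes f :: "real \<Rightarrow> real"
  assumes H: "H holomorphic_on ball (of_real t0) r"
    and eq: "\<And>t. \<bar>t - t0\<bar> < r \<Longrightarrow> H (of_real t) = of_real (f t)"
    and t: "\<bar>t - t0\<bar> < r"
  shows "(deriv ^^ k) H (of_real t) = of_real ((deriv ^^ k) f t)"
    and "((deriv ^^ k) f has_real_derivative (deriv ^^ Suc k) f t) (at t)"
proof -
  have in_ball: "complex_of_real t \<in> ball (of_real t0) r \<longleftrightarrow> \<bar>t - t0\<bar> < r" for t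
    by (simp add: dist_real_def abs_minus_commute)
  have op: "open {t. \<bar>t - t0\<bar> < r}"
    by (intro open_Collect_less continuous_intros)
  have step: "((deriv ^^ k) f has_real_derivative (deriv ^^ Suc k) f t) (at t) \<and>
      (deriv ^^ Suc k) H (of_real t) = of_real ((deriv ^^ Suc k) f t)"
    if eq: "\<And>t. \<bar>t - t0\<bar> < r \<Longrightarrow> (deriv ^^ k) H (of_real t) = of_real ((deriv ^^ k) f t)"
      and t: "\<bar>t - t0\<bar> < r" for k t
  proof -
    define D where "D = (deriv ^^ Suc k) H (of_real t)"
    have "((deriv ^^ k) H has_field_derivative D) (at (of_real t))"
      unfolding D_def using holomorphic_derivI[OF holomorphic_higher_deriv[OF H open_ball] open_ball] t in_ball
      by (simp del: mem_ball)
    then have vd: "((\<lambda>s. (deriv ^^ k) H (of_real s)) has_vector_derivative D) (at t)"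
      by (rule has_vector_derivative_real_field)
    have Re: "((\<lambda>s. Re ((deriv ^^ k) H (of_real s))) has_real_derivative Re D) (at t)"
      using bounded_linear.has_vector_derivative[OF bounded_linear_Re vd]
      by (simp add: has_real_derivative_iff_has_vector_derivative)
    have Im: "((\<lambda>s. Im ((deriv ^^ k) H (of_real s))) has_real_derivative Im D) (at t)"
      using bounded_linear.has_vector_derivative[OF bounded_linear_Im vd]
      by (simp add: has_real_derivative_iff_has_vector_derivative)
    have 1: "((deriv ^^ k) f has_real_derivative Re D) (at t)"
      by (rule has_field_derivative_transform_within_open[OF Re op]) (use t eq in auto)
    have "((\<lambda>s. 0::real) has_real_derivative Im D) (at t)"
      by (rule has_field_derivative_transform_within_open[OF Im op]) (use t eq in auto)
    then have "Im D = 0" by (metis DERIV_const DERIV_unique)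
    moreover have "(deriv ^^ Suc k) f t = Re D" using 1 by (simp add: DERIV_imp_deriv)
    ultimately show ?thesis using 1 by (simp add: complex_eq_iff D_def)
  qed
  have all: "\<And>t. \<bar>t - t0\<bar> < r \<Longrightarrow> (deriv ^^ k) H (of_real t) = of_real ((deriv ^^ k) f t)" for k
  proof (induction k)
    case 0
    then show ?case using eq by simp
  next
    case (Suc k)
    then show ?case using step by blast
  qed
  show "(deriv ^^ k) H (of_real t) = of_real ((deriv ^^ k) f t)" using all t .
  show "((deriv ^^ k) f has_real_derivative (deriv ^^ Suc k) f t) (at t)" using step[OF all t] by blast
qed

subsection \<open>Derivatives of \<open>exp (- F \<circ> g)\<close>\<close>

text \<open>With \<open>F\<close> as a parameter, a root of a weight is obtained by scaling
  \<open>F\<close>.\<close>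

definition omega_fun :: "(real \<Rightarrow> real) \<Rightarrow> (real \<Rightarrow> real) \<Rightarrow> real \<Rightarrow> real" where
  "omega_fun F g t = (if g t = 0 then 0 else exp (- F (g t)))"

text \<open>The extension is \<open>exp (- \<Phi> (\<sigma> * \<Gamma>))\<close>, where
  \<open>\<Gamma>\<close> is the power series of \<open>g\<close> at \<open>t0\<close> and
  \<open>\<Phi>\<close> that of \<open>F\<close> at \<open>x0 = |g t0|\<close>. Giving up half of
  the exponent allows \<open>\<Phi>\<close> to vary by \<open>F x0 / 2\<close> on the disc.\<close>

lemma omega_fun_derivative_bounds:
  assumes A: "A > 0" and g: "Omega_inner A g" and F: "Omega_outer A F"
  shows "\<exists>\<kappa>>0. \<forall>t k. g t \<noteq> 0 \<longrightarrow>
    ((deriv ^^ k) (omega_fun F g) has_real_derivative (deriv ^^ Suc k) (omega_fun F g) t) (at t) \<and>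
    \<bar>(deriv ^^ k) (omega_fun F g) t\<bar> \<le> fact k * (\<kappa> / \<bar>g t\<bar>) ^ k * exp (- F (g t) / 2)"
proof -
  obtain dg D where dg: "derivatives_on UNIV g dg" and D: "D > 0"
    and dgb: "\<And>t n. n \<ge> 1 \<Longrightarrow> \<bar>dg n t\<bar> \<le> D ^ n * fact n"
    using g unfolding Omega_inner_def by blast
  have gA: "\<bar>g t\<bar> \<le> A" for t using g unfolding Omega_inner_def by (metis abs_le_iff atLeastAtMost_iff minus_le_iff)
  obtain dF B0 where dF: "derivatives_on {0<..A} F dF" and B0: "B0 > 0"
    and dFb0: "\<And>x n. x \<in> {0<..A} \<Longrightarrow> n \<ge> 1 \<Longrightarrow> \<bar>dF n x\<bar> \<le> B0 ^ n * real n ^ n * F x / x ^ n"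
    using F unfolding Omega_outer_def by blast
  have Fpos: "F x > 0" if "x \<in> {0<..A}" for x using F that unfolding Omega_outer_def by auto
  have Feven: "F (- x) = F x" if "x \<in> {0<..A}" for x using F that unfolding Omega_outer_def by auto
  have Fanti: "F y \<le> F x" if "0 < x" "x \<le> y" "y \<le> A" for x y
    using F that unfolding Omega_outer_def monotone_on_def by auto
  have Fabs: "F \<bar>g t\<bar> = F (g t)" if "g t \<noteq> 0" for t
    using Feven[of "- g t"] Feven[of "g t"] gA[of t] that by (auto simp: abs_if)
  \<comment> \<open>The factor \<open>exp 1\<close> converts \<open>n ^ n\<close> into a factorial;
    \<open>max 1\<close> ensures \<open>B \<ge> 1\<close>, hence \<open>1 / R \<le> x0 / 2\<close>
    below.\<close>
  define B where "B = exp 1 * max 1 B0"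
  have B: "B \<ge> 1" unfolding B_def using mult_mono[of 1 "exp 1" 1 "max 1 B0"] by simp
  have dFb: "\<bar>dF n x\<bar> \<le> F x * (B / x) ^ n * fact n" if x: "x \<in> {0<..A}" for n x
  proof (cases "n = 0")
    case True
    then show ?thesis using dF x Fpos[OF x] by (simp add: derivatives_on_def)
  next
    case False
    have "B0 ^ n * real n ^ n \<le> max 1 B0 ^ n * (exp 1 ^ n * fact n)"
      using B0 by (intro mult_mono power_mono power_self_le_exp_fact) auto
    also have "\<dots> = B ^ n * fact n" by (simp add: B_def power_mult_distrib)
    finally have "B0 ^ n * real n ^ n * F x / x ^ n \<le> B ^ n * fact n * F x / x ^ n"
      using x Fpos[OF x] by (intro divide_right_mono mult_right_mono) auto
    then show ?thesis using dFb0[OF x, of n] False by (simp add: power_divide mult_ac)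
  qed
  \<comment> \<open>The first entry gives \<open>D * \<rho> \<le> 1 / 2\<close>, so that the series
    of \<open>g\<close> varies by less than \<open>2 * D * \<rho>\<close> on the disc; the second
    keeps this below a third of the radius \<open>1 / R\<close> available for
    \<open>F\<close>.\<close>
  define \<kappa> where "\<kappa> = min (1 / (2 * D * A)) (1 / (12 * B * D))"
  have \<kappa>: "\<kappa> > 0" using D A B by (auto simp: \<kappa>_def)
  have main: "((deriv ^^ k) (omega_fun F g) has_real_derivative (deriv ^^ Suc k) (omega_fun F g) t0) (at t0) \<and>
    \<bar>(deriv ^^ k) (omega_fun F g) t0\<bar> \<le> fact k * ((2 / \<kappa>) / \<bar>g t0\<bar>) ^ k * exp (- F (g t0) / 2)"
    if nz: "g t0 \<noteq> 0" for t0 k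
  proof -
    define x0 where "x0 = \<bar>g t0\<bar>"
    \<comment> \<open>\<open>F\<close> is expanded at positive points only. The sign folds negative
      values of \<open>g\<close> over, and evenness of \<open>F\<close> makes this harmless.\<close>
    define \<sigma> where "\<sigma> = sgn (g t0)"
    have x0: "0 < x0" "x0 \<le> A" using nz gA by (auto simp: x0_def)
    have \<sigma>: "\<sigma> = 1 \<or> \<sigma> = -1" "\<sigma> * g t0 = x0" using nz by (auto simp: \<sigma>_def x0_def sgn_if)
    \<comment> \<open>On \<open>[x0 / 2, A]\<close> one has \<open>B / x \<le> R\<close>, so one
      geometric rate is valid on the whole interval.\<close>
    define R where "R = 2 * B / x0"
    have R: "R > 0" "1 / R \<le> x0 / 2" using B x0 by (auto simp: R_def field_simps)
    define \<rho> where "\<rho> = \<kappa> * x0"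
    have \<rho>: "\<rho> > 0" using \<kappa> x0 by (simp add: \<rho>_def)
    have D\<rho>: "D * \<rho> \<le> 1 / 2"
    proof -
      have "\<rho> \<le> (1 / (2 * D * A)) * A" unfolding \<rho>_def using x0 A D \<kappa>
        by (intro mult_mono) (auto simp: \<kappa>_def)
      then show ?thesis using A D by (simp add: field_simps)
    qed
    have R\<rho>: "2 * D * \<rho> \<le> (1 / R) / 3"
    proof -
      have "\<rho> \<le> (1 / (12 * B * D)) * x0" unfolding \<rho>_def using x0
        by (intro mult_right_mono) (auto simp: \<kappa>_def)
      then show ?thesis using B D by (simp add: R_def field_simps)
    qed
    have Sder: "(dF i has_real_derivative dF (Suc i) x) (at x within {x0 / 2..A})" if "x \<in> {x0 / 2..A}" for i x
    proof (rule DERIV_subset)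
      show "(dF i has_real_derivative dF (Suc i) x) (at x within {0<..A})"
        using dF that x0 unfolding derivatives_on_def by auto
    qed (use x0 in auto)
    have SK: "\<bar>dF i x\<bar> \<le> F (x0 / 2) * R ^ i * fact i" if x: "x \<in> {x0 / 2..A}" for i x
    proof -
      have "\<bar>dF i x\<bar> \<le> F x * (B / x) ^ i * fact i" using x x0 by (intro dFb) auto
      also have "\<dots> \<le> F (x0 / 2) * R ^ i * fact i"
        using x x0 B Fpos[of "x0 / 2"] Fpos[of x]
        by (intro mult_right_mono mult_mono power_mono Fanti) (auto simp: R_def field_simps)
      finally show ?thesis .
    qed
    have SK0: "\<bar>dF i x0\<bar> \<le> F x0 * R ^ i * fact i" for i
    proof -
      have "\<bar>dF i x0\<bar> \<le> F x0 * (B / x0) ^ i * fact i" using x0 by (intro dFb) auto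
      also have "\<dots> \<le> F x0 * R ^ i * fact i"
        using x0 B Fpos[of x0] by (intro mult_right_mono mult_left_mono power_mono) (auto simp: R_def field_simps)
      finally show ?thesis .
    qed
    obtain \<Phi> where \<Phi>: "\<Phi> holomorphic_on ball (of_real x0) (1 / R)"
      "\<And>y. y \<in> {x0 / 2..A} \<Longrightarrow> \<bar>y - x0\<bar> < 1 / R \<Longrightarrow> \<Phi> (of_real y) = of_real (dF 0 y)"
      "\<And>w. w \<in> ball (of_real x0) (1 / R) \<Longrightarrow>
        norm (\<Phi> w - of_real (dF 0 x0)) \<le> F x0 * (R * norm (w - of_real x0)) / (1 - R * norm (w - of_real x0))"
      by (rule holomorphic_extension_of_derivative_bounds[OF _ _ Sder SK SK0 R(1)]) (use x0 in auto)
    have "\<bar>dg i t\<bar> \<le> max 1 A * D ^ i * fact i" for i t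
    proof (cases "i = 0")
      case True
      then show ?thesis using dg gA[of t] by (simp add: derivatives_on_def)
    next
      case False
      have "1 * (D ^ i * fact i) \<le> max 1 A * (D ^ i * fact i)" using D by (intro mult_right_mono) auto
      then show ?thesis using dgb[of i t] False by (simp add: mult.assoc)
    qed
    then obtain \<Gamma> where \<Gamma>: "\<Gamma> holomorphic_on ball (of_real t0) (1 / D)"
      "\<And>t. \<bar>t - t0\<bar> < 1 / D \<Longrightarrow> \<Gamma> (of_real t) = of_real (dg 0 t)"
      "\<And>z. z \<in> ball (of_real t0) (1 / D) \<Longrightarrow>
        norm (\<Gamma> z - of_real (dg 0 t0)) \<le> 1 * (D * norm (z - of_real t0)) / (1 - D * norm (z - of_real t0))"
      using holomorphic_extension_of_derivative_bounds[of UNIV t0 dg "max 1 A" D 1] dg dgb D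
      unfolding derivatives_on_def by auto
    have \<rho>D: "\<rho> < 1 / D" using D\<rho> D by (simp add: field_simps)
    have \<Gamma>b: "norm (of_real \<sigma> * \<Gamma> z - of_real x0) < (1 / R) / 3" if z: "z \<in> ball (of_real t0) \<rho>" for z
    proof -
      have dist: "norm (z - of_real t0) < \<rho>" using z by (simp add: dist_norm norm_minus_commute)
      then have "D * norm (z - of_real t0) < D * \<rho>" using D by simp
      then have q: "D * norm (z - of_real t0) \<le> 1 / 2" using D\<rho> by simp
      have "of_real \<sigma> * \<Gamma> z - of_real x0 = of_real \<sigma> * (\<Gamma> z - of_real (dg 0 t0))"
        using \<sigma>(2) dg by (simp add: derivatives_on_def algebra_simps flip: of_real_mult)
      then have "norm (of_real \<sigma> * \<Gamma> z - of_real x0) = norm (\<Gamma> z - of_real (dg 0 t0))"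
        using \<sigma>(1) by (auto simp: norm_mult)
      also have "\<dots> \<le> 1 * (D * norm (z - of_real t0)) / (1 - D * norm (z - of_real t0))"
        using z \<rho>D by (intro \<Gamma>(3)) auto
      also have "\<dots> \<le> 1 * (D * norm (z - of_real t0)) / (1 / 2)"
        using q D by (intro divide_left_mono mult_nonneg_nonneg) auto
      also have "\<dots> < 2 * D * \<rho>" using dist D by simp
      finally show ?thesis using R\<rho> by simp
    qed
    define H where "H z = exp (- \<Phi> (of_real \<sigma> * \<Gamma> z))" for z
    have inR: "of_real \<sigma> * \<Gamma> z \<in> ball (of_real x0) (1 / R)" if "z \<in> ball (of_real t0) \<rho>" for z
    proof -
      have "(1 / R) / 3 < 1 / R" using R(1) by (simp add: field_simps)
      then show ?thesis using less_trans[OF \<Gamma>b[OF that]] by (simp only: mem_ball dist_norm norm_minus_commute)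
    qed
    have Hhol: "H holomorphic_on ball (of_real t0) \<rho>"
      unfolding H_def
    proof (intro holomorphic_intros)
      have "(\<lambda>z. of_real \<sigma> * \<Gamma> z) holomorphic_on ball (of_real t0) \<rho>"
        by (intro holomorphic_intros holomorphic_on_subset[OF \<Gamma>(1)]) (use \<rho>D in auto)
      from holomorphic_on_compose_gen[OF this \<Phi>(1)] inR
      show "(\<lambda>z. \<Phi> (of_real \<sigma> * \<Gamma> z)) holomorphic_on ball (of_real t0) \<rho>"
        by (auto simp: comp_def simp del: mem_ball)
    qed
    have Hb: "norm (H z) \<le> exp (- F x0 / 2)" if z: "z \<in> ball (of_real t0) \<rho>" for z
    proof -
      let ?w = "of_real \<sigma> * \<Gamma> z"
      have q: "R * norm (?w - of_real x0) \<le> 1 / 3" using \<Gamma>b[OF z] R by (simp add: field_simps)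
      have "norm (\<Phi> ?w - of_real (dF 0 x0)) \<le> F x0 * (R * norm (?w - of_real x0)) / (1 - R * norm (?w - of_real x0))"
        by (rule \<Phi>(3)[OF inR[OF z]])
      \<comment> \<open>A third of the radius is what makes \<open>q / (1 - q)\<close> at most
        1/2.\<close>
      also have "\<dots> \<le> F x0 * (1 / 3) / (1 - 1 / 3)"
        using q R Fpos[of x0] x0 by (intro frac_le mult_left_mono) auto
      finally have "norm (\<Phi> ?w - of_real (F x0)) \<le> F x0 / 2"
        using dF x0 by (simp add: derivatives_on_def)
      moreover have "F x0 - Re (\<Phi> ?w) \<le> norm (\<Phi> ?w - of_real (F x0))"
        using abs_Re_le_cmod[of "\<Phi> ?w - of_real (F x0)"] by simp
      ultimately show ?thesis by (simp add: H_def)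
    qed
    have Hreal: "H (of_real t) = of_real (omega_fun F g t)" if t: "\<bar>t - t0\<bar> < \<rho>" for t
    proof -
      have z: "complex_of_real t \<in> ball (of_real t0) \<rho>" using t by (simp add: dist_real_def abs_minus_commute)
      have \<Gamma>t: "\<Gamma> (of_real t) = of_real (g t)"
        using \<Gamma>(2)[of t] t \<rho>D dg by (simp add: derivatives_on_def)
      define y where "y = \<sigma> * g t"
      have "of_real \<sigma> * \<Gamma> (of_real t) - of_real x0 = complex_of_real (y - x0)" by (simp add: \<Gamma>t y_def)
      then have y: "\<bar>y - x0\<bar> < (1 / R) / 3" using \<Gamma>b[OF z] by (metis norm_of_real)
      have y2: "x0 / 2 \<le> y" using y R by (simp add: abs_if split: if_splits)
      have y3: "y = \<bar>g t\<bar>" using \<sigma>(1) y2 x0 by (auto simp: y_def)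
      have "\<Phi> (of_real y) = of_real (dF 0 y)"
        using y y2 y3 gA[of t] R by (intro \<Phi>(2)) auto
      also have "dF 0 y = F y" using dF y2 y3 gA[of t] x0 by (simp add: derivatives_on_def)
      also have "F y = F (g t)" using y3 y2 x0 Fabs[of t] by auto
      finally have "\<Phi> (of_real \<sigma> * \<Gamma> (of_real t)) = of_real (F (g t))" by (simp add: \<Gamma>t y_def)
      moreover have "g t \<noteq> 0" using y3 y2 x0 by auto
      ultimately show ?thesis
        by (simp add: H_def omega_fun_def flip: exp_of_real)
    qed
    have sub: "cball (complex_of_real t0) (\<rho> / 2) \<subseteq> ball (of_real t0) \<rho>" using \<rho> by auto
    \<comment> \<open>Half the radius, because \<open>Cauchy_inequality\<close> requires continuity
      up to the boundary; hence the final constant \<open>2 / \<kappa>\<close>.\<close>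
    have "norm ((deriv ^^ k) H (of_real t0)) \<le> fact k * exp (- F x0 / 2) / (\<rho> / 2) ^ k"
    proof (rule Cauchy_inequality)
      show "H holomorphic_on ball (of_real t0) (\<rho> / 2)"
        using holomorphic_on_subset[OF Hhol] sub ball_subset_cball by blast
      show "continuous_on (cball (of_real t0) (\<rho> / 2)) H"
        using holomorphic_on_imp_continuous_on[OF holomorphic_on_subset[OF Hhol sub]] .
    qed (use \<rho> Hb in \<open>auto simp: dist_norm\<close>)
    moreover have "(deriv ^^ k) H (of_real t0) = of_real ((deriv ^^ k) (omega_fun F g) t0)"
      using higher_deriv_of_real(1)[OF Hhol Hreal] \<rho> by simp
    moreover have "((deriv ^^ k) (omega_fun F g) has_real_derivative (deriv ^^ Suc k) (omega_fun F g) t0) (at t0)"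
      using higher_deriv_of_real(2)[OF Hhol Hreal] \<rho> by simp
    moreover have "fact k * exp (- F x0 / 2) / (\<rho> / 2) ^ k = fact k * ((2 / \<kappa>) / \<bar>g t0\<bar>) ^ k * exp (- F (g t0) / 2)"
      using Fabs[OF nz] by (simp add: \<rho>_def x0_def power_divide power_mult_distrib field_simps)
    ultimately show ?thesis by simp
  qed
  show ?thesis using main \<kappa> by (intro exI[of _ "2 / \<kappa>"]) auto
qed

section \<open>Growth of the outer function at 0 and decay of its negative exponential\<close>

lemma Omega_outer_growth:
  assumes A: "A > 0" and F: "Omega_outer A F"
  shows "\<exists>\<alpha>>0. \<forall>x y. 0 < x \<longrightarrow> x \<le> y \<longrightarrow> y \<le> A \<longrightarrow> F y * (y / x) powr \<alpha> \<le> F x"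
proof -
  have Fpos: "F x > 0" if "x \<in> {0<..A}" for x using F that unfolding Omega_outer_def by auto
  have Fanti: "F y \<le> F x" if "0 < x" "x \<le> y" "y \<le> A" for x y
    using F that unfolding Omega_outer_def monotone_on_def by auto
  obtain d \<alpha> where d: "derivatives_on {0<..A} F d" and \<alpha>: "\<alpha> > 0"
    and low: "\<And>x. x \<in> {0<..A} \<Longrightarrow> \<alpha> \<le> \<bar>d 1 x\<bar> * x / F x"
    using F unfolding Omega_outer_def by blast
  have "F y * (y / x) powr \<alpha> \<le> F x" if xy: "0 < x" "x \<le> y" "y \<le> A" for x y
  proof -
    \<comment> \<open>The derivative of \<open>s powr \<alpha> * F s\<close> is
      \<open>s powr (\<alpha> - 1) * (\<alpha> * F s + s * F' s)\<close>. Monotonicity gives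
      \<open>F' \<le> 0\<close>, which turns the lower bound on \<open>|F'| * s / F\<close> into
      \<open>s * F' \<le> - \<alpha> * F\<close>, so the product does not increase.\<close>
    let ?h = "\<lambda>s. s powr \<alpha> * d 0 s"
    have "?h y \<le> ?h x"
    proof (rule DERIV_nonpos_imp_decreasing_open[where f = ?h])
      fix s assume s: "x < s" "s < y"
      have "(d 0 has_real_derivative d 1 s) (at s within {0<..A})"
        using d s xy unfolding derivatives_on_def by auto
      then have ds: "(d 0 has_real_derivative d 1 s) (at s)"
        by (subst (asm) at_within_interior) (use s xy in auto)
      have lows: "\<alpha> * F s \<le> \<bar>d 1 s\<bar> * s"
        using low[of s] Fpos[of s] s xy by (simp add: pos_le_divide_eq)
      have "d 1 s \<le> 0"
      proof (rule ccontr)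
        assume "\<not> d 1 s \<le> 0"
        then obtain \<delta> where \<delta>: "\<delta> > 0" "\<And>h. 0 < h \<Longrightarrow> h < \<delta> \<Longrightarrow> d 0 s < d 0 (s + h)"
          using DERIV_pos_inc_right[OF ds] by auto
        define h where "h = min (\<delta> / 2) (A - s)"
        have h: "0 < h" "h < \<delta>" "s + h \<le> A" using \<delta> s xy by (auto simp: h_def min_def)
        have "d 0 s < d 0 (s + h)" using \<delta>(2) h by auto
        moreover have "d 0 (s + h) \<le> d 0 s"
          using Fanti[of s "s + h"] d h s xy by (simp add: derivatives_on_def)
        ultimately show False by simp
      qed
      then have "\<alpha> * F s + s * d 1 s \<le> 0" using lows by (simp add: algebra_simps)
      then have "s powr (\<alpha> - 1) * (\<alpha> * F s + s * d 1 s) \<le> 0" by (simp add: mult_nonneg_nonpos)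
      moreover have "s powr \<alpha> = s powr (\<alpha> - 1) * s"
        using s xy powr_add[of s "\<alpha> - 1" 1] by simp
      moreover have "d 0 s = F s" using d s xy by (simp add: derivatives_on_def)
      moreover have "(?h has_real_derivative (\<alpha> * s powr (\<alpha> - 1) * d 0 s + d 1 s * s powr \<alpha>)) (at s)"
        using s xy by (auto intro!: derivative_eq_intros ds)
      ultimately show "\<exists>D. (?h has_real_derivative D) (at s) \<and> D \<le> 0"
        by (intro exI conjI) (assumption, simp add: algebra_simps)
    next
      have "continuous_on {0<..A} (d 0)"
        using d unfolding derivatives_on_def by (meson DERIV_continuous_on)
      then show "continuous_on {x..y} ?h"
        using xy by (intro continuous_intros) (auto elim: continuous_on_subset)
    qed (use xy in auto)
    moreover have "d 0 y = F y" "d 0 x = F x" using d xy by (auto simp: derivatives_on_def)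
    ultimately have "y powr \<alpha> * F y \<le> x powr \<alpha> * F x" by simp
    then show ?thesis using xy by (simp add: powr_divide field_simps)
  qed
  then show ?thesis using \<alpha> by blast
qed

text \<open>The exponential exceeds the single term
  \<open>(a * y powr \<alpha>) ^ j / fact j\<close> of its series, and
  \<open>j * \<alpha> \<ge> 1\<close> makes that term at least a multiple of \<open>y\<close> for
  \<open>y > 1\<close>.\<close>

lemma mult_exp_neg_powr_bounded:
  fixes a \<alpha> :: real
  assumes "a > 0" "\<alpha> > 0"
  obtains Y where "Y \<ge> 1" "\<And>y. 0 < y \<Longrightarrow> y * exp (- (a * y powr \<alpha>)) \<le> Y"
proof -
  obtain j :: nat where j: "1 \<le> real j * \<alpha>"
    using ex_less_of_nat_mult[OF assms(2), of 1] less_imp_le by blast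
  have "y * exp (- (a * y powr \<alpha>)) \<le> max 1 (fact j / a ^ j)" if y: "0 < y" for y
  proof (cases "y \<le> 1")
    case True
    have "y * exp (- (a * y powr \<alpha>)) \<le> 1 * 1" using True y assms by (intro mult_mono) auto
    then show ?thesis by simp
  next
    case False
    let ?s = "y powr \<alpha>"
    have "(\<Sum>n\<in>{j}. (a * ?s) ^ n /\<^sub>R fact n) \<le> exp (a * ?s)"
      unfolding exp_def using assms by (intro sum_le_suminf summable_exp_generic) auto
    then have 1: "a ^ j * ?s ^ j \<le> fact j * exp (a * ?s)"
      by (simp add: field_simps power_mult_distrib)
    have "y = y powr 1" using y by simp
    also have "\<dots> \<le> y powr (\<alpha> * real j)" using False j by (intro powr_mono) (auto simp: mult.commute)
    also have "\<dots> = ?s ^ j" using y by (simp add: powr_powr[symmetric] powr_realpow)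
    finally have "y \<le> ?s ^ j" .
    then have "a ^ j * y \<le> a ^ j * ?s ^ j" using assms by simp
    with 1 have "a ^ j * y \<le> fact j * exp (a * ?s)" by simp
    then have "y \<le> fact j / a ^ j * exp (a * ?s)" using assms by (simp add: field_simps)
    then have "y * exp (- (a * ?s)) \<le> fact j / a ^ j" by (simp add: exp_minus field_simps)
    then show ?thesis by simp
  qed
  then show thesis using that[of "max 1 (fact j / a ^ j)"] by auto
qed

text \<open>\<open>F x\<close> is at least \<open>F A * (A / x) powr \<alpha>\<close>, so the
  exponential beats every power of \<open>x\<close>. It is split into \<open>k\<close> equal
  factors, each of which yields one factor \<open>x\<close>.\<close>

lemma exp_neg_F_le_power:
  assumes A: "A > 0" and F: "Omega_outer A F" and c: "c > 0"
  shows "\<exists>C>0. \<forall>x\<in>{0<..A}. exp (- c * F x) \<le> C * x ^ k"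
proof (cases "k = 0")
  case True
  have "exp (- c * F x) \<le> 1" if "x \<in> {0<..A}" for x
    using F that c unfolding Omega_outer_def by (auto intro!: mult_nonneg_nonneg less_imp_le)
  then show ?thesis using True by (intro exI[of _ 1]) auto
next
  case False
  obtain \<alpha> where \<alpha>: "\<alpha> > 0" and gr: "\<And>x y. 0 < x \<Longrightarrow> x \<le> y \<Longrightarrow> y \<le> A \<Longrightarrow> F y * (y / x) powr \<alpha> \<le> F x"
    using Omega_outer_growth[OF A F] by blast
  have FA: "F A > 0" using F A unfolding Omega_outer_def by auto
  obtain Y where Y: "Y \<ge> 1" "\<And>y. 0 < y \<Longrightarrow> y * exp (- (c * F A / real k * y powr \<alpha>)) \<le> Y"
    by (rule mult_exp_neg_powr_bounded[of "c * F A / real k" \<alpha>]) (use FA False \<alpha> c in auto)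
  have "exp (- c * F x) \<le> (Y / A) ^ k * x ^ k" if x: "x \<in> {0<..A}" for x
  proof -
    have "exp (- c * F x) \<le> exp (- c * (F A * (A / x) powr \<alpha>))"
      using gr[of x A] x c by auto
    also have "\<dots> = exp (- (c * F A / real k * (A / x) powr \<alpha>)) ^ k"
      using False by (simp flip: exp_of_nat_mult)
    also have "\<dots> \<le> (Y / (A / x)) ^ k"
      using Y(2)[of "A / x"] x A by (intro power_mono) (auto simp: field_simps)
    finally show ?thesis by (simp add: power_divide power_mult_distrib)
  qed
  then show ?thesis using Y A by (intro exI[of _ "(Y / A) ^ k"]) auto
qed

section \<open>Smoothness across the zeros of the inner function\<close>

lemma periodic_2pi_deriv:
  fixes h :: "real \<Rightarrow> real"
  assumes "periodic_2pi h"
  shows "periodic_2pi (deriv h)"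
proof -
  have "(\<lambda>x. h (x + 2 * pi)) = h" using assms by (auto simp: periodic_2pi_def)
  then have "deriv h (t + 2 * pi) = deriv h t" for t
    unfolding deriv_def DERIV_shift by simp
  then show ?thesis by (simp add: periodic_2pi_def)
qed

lemma DERIV_zero_of_quadratic_bound:
  fixes h :: "real \<Rightarrow> real"
  assumes "\<And>s. \<bar>h s\<bar> \<le> C * (s - t) ^ 2"
  shows "(h has_real_derivative 0) (at t)"
proof -
  have ht: "h t = 0" using assms[of t] by simp
  have "((\<lambda>s. (h s - h t) / (s - t)) \<longlongrightarrow> 0) (at t)"
  proof (rule Lim_null_comparison)
    have "norm ((h s - h t) / (s - t)) \<le> C * \<bar>s - t\<bar>" if "s \<noteq> t" for s
    proof -
      have "\<bar>h s\<bar> \<le> C * \<bar>s - t\<bar> * \<bar>s - t\<bar>" using assms[of s] by (simp add: power2_eq_square)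
      then show ?thesis using that ht by (simp add: abs_divide pos_divide_le_eq)
    qed
    then show "\<forall>\<^sub>F s in at t. norm ((h s - h t) / (s - t)) \<le> C * \<bar>s - t\<bar>"
      by (auto simp: eventually_at_filter)
    show "((\<lambda>s. C * \<bar>s - t\<bar>) \<longlongrightarrow> 0) (at t)"
      by (rule tendsto_eq_intros refl | simp)+
  qed
  then show ?thesis by (simp add: has_field_derivative_iff)
qed

text \<open>At a zero of \<open>g\<close> the singular factor \<open>1 / |g| ^ k\<close> of the
  derivative bound is beaten by \<open>exp (- F / 2)\<close>, so each derivative is quadratically
  flat there. Induction on \<open>k\<close> then shows that all derivatives exist and vanish at the
  zeros.\<close>

lemma omega_fun_smooth:
  assumes A: "A > 0" and g: "Omega_inner A g" and F: "Omega_outer A F"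
  shows "smooth_periodic (\<lambda>k. (deriv ^^ k) (omega_fun F g))"
    and "\<exists>\<kappa>>0. \<forall>t k. \<bar>(deriv ^^ k) (omega_fun F g) t\<bar> \<le>
       (if g t = 0 then 0 else fact k * (\<kappa> / \<bar>g t\<bar>) ^ k * exp (- F (g t) / 2))"
proof -
  let ?f = "\<lambda>k. (deriv ^^ k) (omega_fun F g)"
  obtain \<kappa> where \<kappa>: "\<kappa> > 0"
    and der: "\<And>t k. g t \<noteq> 0 \<Longrightarrow> (?f k has_real_derivative ?f (Suc k) t) (at t)"
    and bd: "\<And>t k. g t \<noteq> 0 \<Longrightarrow> \<bar>?f k t\<bar> \<le> fact k * (\<kappa> / \<bar>g t\<bar>) ^ k * exp (- F (g t) / 2)"
    using omega_fun_derivative_bounds[OF A g F] by blast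
  obtain dg D where dg: "derivatives_on UNIV g dg" and D: "D > 0"
    and dgb: "\<And>t n. n \<ge> 1 \<Longrightarrow> \<bar>dg n t\<bar> \<le> D ^ n * fact n"
    using g unfolding Omega_inner_def by blast
  have gper: "periodic_2pi g" and gA: "\<bar>g t\<bar> \<le> A" for t
    using g unfolding Omega_inner_def by (auto simp: abs_le_iff minus_le_iff)
  have Fabs: "F (g t) = F \<bar>g t\<bar>" if "g t \<noteq> 0" for t
    using F gA[of t] that unfolding Omega_outer_def by (cases "g t > 0") auto
  have "(dg 0 has_real_derivative dg 1 t) (at t)" for t using dg by (simp add: derivatives_on_def)
  moreover have "\<bar>dg 1 t\<bar> \<le> D" for t using dgb[of 1 t] by simp
  ultimately have "\<bar>dg 0 t - dg 0 s\<bar> \<le> D * \<bar>t - s\<bar>" for s t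
    using field_differentiable_bound[of UNIV "dg 0" "dg 1" D t s] by simp
  then have lip: "\<bar>g t - g s\<bar> \<le> D * \<bar>t - s\<bar>" for s t using dg by (simp add: derivatives_on_def)
  have flat: "(?f k has_real_derivative 0) (at t)" if z: "\<And>s. g s = 0 \<Longrightarrow> ?f k s = 0" and t: "g t = 0" for k t
  proof -
    \<comment> \<open>Of the \<open>k + 2\<close> powers, \<open>k\<close> cancel
      \<open>1 / |g s| ^ k\<close>; the other two become \<open>(s - t) ^ 2\<close> by the Lipschitz
      bound for \<open>g\<close>.\<close>
    obtain C where C: "C > 0" "\<And>x. x \<in> {0<..A} \<Longrightarrow> exp (- (1/2) * F x) \<le> C * x ^ (k + 2)"
      using exp_neg_F_le_power[OF A F, of "1/2" "k + 2"] by auto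
    have "\<bar>?f k s\<bar> \<le> (fact k * \<kappa> ^ k * C * D ^ 2) * (s - t) ^ 2" for s
    proof (cases "g s = 0")
      case True
      then show ?thesis using z \<kappa> C by simp
    next
      case False
      have "\<bar>?f k s\<bar> \<le> fact k * (\<kappa> / \<bar>g s\<bar>) ^ k * exp (- (1/2) * F \<bar>g s\<bar>)"
        using bd[OF False, of k] Fabs[OF False] by simp
      also have "\<dots> \<le> fact k * (\<kappa> / \<bar>g s\<bar>) ^ k * (C * \<bar>g s\<bar> ^ (k + 2))"
        using C(2)[of "\<bar>g s\<bar>"] gA[of s] False \<kappa> by (intro mult_left_mono) auto
      also have "\<dots> = fact k * \<kappa> ^ k * C * \<bar>g s\<bar> ^ 2"
        using False by (simp add: power_divide power_add power2_eq_square)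
      also have "\<dots> \<le> fact k * \<kappa> ^ k * C * (D * \<bar>s - t\<bar>) ^ 2"
        using lip[of s t] t \<kappa> C(1) by (intro mult_left_mono power_mono) auto
      finally show ?thesis by (simp add: power_mult_distrib mult_ac)
    qed
    then show ?thesis by (rule DERIV_zero_of_quadratic_bound)
  qed
  have zero': "\<And>t. g t = 0 \<Longrightarrow> ?f k t = 0" for k
  proof (induction k)
    case 0
    then show ?case by (simp add: omega_fun_def)
  next
    case (Suc k)
    then show ?case using flat[of k t] by (simp add: DERIV_imp_deriv)
  qed
  have zero: "?f k t = 0 \<and> (?f k has_real_derivative ?f (Suc k) t) (at t)" if "g t = 0" for k t
    using flat[OF zero' that] zero'[OF that] by metis
  have per: "periodic_2pi (?f k)" for k
  proof (induction k)
    case 0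
    then show ?case using gper by (simp add: periodic_2pi_def omega_fun_def)
  qed (simp add: periodic_2pi_deriv)
  show "smooth_periodic ?f" unfolding smooth_periodic_def using per der zero by blast
  show "\<exists>\<kappa>>0. \<forall>t k. \<bar>?f k t\<bar> \<le> (if g t = 0 then 0 else fact k * (\<kappa> / \<bar>g t\<bar>) ^ k * exp (- F (g t) / 2))"
    using \<kappa> bd zero by (intro exI[of _ \<kappa>]) auto
qed

subsection \<open>Sublevel sets and exponentially good approximation\<close>

abbreviation (input) vol :: "real set \<Rightarrow> real" where
  "vol \<equiv> measure lebesgue"

text \<open>Near a point with \<open>g t \<noteq> 0\<close> the set is empty for small
  \<open>x\<close>, and for larger \<open>x\<close> the length of the neighbourhood is itself at
  most a multiple of \<open>x\<close>. At a zero, simplicity gives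
  \<open>|g s| \<ge> (m / 2) * |s - t|\<close> and hence an interval of length
  \<open>4 * x / m\<close>. The cover \<open>U\<close> postpones the question of
  measurability.\<close>

lemma Omega_inner_local_sublevel:
  assumes g: "Omega_inner A g"
  shows "\<exists>\<epsilon>>0. \<exists>c\<ge>0. \<forall>x>0. \<exists>U\<in>lmeasurable. {s \<in> ball t \<epsilon>. \<bar>g s\<bar> \<le> x} \<subseteq> U \<and> vol U \<le> c * x"
proof -
  obtain dg where dg: "derivatives_on UNIV g dg" and simple: "\<And>t. g t = 0 \<Longrightarrow> dg 1 t \<noteq> 0"
    using g unfolding Omega_inner_def by blast
  have der0: "(g has_real_derivative dg 1 t) (at t)" for t
  proof -
    have "(dg 0 has_real_derivative dg 1 t) (at t)" using dg by (simp add: derivatives_on_def)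
    moreover have "dg 0 = g" using dg by (auto simp: derivatives_on_def)
    ultimately show ?thesis by simp
  qed
  have der1: "(dg 1 has_real_derivative dg (Suc 1) t) (at t)" for t using dg by (simp add: derivatives_on_def)
  show ?thesis
  proof (cases "g t = 0")
    case False
    have "isCont g t" using der0 by (rule DERIV_isCont)
    then obtain \<epsilon> where \<epsilon>: "\<epsilon> > 0" "\<And>s. \<bar>s - t\<bar> < \<epsilon> \<Longrightarrow> \<bar>g s - g t\<bar> < \<bar>g t\<bar> / 2"
      using False unfolding continuous_at_eps_delta by (metis dist_real_def half_gt_zero zero_less_abs_iff)
    have "\<exists>U\<in>lmeasurable. {s \<in> ball t \<epsilon>. \<bar>g s\<bar> \<le> x} \<subseteq> U \<and> vol U \<le> (4 * \<epsilon> / \<bar>g t\<bar>) * x" if x: "x > 0" for x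
    proof (cases "x < \<bar>g t\<bar> / 2")
      case True
      have "\<bar>g s\<bar> > x" if "s \<in> ball t \<epsilon>" for s
      proof -
        have "\<bar>s - t\<bar> < \<epsilon>" using that by (simp add: dist_real_def abs_minus_commute)
        from \<epsilon>(2)[OF this] True show ?thesis by linarith
      qed
      then show ?thesis using x \<epsilon> by (intro bexI[of _ "{}"]) force+
    next
      case 2: False
      have "2 * \<epsilon> * \<bar>g t\<bar> \<le> 4 * \<epsilon> * x" using 2 \<epsilon>(1) by simp
      then have "2 * \<epsilon> \<le> (4 * \<epsilon> / \<bar>g t\<bar>) * x" using False by (simp add: field_simps)
      then show ?thesis using \<epsilon>(1)
        by (intro bexI[of _ "{t - \<epsilon>..t + \<epsilon>}"]) (auto simp: dist_real_def)
    qed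
    then show ?thesis using \<epsilon>(1) by (intro exI[of _ \<epsilon>] exI[of _ "4 * \<epsilon> / \<bar>g t\<bar>"] conjI) auto
  next
    case True
    define m where "m = \<bar>dg 1 t\<bar>"
    have m: "m > 0" using simple[OF True] by (simp add: m_def)
    have "isCont (dg 1) t" using der1 by (rule DERIV_isCont)
    then obtain \<epsilon> where \<epsilon>: "\<epsilon> > 0" "\<And>s. \<bar>s - t\<bar> < \<epsilon> \<Longrightarrow> \<bar>dg 1 s - dg 1 t\<bar> < m / 2"
      using m unfolding continuous_at_eps_delta by (metis dist_real_def half_gt_zero)
    have low: "(m / 2) * \<bar>s - t\<bar> \<le> \<bar>g s\<bar>" if s: "s \<in> ball t \<epsilon>" for s
    proof -
      have "norm ((g s - dg 1 t * s) - (g t - dg 1 t * t)) \<le> m / 2 * norm (s - t)"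
      proof (rule field_differentiable_bound[where S = "ball t \<epsilon>"])
        fix z assume z: "z \<in> ball t \<epsilon>"
        show "((\<lambda>s. g s - dg 1 t * s) has_real_derivative dg 1 z - dg 1 t) (at z within ball t \<epsilon>)"
          by (auto intro!: derivative_eq_intros has_field_derivative_at_within[OF der0])
        show "norm (dg 1 z - dg 1 t) \<le> m / 2"
          using \<epsilon>(2)[of z] z by (auto simp: dist_real_def abs_minus_commute)
      qed (use s \<epsilon> in auto)
      then have "\<bar>g s - dg 1 t * (s - t)\<bar> \<le> m / 2 * \<bar>s - t\<bar>" using True by (simp add: algebra_simps)
      moreover have "\<bar>dg 1 t * (s - t)\<bar> = m * \<bar>s - t\<bar>" by (simp add: m_def abs_mult)
      ultimately show ?thesis by linarith
    qed
    have "\<exists>U\<in>lmeasurable. {s \<in> ball t \<epsilon>. \<bar>g s\<bar> \<le> x} \<subseteq> U \<and> vol U \<le> (4 / m) * x" if x: "x > 0" for x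
    proof (intro bexI[of _ "{t - 2 * x / m..t + 2 * x / m}"] conjI subsetI)
      fix s assume "s \<in> {s \<in> ball t \<epsilon>. \<bar>g s\<bar> \<le> x}"
      then have "(m / 2) * \<bar>s - t\<bar> \<le> x" using low[of s] by auto
      then have "\<bar>s - t\<bar> \<le> 2 * x / m" using m by (simp add: field_simps)
      then show "s \<in> {t - 2 * x / m..t + 2 * x / m}" by (auto simp: abs_le_iff)
    next
      show "vol {t - 2 * x / m..t + 2 * x / m} \<le> (4 / m) * x"
        using x m by (simp add: field_simps)
    qed auto
    then show ?thesis using \<epsilon>(1) m by (intro exI[of _ \<epsilon>] exI[of _ "4 / m"] conjI) auto
  qed
qed

lemma Omega_inner_continuous: "Omega_inner A g \<Longrightarrow> continuous_on S g"
proof -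
  assume "Omega_inner A g"
  then obtain dg where dg: "derivatives_on UNIV g dg" unfolding Omega_inner_def by blast
  then have "dg 0 = g" by (auto simp: derivatives_on_def)
  then have "(g has_real_derivative dg 1 t) (at t)" for t using dg by (auto simp: derivatives_on_def)
  then show ?thesis by (meson DERIV_continuous_on has_field_derivative_at_within)
qed

lemma circle_lmeasurable [simp]: "circle \<in> lmeasurable" "circle \<in> sets lebesgue"
  by (auto simp: circle_def intro!: bounded_set_imp_lmeasurable)

lemma continuous_imp_borel_measurable_lebesgue:
  "continuous_on UNIV f \<Longrightarrow> f \<in> borel_measurable (lebesgue :: real measure)"
  by (rule measurable_completion) (simp add: borel_measurable_continuous_onI)

text \<open>By compactness finitely many of the local neighbourhoods cover a period. The summand 1
  in the constant ensures that it is positive.\<close>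

lemma Omega_inner_sublevel:
  assumes g: "Omega_inner A g"
  shows "\<exists>L>0. \<forall>x>0. {t \<in> circle. \<bar>g t\<bar> \<le> x} \<in> lmeasurable \<and> vol {t \<in> circle. \<bar>g t\<bar> \<le> x} \<le> L * x"
proof -
  define P where "P t \<epsilon> c \<longleftrightarrow> \<epsilon> > 0 \<and> c \<ge> 0 \<and>
      (\<forall>x>0. \<exists>U\<in>lmeasurable. {s \<in> ball t \<epsilon>. \<bar>g s\<bar> \<le> x} \<subseteq> U \<and> vol U \<le> c * x)" for t \<epsilon> c
  have "\<exists>\<epsilon> c. P t \<epsilon> c" for t
    using Omega_inner_local_sublevel[OF g, of t] unfolding P_def by blast
  then obtain \<epsilon> c where P: "\<And>t. P t (\<epsilon> t) (c t)" by metis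
  have \<epsilon>: "\<And>t. \<epsilon> t > 0" and c: "\<And>t. c t \<ge> 0"
    and loc: "\<And>t x. x > 0 \<Longrightarrow> \<exists>U\<in>lmeasurable. {s \<in> ball t (\<epsilon> t). \<bar>g s\<bar> \<le> x} \<subseteq> U \<and> vol U \<le> c t * x"
    using P unfolding P_def by blast+
  obtain I where I: "finite I" "{0..2 * pi} \<subseteq> (\<Union>t\<in>I. ball t (\<epsilon> t))"
  proof -
    have "compact {0..2 * pi}" by simp
    moreover have "{0..2 * pi} \<subseteq> (\<Union>t\<in>{0..2 * pi}. ball t (\<epsilon> t))" using \<epsilon> by force
    ultimately show thesis using that by (metis (no_types, lifting) compactE_image open_ball)
  qed
  have "{t \<in> circle. \<bar>g t\<bar> \<le> x} \<in> lmeasurable \<and> vol {t \<in> circle. \<bar>g t\<bar> \<le> x} \<le> ((\<Sum>t\<in>I. c t) + 1) * x"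
    if x: "x > 0" for x
  proof
    have [measurable]: "g \<in> borel_measurable lebesgue"
      using Omega_inner_continuous[OF g] by (rule continuous_imp_borel_measurable_lebesgue)
    have "{t \<in> circle. \<bar>g t\<bar> \<le> x} = circle \<inter> {t \<in> space lebesgue. \<bar>g t\<bar> \<le> x}" by auto
    also have "\<dots> \<in> lmeasurable" by (rule fmeasurable_Int_fmeasurable[OF circle_lmeasurable(1)]) measurable
    finally show meas: "{t \<in> circle. \<bar>g t\<bar> \<le> x} \<in> lmeasurable" .
    obtain U where U: "\<And>t. U t \<in> lmeasurable" "\<And>t. {s \<in> ball t (\<epsilon> t). \<bar>g s\<bar> \<le> x} \<subseteq> U t"
      "\<And>t. vol (U t) \<le> c t * x"
      using loc[OF x] by metis
    have "{t \<in> circle. \<bar>g t\<bar> \<le> x} \<subseteq> (\<Union>t\<in>I. U t)"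
    proof
      fix s assume s: "s \<in> {t \<in> circle. \<bar>g t\<bar> \<le> x}"
      then have "s \<in> {0..2 * pi}" by (auto simp: circle_def)
      then obtain t where "t \<in> I" "s \<in> ball t (\<epsilon> t)" using I by blast
      then show "s \<in> (\<Union>t\<in>I. U t)" using U(2)[of t] s by auto
    qed
    then have "vol {t \<in> circle. \<bar>g t\<bar> \<le> x} \<le> vol (\<Union>t\<in>I. U t)"
      using meas U(1) I(1) by (intro measure_mono_fmeasurable) auto
    also have "\<dots> \<le> (\<Sum>t\<in>I. vol (U t))"
      using U(1) I(1) by (intro measure_UNION_le) auto
    also have "\<dots> \<le> (\<Sum>t\<in>I. c t * x)" by (intro sum_mono U(3))
    also have "\<dots> \<le> ((\<Sum>t\<in>I. c t) + 1) * x" using x by (simp add: sum_distrib_right distrib_right)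
    finally show "vol {t \<in> circle. \<bar>g t\<bar> \<le> x} \<le> ((\<Sum>t\<in>I. c t) + 1) * x" .
  qed
  moreover have "(\<Sum>t\<in>I. c t) + 1 > 0" using c by (intro add_nonneg_pos sum_nonneg) auto
  ultimately show ?thesis by blast
qed

section \<open>The critical scale and exponentially good approximation of \<open>f\<close>\<close>

lemma critical_scale_exists:
  assumes A: "A > 0" and F: "Omega_outer A F" and n: "F A < real n * A"
  shows "\<exists>\<delta>. 0 < \<delta> \<and> \<delta> \<le> A \<and> F \<delta> = real n * \<delta>"
proof -
  obtain d where d: "derivatives_on {0<..A} F d" using F unfolding Omega_outer_def by blast
  have "continuous_on {0<..A} (d 0)"
    using d unfolding derivatives_on_def by (meson DERIV_continuous_on)
  then have cont: "continuous_on {0<..A} F"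
    by (rule continuous_on_eq) (use d in \<open>auto simp: derivatives_on_def\<close>)
  have "filterlim F at_top (at_right 0)" using F unfolding Omega_outer_def by blast
  then have "\<forall>\<^sub>F x in at_right 0. real n * A \<le> F x" by (simp add: filterlim_at_top)
  moreover have "\<forall>\<^sub>F x in at_right 0. x \<in> {0<..<A}" using A by (auto simp: eventually_at_right_field)
  ultimately have "\<forall>\<^sub>F x in at_right (0::real). real n * A \<le> F x \<and> x \<in> {0<..<A}" by (rule eventually_conj)
  from eventually_happens'[OF trivial_limit_at_right_real this]
  obtain x where x: "real n * A \<le> F x" "0 < x" "x < A" by auto
  \<comment> \<open>\<open>F y - n * y\<close> is nonnegative close to 0, where \<open>F\<close> is
    unbounded, and negative at \<open>A\<close>.\<close>
  have "\<exists>y\<ge>x. y \<le> A \<and> F y - real n * y = 0"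
  proof (rule IVT2')
    show "F A - real n * A \<le> 0" using n by simp
    have "real n * x \<le> real n * A" using x by (intro mult_left_mono) auto
    then show "0 \<le> F x - real n * x" using x by linarith
    show "continuous_on {x..A} (\<lambda>y. F y - real n * y)"
      using x by (intro continuous_intros) (auto intro: continuous_on_subset[OF cont])
  qed (use x in auto)
  then obtain y where "x \<le> y" "y \<le> A" "F y = real n * y" by auto
  then show ?thesis using x by (intro exI[of _ y]) auto
qed

text \<open>The excess of \<open>fact (k + 2)\<close> over \<open>fact k\<close> is absorbed into a
  \<open>k\<close>-th power by \<open>k + 1 \<le> 2 ^ k\<close>; the bounds below need the form of a
  constant times a \<open>k\<close>-th power.\<close>

lemma fact_add_le:
  assumes "i \<le> 2"
  shows "fact (k + i) \<le> (2 * (4 * real k) ^ k :: real)"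
proof -
  have pk: "real k + 1 \<le> 2 ^ k"
  proof -
    have "k + 1 \<le> 2 ^ k" using less_exp[of k] by (simp add: Suc_le_eq)
    then have "real (k + 1) \<le> real (2 ^ k)" by (simp only: of_nat_le_iff)
    then show ?thesis by simp
  qed
  have "fact (k + i) \<le> (fact (k + 2) :: real)" using assms by (intro fact_mono) auto
  also have "\<dots> = ((real k + 1) * (real k + 2)) * fact k" by (simp add: algebra_simps)
  also have "\<dots> \<le> (2 ^ k * (2 * 2 ^ k)) * real k ^ k"
    using pk of_nat_mono[OF fact_le_power[of k], where 'a = real] by (intro mult_mono) auto
  also have "\<dots> = 2 * (4 * real k) ^ k"
    using power_mult_distrib[of "2::real" 2 k] by (simp add: power_mult_distrib)
  finally show ?thesis .
qed

text \<open>\<open>e 0\<close> is the error of a polynomial approximation of \<open>f\<close>. Two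
  of its derivatives are controlled as well, because the correction for infinite exponent expands
  the error to second order.\<close>

definition approximation_error :: "(real \<Rightarrow> real) \<Rightarrow> nat \<Rightarrow> real \<Rightarrow> (nat \<Rightarrow> real \<Rightarrow> real) \<Rightarrow> bool" where
  "approximation_error f m \<eta> e \<longleftrightarrow> smooth_periodic e \<and>
     trig_poly m (\<lambda>t. complex_of_real (f t - e 0 t)) \<and> (\<forall>i\<le>2. \<forall>t. \<bar>e i t\<bar> \<le> \<eta>)"

text \<open>Here \<open>\<mu> n = n * \<delta> n = F (\<delta> n)\<close>. The derivative of order
  \<open>k\<close>, for \<open>k\<close> comparable to \<open>\<mu> n\<close>, is at most a constant
  times \<open>(b * n) ^ k\<close>: per order, the factorial contributes about
  \<open>\<mu> n\<close>, the factor \<open>1 / |g|\<close> effectively contributes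
  \<open>1 / \<delta> n\<close>, and \<open>\<mu> n / \<delta> n = n\<close>. Jackson's step with
  parameter \<open>m * n\<close>, \<open>m\<close> large, thus gains at least a factor
  \<open>exp (- 1)\<close> per iteration.\<close>

lemma omega_fun_approximation:
  assumes A: "A > 0" and g: "Omega_inner A g" and F: "Omega_outer A F"
  shows "\<exists>\<mu> L. L > 0 \<and> filterlim \<mu> at_top sequentially \<and> (\<lambda>n. \<mu> n / real n) \<longlonglongrightarrow> 0 \<and>
    (\<forall>\<^sub>F n in sequentially. vol {t \<in> circle. omega_fun F g t < exp (- \<mu> n)} \<le> L * \<mu> n / real n) \<and>
    (\<forall>N>0. \<exists>c::nat. \<forall>\<^sub>F n in sequentially. \<exists>e. approximation_error (omega_fun F g) (c * n) (exp (- N * \<mu> n)) e)"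
proof -
  let ?f = "\<lambda>k. (deriv ^^ k) (omega_fun F g)"
  have gA: "\<bar>g t\<bar> \<le> A" for t
    using g unfolding Omega_inner_def by (auto simp: abs_le_iff minus_le_iff)
  have Fpos: "F x > 0" if "x \<in> {0<..A}" for x using F that unfolding Omega_outer_def by auto
  have Fanti: "F y \<le> F x" if "0 < x" "x \<le> y" "y \<le> A" for x y
    using F that unfolding Omega_outer_def monotone_on_def by auto
  have Fabs: "F (g t) = F \<bar>g t\<bar>" if "g t \<noteq> 0" for t
    using F gA[of t] that unfolding Omega_outer_def by (cases "g t > 0") auto
  obtain L where L: "L > 0" "\<And>x. x > 0 \<Longrightarrow> {t \<in> circle. \<bar>g t\<bar> \<le> x} \<in> lmeasurable"
    "\<And>x. x > 0 \<Longrightarrow> vol {t \<in> circle. \<bar>g t\<bar> \<le> x} \<le> L * x"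
    using Omega_inner_sublevel[OF g] by blast
  obtain \<alpha> where \<alpha>: "\<alpha> > 0" and gr: "\<And>x y. 0 < x \<Longrightarrow> x \<le> y \<Longrightarrow> y \<le> A \<Longrightarrow> F y * (y / x) powr \<alpha> \<le> F x"
    using Omega_outer_growth[OF A F] by blast
  obtain \<kappa> where \<kappa>: "\<kappa> > 0" and fb: "\<And>t k. \<bar>?f k t\<bar> \<le>
       (if g t = 0 then 0 else fact k * (\<kappa> / \<bar>g t\<bar>) ^ k * exp (- F (g t) / 2))"
    using omega_fun_smooth(2)[OF A g F] by blast
  \<comment> \<open>The equation is solvable once \<open>n\<close> is large; all conclusions are
    therefore drawn eventually.\<close>
  define \<delta> where "\<delta> n = (SOME \<delta>. 0 < \<delta> \<and> \<delta> \<le> A \<and> F \<delta> = real n * \<delta>)" for n :: nat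
  have "\<forall>\<^sub>F n in sequentially. F A / A < real n"
    using filterlim_real_sequentially by (simp add: filterlim_at_top_dense)
  then have ev\<delta>: "\<forall>\<^sub>F n in sequentially. 0 < \<delta> n \<and> \<delta> n \<le> A \<and> F (\<delta> n) = real n * \<delta> n"
  proof eventually_elim
    case (elim n)
    then have "F A < real n * A" using A by (simp add: field_simps)
    from someI_ex[OF critical_scale_exists[OF A F this]] show ?case unfolding \<delta>_def .
  qed
  define \<mu> where "\<mu> n = real n * \<delta> n" for n
  \<comment> \<open>\<open>\<delta> n \<ge> \<epsilon>'\<close> would imply
    \<open>n * \<epsilon>' \<le> F (\<delta> n) \<le> F \<epsilon>'\<close>, which fails for large
    \<open>n\<close>.\<close>
  have ev_small: "\<forall>\<^sub>F n in sequentially. \<delta> n < \<epsilon>" if \<epsilon>: "\<epsilon> > 0" for \<epsilon>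
  proof -
    define \<epsilon>' where "\<epsilon>' = min \<epsilon> A"
    have \<epsilon>': "0 < \<epsilon>'" "\<epsilon>' \<le> A" "\<epsilon>' \<le> \<epsilon>" using \<epsilon> A by (auto simp: \<epsilon>'_def)
    have "\<forall>\<^sub>F n in sequentially. F \<epsilon>' / \<epsilon>' < real n"
      using filterlim_real_sequentially by (simp add: filterlim_at_top_dense)
    with ev\<delta> show ?thesis
    proof eventually_elim
      case (elim n)
      have "\<delta> n < \<epsilon>'"
      proof (rule ccontr)
        assume "\<not> \<delta> n < \<epsilon>'"
        then have "real n * \<epsilon>' \<le> real n * \<delta> n" by (intro mult_left_mono) auto
        also have "\<dots> \<le> F \<epsilon>'" using Fanti[of \<epsilon>' "\<delta> n"] elim \<epsilon>' \<open>\<not> \<delta> n < \<epsilon>'\<close> by simp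
        finally show False using elim(2) \<epsilon>' by (simp add: field_simps)
      qed
      then show ?case using \<epsilon>' by simp
    qed
  qed
  have \<mu>top: "filterlim \<mu> at_top sequentially"
    unfolding filterlim_at_top
  proof
    fix Z
    have "filterlim F at_top (at_right 0)" using F unfolding Omega_outer_def by blast
    then have "\<forall>\<^sub>F x in at_right 0. Z \<le> F x" by (simp add: filterlim_at_top)
    then obtain \<epsilon> where \<epsilon>: "\<epsilon> > 0" "\<And>x. 0 < x \<Longrightarrow> x < \<epsilon> \<Longrightarrow> Z \<le> F x"
      unfolding eventually_at_right_field by blast
    from ev\<delta> ev_small[OF \<epsilon>(1)] show "\<forall>\<^sub>F n in sequentially. Z \<le> \<mu> n"
      by eventually_elim (use \<epsilon>(2) in \<open>force simp: \<mu>_def\<close>)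
  qed
  have ev1: "\<forall>\<^sub>F n in sequentially. n \<ge> (1::nat)" by (rule eventually_ge_at_top)
  have \<mu>0: "(\<lambda>n. \<mu> n / real n) \<longlonglongrightarrow> 0"
  proof (rule tendstoI)
    fix \<epsilon> :: real assume "\<epsilon> > 0"
    from ev_small[OF this] ev\<delta> ev1 show "\<forall>\<^sub>F n in sequentially. dist (\<mu> n / real n) 0 < \<epsilon>"
      by eventually_elim (auto simp: \<mu>_def)
  qed
  have sub: "\<forall>\<^sub>F n in sequentially. vol {t \<in> circle. omega_fun F g t < exp (- \<mu> n)} \<le> L * \<mu> n / real n"
    using ev\<delta> ev1
  proof eventually_elim
    case (elim n)
    have "{t \<in> circle. omega_fun F g t < exp (- \<mu> n)} \<subseteq> {t \<in> circle. \<bar>g t\<bar> \<le> \<delta> n}"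
    proof safe
      fix t assume t: "omega_fun F g t < exp (- \<mu> n)"
      show "\<bar>g t\<bar> \<le> \<delta> n"
      proof (rule ccontr)
        assume *: "\<not> \<bar>g t\<bar> \<le> \<delta> n"
        then have nz: "g t \<noteq> 0" using elim by auto
        then have "F (g t) > \<mu> n" using t by (simp add: omega_fun_def)
        moreover have "F \<bar>g t\<bar> \<le> F (\<delta> n)" using Fanti[of "\<delta> n" "\<bar>g t\<bar>"] elim * gA[of t] by auto
        ultimately show False using Fabs[OF nz] elim by (simp add: \<mu>_def)
      qed
    qed
    then have "vol {t \<in> circle. omega_fun F g t < exp (- \<mu> n)} \<le> vol {t \<in> circle. \<bar>g t\<bar> \<le> \<delta> n}"
    proof (rule measure_mono_fmeasurable)
      have [measurable]: "omega_fun F g \<in> borel_measurable lebesgue"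
        using smooth_periodic_continuous[OF omega_fun_smooth(1)[OF A g F], of UNIV 0]
        by (intro continuous_imp_borel_measurable_lebesgue) simp
      have "{t \<in> circle. omega_fun F g t < exp (- \<mu> n)} = circle \<inter> {t \<in> space lebesgue. omega_fun F g t < exp (- \<mu> n)}" by auto
      also have "\<dots> \<in> sets lebesgue" by (intro sets.Int) (simp, measurable)
      finally show "{t \<in> circle. omega_fun F g t < exp (- \<mu> n)} \<in> sets lebesgue" .
    qed (use L(2) elim in auto)
    also have "\<dots> \<le> L * \<delta> n" using L(3) elim by auto
    finally show ?case using elim by (simp add: \<mu>_def)
  qed
  have approx: "\<exists>c::nat. \<forall>\<^sub>F n in sequentially. \<exists>e. approximation_error (omega_fun F g) (c * n) (exp (- N * \<mu> n)) e" if N: "N > 0" for N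
  proof -
    \<comment> \<open>One more than required: the spare \<open>exp (- \<mu> n)\<close> absorbs the
      constant \<open>C3\<close>.\<close>
    define K where "K = N + 1"
    have K: "K \<ge> 1" using N by (simp add: K_def)
    have "\<exists>C>0. \<forall>x\<in>{0<..A}. exp (- (1/4) * F x) \<le> C * x ^ i" for i
      by (rule exp_neg_F_le_power[OF A F]) simp
    then obtain C where C: "\<And>i. C i > 0" "\<And>i x. x \<in> {0<..A} \<Longrightarrow> exp (- (1/4) * F x) \<le> C i * x ^ i"
      by metis
    \<comment> \<open>The 2 is that of \<open>fact_add_le\<close>; \<open>\<kappa> ^ i * C i\<close>
      is the price of \<open>i\<close> extra derivatives.\<close>
    define C3 where "C3 = 2 * (1 + C 0 + \<kappa> * C 1 + \<kappa>\<^sup>2 * C 2)"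
    have C3: "C3 \<ge> 1" "\<And>i. i \<le> 2 \<Longrightarrow> 2 * \<kappa> ^ i * C i \<le> C3"
    proof -
      have p: "0 \<le> C 0" "0 \<le> \<kappa> * C 1" "0 \<le> \<kappa>\<^sup>2 * C 2" using C(1) \<kappa> by (auto intro: less_imp_le)
      show "C3 \<ge> 1" using p by (simp add: C3_def)
      fix i :: nat assume "i \<le> 2"
      then consider "i = 0" | "i = 1" | "i = 2" by linarith
      then show "2 * \<kappa> ^ i * C i \<le> C3" by cases (use p in \<open>auto simp: C3_def\<close>)
    qed
    obtain Y where Y: "Y \<ge> 1" "\<And>y. 0 < y \<Longrightarrow> y * exp (- (1 / (8 * K) * y powr \<alpha>)) \<le> Y"
      by (rule mult_exp_neg_powr_bounded[of "1 / (8 * K)" \<alpha>]) (use K \<alpha> in auto)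
    \<comment> \<open>Chosen such that \<open>4 * k * \<kappa> * Y / \<delta> n \<le> b * n\<close>
      whenever \<open>k \<le> 2 * K * \<mu> n\<close>.\<close>
    define b where "b = 8 * K * \<kappa> * Y"
    have b: "b > 0" using K \<kappa> Y by (simp add: b_def)
    obtain m :: nat where m: "exp 1 * (jackson_const * b) \<le> real m" using real_arch_simple by blast
    have m1: "m \<ge> 1"
    proof -
      have "0 < exp 1 * (jackson_const * b)" using b jackson_const_ge_1 by simp
      then show ?thesis using m by linarith
    qed
    have ev\<mu>: "\<forall>\<^sub>F n in sequentially. max 1 (ln C3) \<le> \<mu> n" using \<mu>top unfolding filterlim_at_top by blast
    have "\<forall>\<^sub>F n in sequentially. \<exists>e. approximation_error (omega_fun F g) (4 * m * n) (exp (- N * \<mu> n)) e"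
      using ev\<delta> ev1 ev\<mu>
    proof eventually_elim
      case (elim n)
      have \<delta>n: "0 < \<delta> n" "\<delta> n \<le> A" "F (\<delta> n) = \<mu> n" and n: "n \<ge> 1" and \<mu>n: "1 \<le> \<mu> n" "ln C3 \<le> \<mu> n"
        using elim by (auto simp: \<mu>_def)
      define k where "k = nat \<lceil>K * \<mu> n\<rceil>"
      have k: "K * \<mu> n \<le> real k" "real k \<le> 2 * K * \<mu> n"
      proof -
        have "1 \<le> K * \<mu> n" using K \<mu>n mult_mono[of 1 K 1 "\<mu> n"] by simp
        then show "K * \<mu> n \<le> real k" "real k \<le> 2 * K * \<mu> n" unfolding k_def by linarith+
      qed
      \<comment> \<open>In effect \<open>x\<close> may be replaced by \<open>\<delta> n / Y\<close>.
        This is clear for \<open>x \<ge> \<delta> n\<close>. For smaller \<open>x\<close> the growth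
        of \<open>F\<close> gives \<open>F x \<ge> \<mu> n * (\<delta> n / x) powr \<alpha>\<close>,
        and since \<open>k\<close> is at most a multiple of \<open>\<mu> n\<close>, each of the
        \<open>k\<close> factors \<open>1 / x\<close> receives its own share of the decay.\<close>
      have S: "(1 / x) ^ k * exp (- (1/4) * F x) \<le> (Y / \<delta> n) ^ k" if x: "x \<in> {0<..A}" for x
      proof (cases "\<delta> n \<le> x")
        case True
        have "(1 / x) ^ k * exp (- (1/4) * F x) \<le> (1 / x) ^ k * 1"
          using x Fpos[OF x] by (intro mult_left_mono) auto
        also have "\<dots> \<le> (Y / \<delta> n) ^ k * 1"
          using True \<delta>n Y(1) x by (intro mult_right_mono power_mono frac_le) auto
        finally show ?thesis by simp
      next
        case False
        define y where "y = \<delta> n / x"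
        have y: "y > 0" using x \<delta>n by (simp add: y_def)
        have "real k / (2 * K) * y powr \<alpha> \<le> \<mu> n * y powr \<alpha>"
          using k(2) K by (intro mult_right_mono) (auto simp: field_simps)
        also have "\<dots> \<le> F x" using gr[of x "\<delta> n"] x False \<delta>n by (simp add: y_def)
        finally have "exp (- (1/4) * F x) \<le> exp (- (1/4) * (real k / (2 * K) * y powr \<alpha>))" by simp
        also have "\<dots> = exp (- (1 / (8 * K) * y powr \<alpha>)) ^ k"
          by (simp flip: exp_of_nat_mult)
        finally have "(1 / x) ^ k * exp (- (1/4) * F x) \<le> (1 / x) ^ k * exp (- (1 / (8 * K) * y powr \<alpha>)) ^ k"
          using x by (intro mult_left_mono) auto
        also have "\<dots> = ((y * exp (- (1 / (8 * K) * y powr \<alpha>))) / \<delta> n) ^ k"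
          using \<delta>n by (simp add: y_def power_divide power_mult_distrib)
        also have "\<dots> \<le> (Y / \<delta> n) ^ k"
          using y \<delta>n Y(2)[OF y] by (intro power_mono divide_right_mono) auto
        finally show ?thesis .
      qed
      have fk: "\<bar>?f (i + k) t\<bar> \<le> C3 * (b * real n) ^ k" if i: "i \<le> 2" for i t
      proof (cases "g t = 0")
        case True
        then show ?thesis using fb[of "i + k" t] C3 b by simp
      next
        case False
        define x where "x = \<bar>g t\<bar>"
        have x: "x \<in> {0<..A}" using False gA by (auto simp: x_def)
        \<comment> \<open>The exponential is split in two: one factor pays for the \<open>i\<close>
          extra powers of \<open>1 / x\<close>, the other for the \<open>k\<close> main
          ones.\<close>
        have "\<bar>?f (i + k) t\<bar> \<le> fact (k + i) * (\<kappa> / x) ^ (i + k) * (exp (- (1/4) * F x) * exp (- (1/4) * F x))"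
          using fb[of "i + k" t] False Fabs[OF False] by (simp add: x_def add.commute flip: exp_add)
        also have "\<dots> \<le> (2 * (4 * real k) ^ k) * (\<kappa> / x) ^ (i + k) * ((C i * x ^ i) * exp (- (1/4) * F x))"
          using \<kappa> x by (intro mult_mono fact_add_le[OF i] mult_right_mono C(2)) (auto intro!: mult_nonneg_nonneg less_imp_le[OF C(1)])
        also have "\<dots> = (2 * \<kappa> ^ i * C i) * (4 * real k * \<kappa>) ^ k * ((1 / x) ^ k * exp (- (1/4) * F x))"
          using x by (simp add: power_add power_divide power_mult_distrib field_simps)
        also have "\<dots> \<le> C3 * (4 * real k * \<kappa>) ^ k * (Y / \<delta> n) ^ k"
          using \<kappa> x by (intro mult_mono S C3(2)[OF i] mult_right_mono) (use C3(1) Y \<delta>n in auto)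
        also have "\<dots> = C3 * (4 * real k * \<kappa> * Y / \<delta> n) ^ k" by (simp add: power_divide power_mult_distrib)
        also have "\<dots> \<le> C3 * (b * real n) ^ k"
        proof (intro mult_left_mono power_mono)
          have "4 * real k * \<kappa> * Y \<le> 4 * (2 * K * \<mu> n) * \<kappa> * Y"
            using k(2) \<kappa> Y by (intro mult_left_mono mult_right_mono) auto
          then show "4 * real k * \<kappa> * Y / \<delta> n \<le> b * real n"
            using \<delta>n(1) by (simp add: b_def \<mu>_def field_simps)
        qed (use C3(1) \<kappa> Y \<delta>n in auto)
        finally show ?thesis .
      qed
      obtain e where e: "smooth_periodic e" "trig_poly (4 * (m * n)) (\<lambda>t. complex_of_real (?f 0 t - e 0 t))"
        "\<And>i M t. (\<And>t. \<bar>?f (i + k) t\<bar> \<le> M) \<Longrightarrow> \<bar>e i t\<bar> \<le> (jackson_const / real (m * n)) ^ k * M"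
        using iterated_jackson[OF omega_fun_smooth(1)[OF A g F], of "m * n" k] m1 n by auto
      have "\<bar>e i t\<bar> \<le> exp (- N * \<mu> n)" if i: "i \<le> 2" for i t
      proof -
        have "\<bar>e i t\<bar> \<le> (jackson_const / real (m * n)) ^ k * (C3 * (b * real n) ^ k)"
          by (rule e(3)[OF fk[OF i]])
        also have "\<dots> = C3 * (jackson_const * b / real m) ^ k"
          using n by (simp add: power_mult_distrib power_divide)
        also have "\<dots> \<le> C3 * exp (- 1) ^ k"
        proof (intro mult_left_mono power_mono)
          show "jackson_const * b / real m \<le> exp (- 1)"
            using m m1 by (simp add: exp_minus field_simps)
        qed (use C3(1) b jackson_const_ge_1 in auto)
        also have "\<dots> = C3 * exp (- real k)" by (simp flip: exp_of_nat_mult)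
        also have "\<dots> \<le> exp (\<mu> n) * exp (- (K * \<mu> n))"
        proof (intro mult_mono)
          have "C3 = exp (ln C3)" using C3(1) by simp
          also have "\<dots> \<le> exp (\<mu> n)" using \<mu>n by simp
          finally show "C3 \<le> exp (\<mu> n)" .
        qed (use k(1) in auto)
        also have "\<dots> = exp (- N * \<mu> n)" by (simp add: K_def algebra_simps flip: exp_add)
        finally show ?thesis .
      qed
      then show ?case using e(1,2) unfolding approximation_error_def by (intro exI[of _ e]) (simp add: mult.assoc)
    qed
    then show ?thesis by blast
  qed
  show ?thesis
    by (intro exI[of _ \<mu>] exI[of _ L] conjI L(1) \<mu>top \<mu>0 sub allI impI approx)
qed

subsection \<open>Weighted energies\<close>

text \<open>With exponent 1 for infinite \<open>p\<close>, both cases have the same integrand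
  \<open>|T| powr a * w\<close>.\<close>

definition norm_exponent :: "ennreal \<Rightarrow> real" where
  "norm_exponent p = (if p = \<infinity> then 1 else enn2real p)"

text \<open>The norm before its root is taken, in which form finite exponents are additive over
  disjoint sets.\<close>

definition energy :: "ennreal \<Rightarrow> real set \<Rightarrow> (real \<Rightarrow> real) \<Rightarrow> ennreal" where
  "energy p S h = (if p = \<infinity> then esssup (lebesgue_on S) (\<lambda>t. ennreal (h t))
     else \<integral>\<^sup>+t\<in>S. ennreal (h t) \<partial>lebesgue)"

lemma norm_exponent_pos: "0 < p \<Longrightarrow> norm_exponent p > 0"
  by (auto simp: norm_exponent_def enn2real_positive_iff less_top)

text \<open>Measurability is not assumed: if one of the functions fails to be measurable on
  \<open>S\<close>, so does the other, and \<open>esssup\<close> has its default value for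
  both.\<close>

lemma energy_cong:
  assumes "\<And>t. t \<in> S \<Longrightarrow> h t = h' t"
  shows "energy p S h = energy p S h'"
proof -
  have "esssup (lebesgue_on S) (\<lambda>t. ennreal (h t)) = esssup (lebesgue_on S) (\<lambda>t. ennreal (h' t))"
  proof (cases "(\<lambda>t. ennreal (h t)) \<in> borel_measurable (lebesgue_on S)")
    case True
    moreover have "(\<lambda>t. ennreal (h' t)) \<in> borel_measurable (lebesgue_on S)"
      using True assms by (subst measurable_cong[where g = "\<lambda>t. ennreal (h t)"]) (auto simp: space_restrict_space)
    ultimately show ?thesis using assms by (intro esssup_AE_cong) (auto simp: space_restrict_space)
  next
    case False
    moreover have "(\<lambda>t. ennreal (h' t)) \<notin> borel_measurable (lebesgue_on S)"
      using False assms by (subst measurable_cong[where g = "\<lambda>t. ennreal (h t)"]) (auto simp: space_restrict_space)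
    ultimately show ?thesis by (simp add: esssup_non_measurable)
  qed
  moreover have "(\<integral>\<^sup>+t\<in>S. ennreal (h t) \<partial>lebesgue) = (\<integral>\<^sup>+t\<in>S. ennreal (h' t) \<partial>lebesgue)"
    using assms by (intro nn_integral_cong) (auto simp: indicator_def)
  ultimately show ?thesis by (simp add: energy_def)
qed

lemma ennreal_powr_le_iff:
  assumes P: "P > 0"
  shows "ennreal_powr X (1 / P) \<le> ennreal (exp y) * ennreal_powr Y (1 / P) \<longleftrightarrow> X \<le> ennreal (exp (P * y)) * Y"
proof (cases Y)
  case Y: (real s)
  show ?thesis
  proof (cases X)
    case X: (real r)
    have "r powr (1 / P) \<le> exp y * s powr (1 / P) \<longleftrightarrow> r powr (1 / P) \<le> (exp (P * y) * s) powr (1 / P)"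
      using P Y by (simp add: powr_mult exp_powr_real)
    also have "\<dots> \<longleftrightarrow> r \<le> exp (P * y) * s"
      using P X Y powr_less_mono2[of "1 / P" "exp (P * y) * s" r] powr_mono2[of "1 / P" r "exp (P * y) * s"]
      by (smt (verit, ccfv_SIG) divide_pos_pos exp_ge_zero mult_nonneg_nonneg)
    finally show ?thesis using X Y by (simp add: ennreal_powr_def flip: ennreal_mult)
  next
    case top
    then show ?thesis using Y by (simp add: ennreal_powr_def top_unique ennreal_mult_eq_top_iff)
  qed
next
  case top
  then show ?thesis by (simp add: ennreal_powr_def ennreal_mult_top)
qed

lemma Lp_norm_le_iff_energy:
  assumes "0 < p"
  shows "Lp_norm p w S T \<le> ennreal (exp y) * Lp_norm p w' S' T' \<longleftrightarrow>
    energy p S (\<lambda>t. norm (T t) powr norm_exponent p * w t) \<le>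
    ennreal (exp (norm_exponent p * y)) * energy p S' (\<lambda>t. norm (T' t) powr norm_exponent p * w' t)"
proof (cases "p = \<infinity>")
  case True
  then show ?thesis by (simp add: Lp_norm_def energy_def norm_exponent_def)
next
  case False
  then show ?thesis
    using ennreal_powr_le_iff[of "enn2real p"] norm_exponent_pos[OF assms]
    by (simp add: Lp_norm_def energy_def norm_exponent_def)
qed

text \<open>Infinite exponent is handled through almost-everywhere inequalities.\<close>

lemma energy_infinity_le_iff:
  assumes [measurable]: "h \<in> borel_measurable lebesgue" and S: "S \<in> sets lebesgue"
  shows "energy \<infinity> S h \<le> V \<longleftrightarrow> (AE t in lebesgue. t \<in> S \<longrightarrow> ennreal (h t) \<le> V)"
proof -
  have meas: "(\<lambda>t. ennreal (h t)) \<in> borel_measurable (lebesgue_on S)"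
    by (intro measurable_restrict_space1) measurable
  have "energy \<infinity> S h \<le> V \<longleftrightarrow> (AE t in lebesgue_on S. ennreal (h t) \<le> V)"
    unfolding energy_def
    using esssup_I[OF meas, of V] esssup_AE[of "\<lambda>t. ennreal (h t)" "lebesgue_on S"]
    by (auto elim: eventually_mono order_trans)
  then show ?thesis using S by (simp add: AE_restrict_space_iff)
qed

lemma energy_mono:
  assumes [measurable]: "h \<in> borel_measurable lebesgue" "h' \<in> borel_measurable lebesgue"
    and S [measurable]: "S \<in> sets lebesgue" "S' \<in> sets lebesgue" and sub: "S \<subseteq> S'"
    and k: "0 \<le> k" and le: "\<And>t. t \<in> S \<Longrightarrow> h t \<le> k * h' t" and h': "\<And>t. 0 \<le> h' t"
  shows "energy p S h \<le> ennreal k * energy p S' h'"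
proof (cases "p = \<infinity>")
  case True
  have "AE t in lebesgue. t \<in> S' \<longrightarrow> ennreal (h' t) \<le> energy \<infinity> S' h'"
    by (rule energy_infinity_le_iff[THEN iffD1, OF _ _ order_refl]) (use S in auto)
  then have "AE t in lebesgue. t \<in> S \<longrightarrow> ennreal (h t) \<le> ennreal k * energy \<infinity> S' h'"
  proof eventually_elim
    case (elim t)
    show ?case
    proof
      assume t: "t \<in> S"
      have "ennreal (h t) \<le> ennreal k * ennreal (h' t)"
        using le[OF t] k h' by (simp add: ennreal_leI flip: ennreal_mult)
      also have "\<dots> \<le> ennreal k * energy \<infinity> S' h'" using elim t sub by (intro mult_left_mono) auto
      finally show "ennreal (h t) \<le> ennreal k * energy \<infinity> S' h'" .
    qed
  qed
  then show ?thesis unfolding True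
    by (intro energy_infinity_le_iff[THEN iffD2]) (use S in auto)
next
  case False
  have "(\<integral>\<^sup>+t\<in>S. ennreal (h t) \<partial>lebesgue) \<le> (\<integral>\<^sup>+t. ennreal k * (ennreal (h' t) * indicator S' t) \<partial>lebesgue)"
    using sub le k h' by (intro nn_integral_mono) (auto simp: indicator_def ennreal_leI simp flip: ennreal_mult)
  also have "\<dots> = ennreal k * (\<integral>\<^sup>+t\<in>S'. ennreal (h' t) \<partial>lebesgue)"
    using S by (intro nn_integral_cmult) measurable
  finally show ?thesis using False by (simp add: energy_def)
qed

lemma energy_Un:
  assumes [measurable]: "h \<in> borel_measurable lebesgue"
    and S [measurable]: "S \<in> sets lebesgue" "S' \<in> sets lebesgue"
  shows "energy p (S \<union> S') h \<le> energy p S h + energy p S' h"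
proof (cases "p = \<infinity>")
  case True
  have "AE t in lebesgue. t \<in> S \<longrightarrow> ennreal (h t) \<le> energy \<infinity> S h"
    "AE t in lebesgue. t \<in> S' \<longrightarrow> ennreal (h t) \<le> energy \<infinity> S' h"
    by (rule energy_infinity_le_iff[THEN iffD1, OF _ _ order_refl]; use S in simp)+
  then have "AE t in lebesgue. t \<in> S \<union> S' \<longrightarrow> ennreal (h t) \<le> energy \<infinity> S h + energy \<infinity> S' h"
    by eventually_elim (auto intro: add_increasing add_increasing2)
  then show ?thesis unfolding True
    by (intro energy_infinity_le_iff[THEN iffD2]) (use S in auto)
next
  case False
  have "(\<integral>\<^sup>+t\<in>S \<union> S'. ennreal (h t) \<partial>lebesgue) \<le>
      (\<integral>\<^sup>+t. ennreal (h t) * indicator S t + ennreal (h t) * indicator S' t \<partial>lebesgue)"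
    by (intro nn_integral_mono) (auto simp: indicator_def)
  also have "\<dots> = (\<integral>\<^sup>+t\<in>S. ennreal (h t) \<partial>lebesgue) + (\<integral>\<^sup>+t\<in>S'. ennreal (h t) \<partial>lebesgue)"
    using S by (intro nn_integral_add) measurable
  finally show ?thesis using False by (simp add: energy_def)
qed

text \<open>Exact additivity expresses the energy over \<open>E\<close> as a difference. It fails
  for the essential supremum, which is why infinite exponent needs an argument of its own.\<close>

lemma energy_disjoint_Un:
  assumes [measurable]: "h \<in> borel_measurable lebesgue"
    and S [measurable]: "S \<in> sets lebesgue" "S' \<in> sets lebesgue"
    and disj: "S \<inter> S' = {}" and p: "p \<noteq> \<infinity>"
  shows "energy p (S \<union> S') h = energy p S h + energy p S' h"
proof -
  have "(\<integral>\<^sup>+t\<in>S \<union> S'. ennreal (h t) \<partial>lebesgue) =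
      (\<integral>\<^sup>+t. ennreal (h t) * indicator S t + ennreal (h t) * indicator S' t \<partial>lebesgue)"
    using disj by (intro nn_integral_cong) (auto simp: indicator_def)
  also have "\<dots> = (\<integral>\<^sup>+t\<in>S. ennreal (h t) \<partial>lebesgue) + (\<integral>\<^sup>+t\<in>S'. ennreal (h t) \<partial>lebesgue)"
    using S by (intro nn_integral_add) measurable
  finally show ?thesis using p by (simp add: energy_def)
qed

subsection \<open>Weights satisfying a Remez inequality\<close>

text \<open>The weight will be \<open>u\<close> cut off to the circle, hence integrable on the line;
  \<open>C\<close> already contains the factor \<open>norm_exponent p\<close> that appears when the
  root is removed.\<close>

locale remez_weight =
  fixes p :: ennreal and v :: "real \<Rightarrow> real" and C :: real
  assumes p_pos: "0 < p" and C_pos: "0 < C"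
    and v_measurable [measurable]: "v \<in> borel_measurable lebesgue" and v_nonneg: "\<And>t. 0 \<le> v t"
    and v_integrable: "integrable lebesgue v"
    and remez_energy: "\<And>n T E. n \<ge> 1 \<Longrightarrow> trig_poly n T \<Longrightarrow> E \<in> sets lebesgue \<Longrightarrow> E \<subseteq> circle \<Longrightarrow>
      vol E \<le> 1 \<Longrightarrow>
      energy p circle (\<lambda>t. norm (T t) powr norm_exponent p * v t) \<le>
      ennreal (exp (C * real n * vol E)) * energy p (circle - E) (\<lambda>t. norm (T t) powr norm_exponent p * v t)"
begin

abbreviation "a \<equiv> norm_exponent p"

lemma a_pos: "a > 0"
  using p_pos by (rule norm_exponent_pos)

text \<open>For \<open>p = \<infinity>\<close> the Remez inequality forces the weight to be bounded: apply it to the constant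
  polynomial and to the set where the weight exceeds a large number.\<close>

lemma energy_weight_finite: "energy p circle v < \<infinity>"
proof (cases "p = \<infinity>")
  case False
  have "(\<integral>\<^sup>+t\<in>circle. ennreal (v t) \<partial>lebesgue) \<le> (\<integral>\<^sup>+t. ennreal (v t) \<partial>lebesgue)"
    by (intro nn_integral_mono) (auto simp: indicator_def)
  also have "\<dots> < \<infinity>"
    using v_integrable v_nonneg by (simp add: nn_integral_eq_integral)
  finally show ?thesis using False by (simp add: energy_def)
next
  case True
  \<comment> \<open>By Markov's inequality this level is exceeded on a set of measure at most 1; the
    summand 1 keeps it positive when the integral vanishes.\<close>
  define k where "k = integral\<^sup>L lebesgue v + 1"
  have k: "k > 0" using v_nonneg by (simp add: k_def add_nonneg_pos)
  define E where "E = {t \<in> circle. k \<le> v t}"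
  have "E = circle \<inter> {t \<in> space lebesgue. k \<le> v t}" by (auto simp: E_def)
  also have "\<dots> \<in> sets lebesgue" by (intro sets.Int) (simp, measurable)
  finally have E[measurable]: "E \<in> sets lebesgue" .
  have Ec: "E \<subseteq> circle" by (auto simp: E_def)
  have "emeasure lebesgue E \<le> emeasure lebesgue {t \<in> space lebesgue. k \<le> v t}"
  proof (rule emeasure_mono)
    show "{t \<in> space lebesgue. k \<le> v t} \<in> sets lebesgue" by measurable
  qed (auto simp: E_def)
  also have "\<dots> \<le> ennreal ((1 / k) * integral\<^sup>L lebesgue v)"
    using integral_Markov_inequality[OF v_integrable _ k] v_nonneg by simp
  also have "\<dots> \<le> ennreal 1" using k by (intro ennreal_leI) (simp add: k_def)
  finally have "vol E \<le> 1" unfolding measure_def by (intro enn2real_leI) auto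
  from remez_energy[OF _ trig_poly_const[of 1 1] E Ec this]
  have "energy p circle v \<le> ennreal (exp (C * vol E)) * energy p (circle - E) v" by simp
  also have "\<dots> < \<infinity>"
  proof -
    have "energy p (circle - E) v \<le> ennreal k"
      unfolding True
    proof (rule energy_infinity_le_iff[THEN iffD2])
      show "AE t in lebesgue. t \<in> circle - E \<longrightarrow> ennreal (v t) \<le> ennreal k"
        by (auto simp: E_def intro!: always_eventually ennreal_leI)
    qed auto
    then show ?thesis by (simp add: ennreal_mult_less_top le_less_trans)
  qed
  finally show ?thesis .
qed

text \<open>Real-valued, since admissible functions are bounded on a period and so have finite
  energy.\<close>

definition I :: "real set \<Rightarrow> (real \<Rightarrow> real) \<Rightarrow> real" where
  "I S \<phi> = enn2real (energy p S (\<lambda>t. \<phi> t powr a * v t))"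

definition admissible :: "(real \<Rightarrow> real) \<Rightarrow> bool" where
  "admissible \<phi> \<longleftrightarrow> continuous_on UNIV \<phi> \<and> (\<forall>t. 0 \<le> \<phi> t)"

lemma admissible_measurable:
  "admissible \<phi> \<Longrightarrow> (\<lambda>t. \<phi> t powr a * v t) \<in> borel_measurable lebesgue"
proof -
  assume "admissible \<phi>"
  then have [measurable]: "\<phi> \<in> borel_measurable lebesgue"
    by (simp add: admissible_def continuous_imp_borel_measurable_lebesgue)
  show ?thesis by measurable
qed

lemma admissible_trig_poly: "trig_poly n T \<Longrightarrow> admissible (\<lambda>t. norm (T t))"
  by (auto simp: admissible_def intro!: continuous_intros trig_poly_continuous)

lemma admissible_mult: "admissible \<phi> \<Longrightarrow> admissible \<psi> \<Longrightarrow> admissible (\<lambda>t. \<phi> t * \<psi> t)"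
  by (auto simp: admissible_def intro!: continuous_intros)

lemma energy_finite:
  assumes \<phi>: "admissible \<phi>" and S: "S \<in> sets lebesgue" "S \<subseteq> circle"
  shows "energy p S (\<lambda>t. \<phi> t powr a * v t) < \<infinity>"
proof -
  have "compact (\<phi> ` {0..2 * pi})"
    using \<phi> by (intro compact_continuous_image) (auto simp: admissible_def intro: continuous_on_subset)
  then obtain B where B: "\<And>t. t \<in> {0..2 * pi} \<Longrightarrow> \<phi> t \<le> B"
    using compact_imp_bounded bounded_imp_bdd_above unfolding bdd_above_def by (metis image_eqI)
  have "energy p S (\<lambda>t. \<phi> t powr a * v t) \<le> ennreal (B powr a) * energy p circle v"
  proof (rule energy_mono)
    fix t assume "t \<in> S"
    then have "t \<in> {0..2 * pi}" using S by (auto simp: circle_def)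
    then have "\<phi> t powr a \<le> B powr a"
      using B \<phi> a_pos by (intro powr_mono2) (auto simp: admissible_def)
    then show "\<phi> t powr a * v t \<le> B powr a * v t" using v_nonneg by (intro mult_right_mono)
  qed (use S v_nonneg admissible_measurable[OF \<phi>] in auto)
  then show ?thesis using energy_weight_finite by (simp add: ennreal_mult_less_top le_less_trans)
qed

lemma ennreal_I:
  assumes "admissible \<phi>" "S \<in> sets lebesgue" "S \<subseteq> circle"
  shows "ennreal (I S \<phi>) = energy p S (\<lambda>t. \<phi> t powr a * v t)"
  unfolding I_def using energy_finite[OF assms] by (simp add: less_top)

lemma I_nonneg: "0 \<le> I S \<phi>"
  by (simp add: I_def)

lemma I_mono:
  assumes \<phi>: "admissible \<phi>" "admissible \<psi>" and S: "S \<in> sets lebesgue" "S' \<in> sets lebesgue" "S \<subseteq> S'" "S' \<subseteq> circle"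
    and k: "0 \<le> k" and le: "\<And>t. t \<in> S \<Longrightarrow> \<phi> t \<le> k * \<psi> t"
  shows "I S \<phi> \<le> k powr a * I S' \<psi>"
proof -
  have "energy p S (\<lambda>t. \<phi> t powr a * v t) \<le> ennreal (k powr a) * energy p S' (\<lambda>t. \<psi> t powr a * v t)"
  proof (rule energy_mono)
    fix t assume t: "t \<in> S"
    have "\<phi> t powr a \<le> (k * \<psi> t) powr a"
      using le[OF t] a_pos \<phi> by (intro powr_mono2) (auto simp: admissible_def)
    also have "\<dots> = k powr a * \<psi> t powr a" using k \<phi> by (simp add: powr_mult admissible_def)
    finally show "\<phi> t powr a * v t \<le> k powr a * (\<psi> t powr a * v t)"
      using v_nonneg[of t] by (simp add: mult_right_mono flip: mult.assoc)
  qed (use S v_nonneg admissible_measurable \<phi> in auto)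
  then have "ennreal (I S \<phi>) \<le> ennreal (k powr a) * ennreal (I S' \<psi>)"
    using S \<phi> by (simp add: ennreal_I)
  then show ?thesis using I_nonneg by (simp flip: ennreal_mult)
qed

lemma I_subset:
  assumes "admissible \<phi>" "S \<in> sets lebesgue" "S' \<in> sets lebesgue" "S \<subseteq> S'" "S' \<subseteq> circle"
  shows "I S \<phi> \<le> I S' \<phi>"
  using I_mono[OF assms(1,1-5), of 1] by simp

lemma I_Un:
  assumes \<phi>: "admissible \<phi>" and S: "S \<in> sets lebesgue" "S' \<in> sets lebesgue" "S \<subseteq> circle" "S' \<subseteq> circle"
  shows "I (S \<union> S') \<phi> \<le> I S \<phi> + I S' \<phi>"
proof -
  have "ennreal (I (S \<union> S') \<phi>) \<le> ennreal (I S \<phi>) + ennreal (I S' \<phi>)"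
    using energy_Un[OF admissible_measurable[OF \<phi>] S(1,2)] S \<phi> by (simp add: ennreal_I)
  then show ?thesis using I_nonneg by (simp flip: ennreal_plus)
qed

lemma I_disjoint_Un:
  assumes \<phi>: "admissible \<phi>" and S: "S \<in> sets lebesgue" "S' \<in> sets lebesgue" "S \<subseteq> circle" "S' \<subseteq> circle"
    "S \<inter> S' = {}" and p: "p \<noteq> \<infinity>"
  shows "I (S \<union> S') \<phi> = I S \<phi> + I S' \<phi>"
proof -
  have "ennreal (I (S \<union> S') \<phi>) = ennreal (I S \<phi>) + ennreal (I S' \<phi>)"
    using energy_disjoint_Un[OF admissible_measurable[OF \<phi>] S(1,2,5) p] S \<phi> by (simp add: ennreal_I)
  then show ?thesis using I_nonneg by (simp flip: ennreal_plus)
qed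

lemma I_le_iff_AE:
  assumes \<phi>: "admissible \<phi>" and S: "S \<in> sets lebesgue" "S \<subseteq> circle" and p: "p = \<infinity>" and V: "0 \<le> V"
  shows "I S \<phi> \<le> V \<longleftrightarrow> (AE t in lebesgue. t \<in> S \<longrightarrow> \<phi> t * v t \<le> V)"
proof -
  have a: "a = 1" using p by (simp add: norm_exponent_def)
  have "I S \<phi> \<le> V \<longleftrightarrow> ennreal (I S \<phi>) \<le> ennreal V" using V by simp
  also have "\<dots> \<longleftrightarrow> energy p S (\<lambda>t. \<phi> t powr a * v t) \<le> ennreal V" using \<phi> S by (simp add: ennreal_I)
  also have "\<dots> \<longleftrightarrow> (AE t in lebesgue. t \<in> S \<longrightarrow> ennreal (\<phi> t powr a * v t) \<le> ennreal V)"
    unfolding p using p energy_infinity_le_iff[OF admissible_measurable[OF \<phi>] S(1)] by simp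
  also have "\<dots> \<longleftrightarrow> (AE t in lebesgue. t \<in> S \<longrightarrow> \<phi> t * v t \<le> V)"
    using a V \<phi> by (simp add: admissible_def)
  finally show ?thesis .
qed

lemma remez:
  assumes "n \<ge> 1" and T: "trig_poly n T" and E: "E \<in> sets lebesgue" "E \<subseteq> circle" "vol E \<le> 1"
  shows "I circle (\<lambda>t. norm (T t)) \<le> exp (C * real n * vol E) * I (circle - E) (\<lambda>t. norm (T t))"
proof -
  have "circle - E \<in> sets lebesgue" "circle - E \<subseteq> circle" using E by auto
  then have "ennreal (I circle (\<lambda>t. norm (T t))) \<le> ennreal (exp (C * real n * vol E)) * ennreal (I (circle - E) (\<lambda>t. norm (T t)))"
    using remez_energy[OF assms(1) T E] admissible_trig_poly[OF T] by (simp add: ennreal_I)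
  then show ?thesis using I_nonneg by (simp flip: ennreal_mult)
qed

end

subsection \<open>Removing a large set together with a small one\<close>

lemma abs_sin_ge:
  assumes "\<bar>x\<bar> \<le> pi"
  shows "2 / pi * min \<bar>x\<bar> (pi - \<bar>x\<bar>) \<le> \<bar>sin x\<bar>"
proof -
  have "2 / pi * min \<bar>x\<bar> (pi - \<bar>x\<bar>) \<le> sin \<bar>x\<bar>"
  proof (cases "\<bar>x\<bar> \<le> pi / 2")
    case True
    then show ?thesis using jordan_sin_ge[of "\<bar>x\<bar>"] by (simp add: min_def)
  next
    case False
    then show ?thesis using jordan_sin_ge[of "pi - \<bar>x\<bar>"] assms by (simp add: min_def)
  qed
  also have "\<dots> \<le> \<bar>sin x\<bar>" by (simp add: abs_if)
  finally show ?thesis .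
qed

text \<open>As \<open>t - \<tau>\<close> ranges within \<open>(- 2 * pi, 2 * pi)\<close>, the half
  angle is close to a zero of sine only near \<open>\<tau>\<close> or one of its two translates by a
  period. Three intervals of length \<open>pi / 12\<close> have total length
  \<open>pi / 4 < 1\<close>, which explains 1/24.\<close>

lemma measure_arc_le:
  assumes \<tau>: "\<tau> \<in> circle"
  shows "{t \<in> circle. \<bar>sin ((t - \<tau>) / 2)\<bar> < 1 / 24} \<in> sets lebesgue"
    and "vol {t \<in> circle. \<bar>sin ((t - \<tau>) / 2)\<bar> < 1 / 24} \<le> 1"
proof -
  let ?B = "{t \<in> circle. \<bar>sin ((t - \<tau>) / 2)\<bar> < 1 / 24}"
  have [measurable]: "(\<lambda>t. \<bar>sin ((t - \<tau>) / 2)\<bar>) \<in> borel_measurable lebesgue"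
    by (intro continuous_imp_borel_measurable_lebesgue continuous_intros) auto
  have "?B = circle \<inter> {t \<in> space lebesgue. \<bar>sin ((t - \<tau>) / 2)\<bar> < 1 / 24}" by auto
  also have "\<dots> \<in> sets lebesgue" by (intro sets.Int) (simp, measurable)
  finally show B: "?B \<in> sets lebesgue" .
  define w where "w = pi / 24"
  define J where "J c = {c - w..c + w}" for c :: real
  have mJ: "J c \<in> lmeasurable" "vol (J c) = 2 * w" for c
    by (auto simp: J_def w_def)
  have "?B \<subseteq> J \<tau> \<union> (J (\<tau> + 2 * pi) \<union> J (\<tau> - 2 * pi))"
  proof
    fix t assume t: "t \<in> ?B"
    define x where "x = (t - \<tau>) / 2"
    have x: "\<bar>x\<bar> \<le> pi" using t \<tau> by (auto simp: x_def circle_def)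
    have "\<bar>sin x\<bar> < 1 / 24" using t by (simp add: x_def)
    with abs_sin_ge[OF x] have "2 / pi * min \<bar>x\<bar> (pi - \<bar>x\<bar>) < 1 / 24" by linarith
    then have "2 * min \<bar>x\<bar> (pi - \<bar>x\<bar>) < w" by (simp add: w_def field_simps)
    then have "\<bar>t - \<tau>\<bar> < w \<or> 2 * pi - \<bar>t - \<tau>\<bar> < w" by (auto simp: x_def min_def split: if_splits)
    moreover have "\<bar>t - \<tau>\<bar> < 2 * pi" using t \<tau> by (auto simp: circle_def)
    ultimately show "t \<in> J \<tau> \<union> (J (\<tau> + 2 * pi) \<union> J (\<tau> - 2 * pi))"
      unfolding J_def Un_iff atLeastAtMost_iff by (smt (verit))
  qed
  then have "vol ?B \<le> vol (J \<tau> \<union> (J (\<tau> + 2 * pi) \<union> J (\<tau> - 2 * pi)))"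
    using B mJ by (intro measure_mono_fmeasurable) (auto intro!: fmeasurable.Un)
  also have "\<dots> \<le> vol (J \<tau>) + (vol (J (\<tau> + 2 * pi)) + vol (J (\<tau> - 2 * pi)))"
    using mJ by (intro order_trans[OF measure_Un_le] add_left_mono measure_Un_le) auto
  also have "\<dots> \<le> 1" using pi_less_4 by (simp add: mJ w_def)
  finally show "vol ?B \<le> 1" .
qed

text \<open>Pigeonhole over \<open>m\<close> equal arcs.\<close>

lemma dense_arc_exists:
  assumes E: "E \<in> sets lebesgue" "E \<subseteq> circle" and m: "m \<ge> (1::nat)"
  obtains \<tau> J where "\<tau> \<in> circle" "J \<in> sets lebesgue" "J \<subseteq> circle"
    "\<And>t. t \<in> J \<Longrightarrow> \<bar>t - \<tau>\<bar> \<le> 2 * pi / real m"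
    "vol E \<le> real m * vol (E \<inter> J)"
proof -
  define w where "w = 2 * pi / real m"
  have w: "w > 0" "real m * w = 2 * pi" using m by (auto simp: w_def)
  define J where "J j = {real j * w..<(real j + 1) * w}" for j :: nat
  have cover: "circle \<subseteq> (\<Union>j<m. J j)"
  proof
    fix t assume t: "t \<in> circle"
    define j where "j = nat \<lfloor>t / w\<rfloor>"
    have t0: "0 \<le> t" "t < real m * w" using t w by (auto simp: circle_def)
    have "0 \<le> t / w" "t / w < real m" using t0 w by (auto simp: field_simps)
    then have j: "real j \<le> t / w" "t / w < real j + 1" "j < m" unfolding j_def by linarith+
    then have "t \<in> J j" using w by (auto simp: J_def field_simps)
    then show "t \<in> (\<Union>j<m. J j)" using j by blast
  qed
  have Jc: "J j \<subseteq> circle" if "j < m" for j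
  proof -
    have "(real j + 1) * w \<le> real m * w" using that w by (intro mult_right_mono) auto
    then show ?thesis using w by (auto simp: J_def circle_def intro: order_trans[rotated])
  qed
  have Jm: "J j \<in> sets lebesgue" for j by (simp add: J_def)
  have El: "E \<in> lmeasurable"
    using E by (intro fmeasurableI2[OF circle_lmeasurable(1)]) auto
  have EJ: "E \<inter> J j \<in> lmeasurable" for j using El Jm by (rule fmeasurable_Int_fmeasurable)
  have "E = (\<Union>j<m. E \<inter> J j)" using cover E by auto
  then have "vol E \<le> (\<Sum>j<m. vol (E \<inter> J j))"
    using measure_UNION_le[of "{..<m}" "\<lambda>j. E \<inter> J j" lebesgue] EJ by (auto simp: fmeasurableD)
  moreover have "\<exists>j<m. vol E \<le> real m * vol (E \<inter> J j)"
  proof (rule ccontr)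
    assume "\<not> ?thesis"
    then have "\<And>j. j < m \<Longrightarrow> vol (E \<inter> J j) < vol E / real m"
      using m by (auto simp: field_simps not_le)
    then have "(\<Sum>j<m. vol (E \<inter> J j)) < (\<Sum>j<m. vol E / real m)"
      using m by (intro sum_strict_mono) (auto simp: lessThan_empty_iff)
    then show False using calculation m by simp
  qed
  ultimately obtain j where j: "j < m" "vol E \<le> real m * vol (E \<inter> J j)" by blast
  show thesis
  proof (rule that[of "real j * w" "J j"])
    show "real j * w \<in> circle" using Jc[OF j(1)] w by (auto simp: J_def)
    show "\<bar>t - real j * w\<bar> \<le> 2 * pi / real m" if "t \<in> J j" for t
    proof -
      have "\<bar>t - real j * w\<bar> \<le> w" using that by (auto simp: J_def algebra_simps)
      then show ?thesis by (simp only: w_def)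
    qed
  qed (use Jc[OF j(1)] Jm j in auto)
qed

context remez_weight
begin

text \<open>A high power of \<open>sin\<^sup>2((t - \<tau>) / 2)\<close> is negligible on a tiny arc around \<open>\<tau>\<close> that carries a fixed
  portion of \<open>E\<close>. Hence this portion need not be removed, which makes room for \<open>Z\<close>.\<close>

lemma remez_large_set:
  "\<exists>\<epsilon>>0. \<exists>C'>0. \<forall>n\<ge>1. \<forall>T E Z. trig_poly n T \<longrightarrow> E \<in> sets lebesgue \<longrightarrow> E \<subseteq> circle \<longrightarrow>
     1 / 2 \<le> vol E \<longrightarrow> vol E \<le> 1 \<longrightarrow>
     Z \<in> sets lebesgue \<longrightarrow> Z \<subseteq> circle \<longrightarrow> vol Z \<le> \<epsilon> \<longrightarrow>
     I circle (\<lambda>t. norm (T t)) \<le> exp (C' * real n) * I (circle - (E \<union> Z)) (\<lambda>t. norm (T t))"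
proof -
  \<comment> \<open>The square of 1/24: outside the arc \<open>B\<close> one has
    \<open>\<sigma> \<ge> s\<close>.\<close>
  define s :: real where "s = 1 / 576"
  \<comment> \<open>With \<open>r / s \<le> 1 / K\<close>, the number
    \<open>(r / s) powr a * exp (3 * C)\<close> is at most 1/2.\<close>
  define K where "K = (2 * exp (3 * C)) powr (1 / a)"
  have K: "K > 0" "K powr a = 2 * exp (3 * C)" using a_pos by (auto simp: K_def powr_powr)
  obtain m :: nat where m: "1 + 576 * pi\<^sup>2 * K \<le> real m"
    using real_arch_simple by blast
  have m1: "m \<ge> 1" using m K by (smt (verit) mult_nonneg_nonneg of_nat_1 of_nat_le_iff zero_le_power2)
  define r where "r = (pi / real m)\<^sup>2"
  have r: "r > 0" "(r / s) powr a * (2 * exp (3 * C)) \<le> 1"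
  proof -
    show "r > 0" using m1 by (simp add: r_def)
    have "576 * pi\<^sup>2 * K \<le> real m * 1" using m by simp
    also have "\<dots> \<le> real m * real m" using m1 by (intro mult_left_mono) auto
    finally have "r / s * K \<le> 1" using m1 by (simp add: r_def s_def field_simps power2_eq_square)
    then have "(r / s * K) powr a \<le> 1 powr a"
      using \<open>r > 0\<close> K a_pos by (intro powr_mono2) (auto simp: s_def)
    then show "(r / s) powr a * (2 * exp (3 * C)) \<le> 1"
      using \<open>r > 0\<close> K by (simp add: powr_mult s_def)
  qed
  \<comment> \<open>\<open>J\<close> carries at least \<open>vol E / m \<ge> 1 / (2 * m)\<close> of
    \<open>E\<close>; not removing it compensates for removing \<open>Z\<close>.\<close>
  define \<epsilon> where "\<epsilon> = 1 / (2 * real m)"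
  define C' where "C' = ln 2 + 3 * C + a * ln 576"
  have pp: "(x ^ n) powr a = (x powr a) ^ n" if "x > 0" for x :: real and n
    using that by (simp add: powr_powr mult.commute flip: powr_realpow)
  have "I circle (\<lambda>t. norm (T t)) \<le> exp (C' * real n) * I (circle - (E \<union> Z)) (\<lambda>t. norm (T t))"
    if n: "n \<ge> 1" and T: "trig_poly n T" and E: "E \<in> sets lebesgue" "E \<subseteq> circle"
      and Eh: "1 / 2 \<le> vol E" and E1: "vol E \<le> 1"
      and Z: "Z \<in> sets lebesgue" "Z \<subseteq> circle" "vol Z \<le> \<epsilon>" for n T E Z
  proof -
    obtain \<tau> J where \<tau>: "\<tau> \<in> circle" and J: "J \<in> sets lebesgue" "J \<subseteq> circle"
      "\<And>t. t \<in> J \<Longrightarrow> \<bar>t - \<tau>\<bar> \<le> 2 * pi / real m"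
      and EJ: "vol E \<le> real m * vol (E \<inter> J)"
      using dense_arc_exists[OF E m1] by blast
    define \<sigma> where "\<sigma> t = (1 - cos (t - \<tau>)) / 2" for t
    have \<sigma>_eq: "\<sigma> t = (sin ((t - \<tau>) / 2))\<^sup>2" for t
      using cos_double_sin[of "(t - \<tau>) / 2"] by (simp add: \<sigma>_def del: right_diff_distrib_numeral)
    have \<sigma>01: "0 \<le> \<sigma> t" "\<sigma> t \<le> 1" for t
      using cos_ge_minus_one[of "t - \<tau>"] by (auto simp: \<sigma>_def)
    define B where "B = {t \<in> circle. \<bar>sin ((t - \<tau>) / 2)\<bar> < 1 / 24}"
    have B: "B \<in> sets lebesgue" "B \<subseteq> circle" "vol B \<le> 1"
      unfolding B_def by (fact measure_arc_le(1)[OF \<tau>], blast, fact measure_arc_le(2)[OF \<tau>])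
    have "trig_poly 1 (\<lambda>t. complex_of_real (\<sigma> t))"
      using trig_poly_cmult[OF trig_poly_diff[OF trig_poly_const[of 1 1] trig_poly_cos[of \<tau>]], of "1/2"]
      by (simp add: \<sigma>_def)
    from trig_poly_mult[OF T trig_poly_power[OF this, of n]]
    have TP: "trig_poly (2 * n) (\<lambda>t. T t * complex_of_real (\<sigma> t) ^ n)" by (simp add: mult_2)
    define \<phi> where "\<phi> t = norm (T t)" for t
    define \<psi> where "\<psi> t = norm (T t * complex_of_real (\<sigma> t) ^ n)" for t
    have \<psi>_eq: "\<psi> t = \<phi> t * \<sigma> t ^ n" for t
      using \<sigma>01[of t] by (simp add: \<psi>_def \<phi>_def norm_mult norm_power)
    have adm: "admissible \<phi>" "admissible \<psi>"
      unfolding \<phi>_def \<psi>_def using T TP by (auto intro: admissible_trig_poly)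
    have \<phi>0: "\<phi> t \<ge> 0" for t by (simp add: \<phi>_def)
    define E' where "E' = (E \<union> Z) - J"
    have El: "E \<in> lmeasurable" "Z \<in> lmeasurable"
      using E Z by (auto intro: fmeasurableI2[OF circle_lmeasurable(1)])
    have E': "E' \<in> sets lebesgue" "E' \<subseteq> circle" "vol E' \<le> 1"
    proof -
      show "E' \<in> sets lebesgue" "E' \<subseteq> circle" using E Z J by (auto simp: E'_def)
      have EmJ: "E - J \<in> lmeasurable" "Z - J \<in> lmeasurable" "E \<inter> J \<in> lmeasurable"
        using El J by (auto intro: fmeasurable_Diff fmeasurable_Int_fmeasurable)
      have "vol E = vol (E \<inter> J) + vol (E - J)"
        using measure_Union[of lebesgue "E \<inter> J" "E - J"] fmeasurableD[OF EmJ(1)] fmeasurableD[OF EmJ(3)]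
          fmeasurableD2[OF EmJ(1)] fmeasurableD2[OF EmJ(3)]
        by (simp add: Int_Diff_Un Int_Diff_disjoint)
      moreover have "\<epsilon> \<le> vol (E \<inter> J)"
        using EJ Eh m1 by (simp add: \<epsilon>_def field_simps)
      moreover have "vol E' \<le> vol (E - J) + vol (Z - J)"
        unfolding E'_def Un_Diff using EmJ by (intro measure_Un_le) auto
      moreover have "vol (Z - J) \<le> vol Z"
        using EmJ El by (intro measure_mono_fmeasurable) auto
      ultimately show "vol E' \<le> 1" using E1 Z(3) by linarith
    qed
    have exp_le: "exp (C * real k * x) \<le> exp (C * real k)" if "x \<le> 1" for k :: nat and x
      using that C_pos mult_left_mono[of x 1 "C * real k"] by simp
    have 1: "I circle \<phi> \<le> exp (C * real n) * I (circle - B) \<phi>"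
      using remez[OF n T B] mult_right_mono[OF exp_le[OF B(3), of n] I_nonneg[of "circle - B" \<phi>]]
      unfolding \<phi>_def by linarith
    have 2: "I (circle - B) \<phi> \<le> (1 / s ^ n) powr a * I circle \<psi>"
    proof (rule I_mono[OF adm])
      fix t assume "t \<in> circle - B"
      then have "(1 / 24)\<^sup>2 \<le> \<bar>sin ((t - \<tau>) / 2)\<bar>\<^sup>2" by (intro power_mono) (auto simp: B_def)
      then have "s \<le> \<sigma> t" by (simp add: \<sigma>_eq s_def power_divide)
      then have "s ^ n \<le> \<sigma> t ^ n" by (intro power_mono) (auto simp: s_def)
      then have "\<phi> t * s ^ n \<le> \<psi> t" unfolding \<psi>_eq using \<phi>0 by (intro mult_left_mono)
      then show "\<phi> t \<le> 1 / s ^ n * \<psi> t" by (simp add: s_def field_simps)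
    qed (use B in \<open>auto simp: s_def\<close>)
    have 3: "I circle \<psi> \<le> exp (2 * C * real n) * I (circle - E') \<psi>"
      using remez[OF _ TP E'] n mult_right_mono[OF exp_le[OF E'(3), of "2 * n"] I_nonneg[of "circle - E'" \<psi>]]
      unfolding \<psi>_def by (simp add: mult_ac)
    have 4: "I (circle - E') \<psi> \<le> I (circle - (E \<union> Z)) \<phi> + (r ^ n) powr a * I circle \<phi>"
    proof -
      have "I (circle - E') \<psi> \<le> I ((circle - (E \<union> Z)) \<union> J) \<psi>"
      proof (rule I_subset[OF adm(2)])
        show "circle - (E \<union> Z) \<union> J \<in> sets lebesgue"
          using E(1) Z(1) J(1) by (intro sets.Un sets.Diff circle_lmeasurable(2))
      qed (use E' E Z J in \<open>auto simp: E'_def\<close>)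
      also have "\<dots> \<le> I (circle - (E \<union> Z)) \<psi> + I J \<psi>"
        using E Z J by (intro I_Un adm) auto
      also have "I (circle - (E \<union> Z)) \<psi> \<le> 1 powr a * I (circle - (E \<union> Z)) \<phi>"
      proof (rule I_mono[OF adm(2,1)])
        fix t show "\<psi> t \<le> 1 * \<phi> t"
          unfolding \<psi>_eq using \<sigma>01 \<phi>0 by (simp add: mult_left_le power_le_one)
      qed (use E Z in auto)
      also have "I J \<psi> \<le> (r ^ n) powr a * I circle \<phi>"
      proof (rule I_mono[OF adm(2,1)])
        fix t assume t: "t \<in> J"
        have "\<bar>sin ((t - \<tau>) / 2)\<bar> \<le> \<bar>(t - \<tau>) / 2\<bar>" by (rule abs_sin_x_le_abs_x)
        also have "\<dots> \<le> pi / real m" using J(3)[OF t] by (simp add: mult.commute)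
        finally have "\<bar>sin ((t - \<tau>) / 2)\<bar>\<^sup>2 \<le> (pi / real m)\<^sup>2" by (intro power_mono) auto
        then have "\<sigma> t \<le> r" by (simp add: \<sigma>_eq r_def)
        then have "\<sigma> t ^ n \<le> r ^ n" using \<sigma>01 by (intro power_mono) auto
        then show "\<psi> t \<le> r ^ n * \<phi> t" unfolding \<psi>_eq mult.commute[of "r ^ n"] by (intro mult_left_mono \<phi>0)
      qed (use J r in auto)
      finally show ?thesis by simp
    qed
    \<comment> \<open>Of \<open>3 * C\<close>, one \<open>C\<close> comes from removing
      \<open>B\<close> at degree \<open>n\<close> and \<open>2 * C\<close> from removing
      \<open>E'\<close> at degree \<open>2 * n\<close>; the power of \<open>1 / s\<close> undoes the
      multiplication by \<open>\<sigma> ^ n\<close>.\<close>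
    let ?G = "exp (3 * C * real n) * (1 / s ^ n) powr a"
    have G0: "?G \<ge> 0" by simp
    have G_pow: "?G = (exp (3 * C) * (1 / s) powr a) ^ n"
    proof -
      have "exp (3 * C * real n) = exp (3 * C) ^ n" by (simp add: mult.commute flip: exp_of_nat_mult)
      moreover have "(1 / s ^ n) powr a = ((1 / s) powr a) ^ n"
        using pp[of "1 / s" n] by (simp add: s_def power_divide)
      ultimately show ?thesis by (simp only: power_mult_distrib)
    qed
    have G: "?G = exp (C * real n) * (1 / s ^ n) powr a * exp (2 * C * real n)"
    proof -
      have "exp (3 * C * real n) = exp (C * real n) * exp (2 * C * real n)"
        by (simp flip: exp_add)
      then show ?thesis by (simp only: mult_ac)
    qed
    have "I circle \<phi> \<le> exp (C * real n) * ((1 / s ^ n) powr a * I circle \<psi>)"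
      by (rule order_trans[OF 1 mult_left_mono[OF 2]]) simp
    also have "\<dots> = exp (C * real n) * (1 / s ^ n) powr a * I circle \<psi>" by simp
    also have "\<dots> \<le> exp (C * real n) * (1 / s ^ n) powr a * (exp (2 * C * real n) * I (circle - E') \<psi>)"
      by (rule mult_left_mono[OF 3]) simp
    also have "\<dots> = ?G * I (circle - E') \<psi>" unfolding G by simp
    also have "\<dots> \<le> ?G * (I (circle - (E \<union> Z)) \<phi> + (r ^ n) powr a * I circle \<phi>)"
      by (rule mult_left_mono[OF 4 G0])
    also have "\<dots> = ?G * I (circle - (E \<union> Z)) \<phi> + (?G * (r ^ n) powr a) * I circle \<phi>"
      by (simp add: algebra_simps)
    \<comment> \<open>What \<open>J\<close> contributes is at most half of the left-hand side and
      can be absorbed into it.\<close>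
    also have "?G * (r ^ n) powr a \<le> 1 / 2"
    proof -
      have "?G * (r ^ n) powr a = (exp (3 * C) * ((1 / s) powr a * r powr a)) ^ n"
        unfolding G_pow pp[OF r(1)] by (simp only: power_mult_distrib mult.assoc)
      also have "(1 / s) powr a * r powr a = (r / s) powr a"
        using r(1) powr_mult[of "1 / s" r a] by (simp add: s_def mult.commute)
      also have "(exp (3 * C) * (r / s) powr a) ^ n \<le> (1 / 2) ^ n" using r by (intro power_mono) (auto simp: field_simps)
      also have "\<dots> \<le> (1 / 2) ^ 1" using n by (intro power_decreasing) auto
      finally show ?thesis by simp
    qed
    finally have "I circle \<phi> \<le> ?G * I (circle - (E \<union> Z)) \<phi> + 1 / 2 * I circle \<phi>"
      using I_nonneg[of circle \<phi>] by (simp add: mult_right_mono)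
    then have "I circle \<phi> \<le> (2 * ?G) * I (circle - (E \<union> Z)) \<phi>" by simp
    also have "\<dots> \<le> exp (C' * real n) * I (circle - (E \<union> Z)) \<phi>"
    proof (intro mult_right_mono I_nonneg)
      have "2 * ?G \<le> 2 ^ n * ?G"
        using n power_increasing[of 1 n "2::real"] by (intro mult_right_mono G0) auto
      also have "\<dots> = (2 * (exp (3 * C) * (1 / s) powr a)) ^ n" unfolding G_pow by (simp only: power_mult_distrib)
      also have "2 * (exp (3 * C) * (1 / s) powr a) = exp C'"
        by (simp add: C'_def s_def powr_def exp_add mult.assoc)
      also have "exp C' ^ n = exp (C' * real n)" by (simp add: mult.commute flip: exp_of_nat_mult)
      finally show "2 * ?G \<le> exp (C' * real n)" .
    qed
    finally show ?thesis unfolding \<phi>_def .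
  qed
  moreover have "\<epsilon> > 0" using m1 by (simp add: \<epsilon>_def)
  moreover have "C' > 0" using C_pos a_pos by (simp add: C'_def add_pos_pos)
  ultimately show ?thesis by blast
qed

end

subsection \<open>Weights with good polynomial approximation\<close>

text \<open>Isolates the properties of \<open>f\<close> on which the rest of the argument relies;
  \<open>exp (- \<mu> n)\<close> is the level below which \<open>f\<close> is regarded as small at
  degree \<open>n\<close>.\<close>

definition fast_approximable :: "(real \<Rightarrow> real) \<Rightarrow> (nat \<Rightarrow> real) \<Rightarrow> real \<Rightarrow> bool" where
  "fast_approximable f \<mu> L \<longleftrightarrow> L > 0 \<and> continuous_on UNIV f \<and> (\<forall>t. 0 \<le> f t \<and> f t \<le> 1) \<and>
    filterlim \<mu> at_top sequentially \<and> (\<lambda>n. \<mu> n / real n) \<longlonglongrightarrow> 0 \<and>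
    (\<forall>\<^sub>F n in sequentially. vol {t \<in> circle. f t < exp (- \<mu> n)} \<le> L * \<mu> n / real n) \<and>
    (\<forall>N>0. \<exists>c::nat. \<forall>\<^sub>F n in sequentially. \<exists>e. approximation_error f (c * n) (exp (- N * \<mu> n)) e)"

lemma fast_approximableD:
  assumes "fast_approximable f \<mu> L"
  shows "L > 0" "continuous_on UNIV f" "0 \<le> f t" "f t \<le> 1"
    "filterlim \<mu> at_top sequentially" "(\<lambda>n. \<mu> n / real n) \<longlonglongrightarrow> 0"
    "\<forall>\<^sub>F n in sequentially. vol {t \<in> circle. f t < exp (- \<mu> n)} \<le> L * \<mu> n / real n"
    "N > 0 \<Longrightarrow> \<exists>c::nat. \<forall>\<^sub>F n in sequentially. \<exists>e. approximation_error f (c * n) (exp (- N * \<mu> n)) e"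
  using assms unfolding fast_approximable_def by blast+

lemma fast_approximable_eventually:
  assumes f: "fast_approximable f \<mu> L" and \<epsilon>: "\<epsilon> > 0"
  shows "\<forall>\<^sub>F n in sequentially. L * \<mu> n / real n < \<epsilon> \<and> 1 \<le> \<mu> n \<and> n \<ge> 1 \<and>
    vol {t \<in> circle. f t < exp (- \<mu> n)} \<le> L * \<mu> n / real n"
proof -
  have "(\<lambda>n. L * (\<mu> n / real n)) \<longlonglongrightarrow> L * 0"
    by (intro tendsto_mult_left fast_approximableD(6)[OF f])
  then have "\<forall>\<^sub>F n in sequentially. L * (\<mu> n / real n) < \<epsilon>" using \<epsilon> by (auto dest: order_tendstoD)
  moreover have "\<forall>\<^sub>F n in sequentially. 1 \<le> \<mu> n"
    using fast_approximableD(5)[OF f] unfolding filterlim_at_top by blast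
  ultimately show ?thesis
    using fast_approximableD(7)[OF f] eventually_ge_at_top[of "1::nat"]
    by eventually_elim auto
qed

lemma omega_fun_fast_approximable:
  assumes "A > 0" "Omega_inner A g" "Omega_outer A F"
  shows "\<exists>\<mu> L. fast_approximable (omega_fun F g) \<mu> L"
proof -
  have sp: "smooth_periodic (\<lambda>k. (deriv ^^ k) (omega_fun F g))" using assms by (rule omega_fun_smooth)
  have 1: "continuous_on UNIV (omega_fun F g)"
    using smooth_periodic_continuous[OF sp, of UNIV 0] by simp
  have 2: "0 \<le> omega_fun F g t \<and> omega_fun F g t \<le> 1" for t
  proof -
    have "g t \<in> {-A..A}" using assms(2) unfolding Omega_inner_def by blast
    then have "g t \<noteq> 0 \<Longrightarrow> F (g t) > 0" using assms(3) unfolding Omega_outer_def by blast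
    then show ?thesis by (auto simp: omega_fun_def)
  qed
  show ?thesis
    using omega_fun_approximation[OF assms] 1 2 unfolding fast_approximable_def by blast
qed

lemma sublevel_sets: "continuous_on UNIV f \<Longrightarrow> {t \<in> circle. f t < (x::real)} \<in> sets lebesgue"
proof -
  assume "continuous_on UNIV f"
  then have [measurable]: "f \<in> borel_measurable lebesgue" by (rule continuous_imp_borel_measurable_lebesgue)
  have "{t \<in> circle. f t < x} = circle \<inter> {t \<in> space lebesgue. f t < x}" by auto
  also have "\<dots> \<in> sets lebesgue" by (intro sets.Int) (simp, measurable)
  finally show ?thesis .
qed

text \<open>Bernoulli's inequality. For \<open>y = exp (c * x)\<close> it turns
  \<open>1 + k * (y - 1)\<close> into an exponential of a multiple of \<open>x\<close>, so a
  constant in front of \<open>y - 1\<close> is tolerable for arbitrarily small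
  \<open>x\<close>.\<close>

lemma one_plus_mult_le_power:
  assumes "y \<ge> (1::real)" "0 \<le> k"
  shows "1 + k * (y - 1) \<le> y ^ nat \<lceil>k\<rceil>"
proof -
  have "k * (y - 1) \<le> real (nat \<lceil>k\<rceil>) * (y - 1)" using assms by (intro mult_right_mono) linarith+
  moreover have "1 + real (nat \<lceil>k\<rceil>) * (y - 1) \<le> (1 + (y - 1)) ^ nat \<lceil>k\<rceil>"
    by (rule Bernoulli_inequality) (use assms in simp)
  ultimately show ?thesis by simp
qed

text \<open>Added to an approximant \<open>f - e\<close>, this trigonometric polynomial of degree one yields a minorant
  of \<open>f\<close> that touches \<open>f\<close> at \<open>r\<close>.\<close>

lemma touching_correction:
  assumes e: "smooth_periodic e" and b: "\<And>i t. i \<le> 2 \<Longrightarrow> \<bar>e i t\<bar> \<le> \<eta>"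
  shows "e 0 r + e 1 r * sin (t - r) - 16 * \<eta> * (1 - cos (t - r)) \<le> e 0 t"
    and "e 0 t - 35 * \<eta> \<le> e 0 r + e 1 r * sin (t - r) - 16 * \<eta> * (1 - cos (t - r))"
proof -
  have \<eta>: "\<eta> \<ge> 0" using b[of 0 0] by simp
  have der: "(e i has_real_derivative e (Suc i) t) (at t)" for i t
    using e by (simp add: smooth_periodic_def)
  have *: "e 0 r + e 1 r * sin (t - r) - 16 * \<eta> * (1 - cos (t - r)) \<le> e 0 t" if t: "\<bar>t - r\<bar> \<le> pi" for t
  proof -
    define x where "x = t - r"
    have "norm (e 0 t - (\<Sum>i\<le>1. e i r * (t - r) ^ i / fact i)) \<le> \<eta> * norm (t - r) ^ Suc 1 / fact 1"
      by (rule field_Taylor[where S = UNIV]) (use der b[of 2] in \<open>auto simp: numeral_2_eq_2\<close>)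
    then have 1: "\<bar>e 0 t - e 0 r - e 1 r * x\<bar> \<le> \<eta> * x\<^sup>2"
      by (simp add: x_def diff_diff_eq power2_eq_square abs_mult_self_eq)
    have sin: "\<bar>sin x - x\<bar> \<le> x\<^sup>2"
    proof -
      define d :: "nat \<Rightarrow> real \<Rightarrow> real" where
        "d i = (if i = 0 then sin else if i = 1 then cos else (\<lambda>x. - sin x))" for i
      have "norm (d 0 x - (\<Sum>i\<le>1. d i 0 * (x - 0) ^ i / fact i)) \<le> 1 * norm (x - 0) ^ Suc 1 / fact 1"
        by (rule field_Taylor[where S = UNIV])
           (auto simp: d_def le_Suc_eq intro!: derivative_eq_intros)
      then show ?thesis by (simp add: d_def power2_eq_square abs_mult_self_eq)
    qed
    have 2: "\<bar>e 1 r * (sin x - x)\<bar> \<le> \<eta> * x\<^sup>2"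
      unfolding abs_mult using b[of 1 r] sin \<eta> by (intro mult_mono) auto
    have 3: "x\<^sup>2 \<le> 8 * (1 - cos x)"
    proof -
      have "2 / pi * \<bar>x / 2\<bar> \<le> \<bar>sin (x / 2)\<bar>"
        using abs_sin_ge[of "x / 2"] t by (simp add: x_def min_def split: if_splits)
      then have "\<bar>x\<bar> \<le> pi * \<bar>sin (x / 2)\<bar>" by (simp add: field_simps)
      also have "\<dots> \<le> 4 * \<bar>sin (x / 2)\<bar>" using pi_less_4 by (intro mult_right_mono) auto
      finally have "\<bar>x\<bar>\<^sup>2 \<le> (4 * \<bar>sin (x / 2)\<bar>)\<^sup>2" by (intro power_mono) auto
      then show ?thesis using cos_double_sin[of "x / 2"] by (simp add: power_mult_distrib)
    qed
    have "\<eta> * x\<^sup>2 \<le> \<eta> * (8 * (1 - cos x))" using 3 \<eta> by (rule mult_left_mono)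
    \<comment> \<open>Taylor's formula for \<open>e 0\<close> and the replacement of
      \<open>x\<close> by \<open>sin x\<close> each cost \<open>\<eta> * x ^ 2\<close>; together
      with \<open>x ^ 2 \<le> 8 * (1 - cos x)\<close> this gives the coefficient 16.\<close>
    then have 4: "2 * (\<eta> * x\<^sup>2) \<le> 16 * \<eta> * (1 - cos x)" by (simp add: algebra_simps)
    have "e 1 r * (sin x - x) = e 1 r * sin x - e 1 r * x" by (rule right_diff_distrib)
    with 1 2 4 show ?thesis unfolding x_def[symmetric] by linarith
  qed
  define k where "k = \<lfloor>(t - r + pi) / (2 * pi)\<rfloor>"
  define t' where "t' = t + 2 * pi * of_int (- k)"
  have "2 * pi * of_int k \<le> t - r + pi" "t - r + pi < 2 * pi * of_int k + 2 * pi"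
    using floor_divide_lower[of "2 * pi" "t - r + pi"] floor_divide_upper[of "2 * pi" "t - r + pi"]
    by (simp_all add: k_def algebra_simps)
  then have "\<bar>t' - r\<bar> \<le> pi" by (simp add: t'_def abs_le_iff)
  moreover have "e 0 t' = e 0 t"
    unfolding t'_def by (rule periodic_2pi_of_int) (use e in \<open>simp add: smooth_periodic_def\<close>)
  moreover have "sin (t' - r) = sin (t - r)" "cos (t' - r) = cos (t - r)"
  proof -
    have "t' - r = (t - r) + 2 * pi * of_int (- k)" by (simp add: t'_def)
    then show "sin (t' - r) = sin (t - r)" "cos (t' - r) = cos (t - r)"
      by (simp_all only: periodic_2pi_of_int[of sin] periodic_2pi_of_int[of cos] periodic_2pi_def sin_periodic cos_periodic simp_thms)
  qed
  ultimately show "e 0 r + e 1 r * sin (t - r) - 16 * \<eta> * (1 - cos (t - r)) \<le> e 0 t"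
    using *[of t'] by simp
  \<comment> \<open>35 = 1 + 1 + 32 + 1, from \<open>e 0 r\<close>, the sine term, the cosine term
    and \<open>e 0 t\<close>.\<close>
  have "\<bar>e 1 r * sin (t - r)\<bar> \<le> \<eta> * 1"
    unfolding abs_mult using b[of 1 r] \<eta> by (intro mult_mono) auto
  moreover have "16 * \<eta> * (1 - cos (t - r)) \<le> 16 * \<eta> * 2"
    using \<eta> cos_ge_minus_one[of "t - r"] by (intro mult_left_mono) auto
  moreover have "\<bar>e 0 t\<bar> \<le> \<eta>" "\<bar>e 0 r\<bar> \<le> \<eta>" using b by auto
  ultimately show "e 0 t - 35 * \<eta> \<le> e 0 r + e 1 r * sin (t - r) - 16 * \<eta> * (1 - cos (t - r))"
    by linarith
qed

context remez_weight
begin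

text \<open>Measure at most 1/2 leaves room for removing a sublevel set of \<open>f\<close> as
  well.\<close>

definition remez_small_sets :: "(real \<Rightarrow> real) \<Rightarrow> real \<Rightarrow> nat \<Rightarrow> bool" where
  "remez_small_sets f K n \<longleftrightarrow> (\<forall>T E. trig_poly n T \<longrightarrow> E \<in> sets lebesgue \<longrightarrow> E \<subseteq> circle \<longrightarrow>
     vol E \<le> 1 / 2 \<longrightarrow>
     I circle (\<lambda>t. norm (T t) * f t) \<le> exp (K * (real n * vol E)) * I (circle - E) (\<lambda>t. norm (T t) * f t))"

section \<open>Removing sets of measure at least one half\<close>

lemma remez_large_sets_weighted:
  assumes f: "fast_approximable f \<mu> L"
  shows "\<exists>K>0. \<forall>n\<ge>1. \<forall>T E. trig_poly n T \<longrightarrow> E \<in> sets lebesgue \<longrightarrow> E \<subseteq> circle \<longrightarrow>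
     1 / 2 \<le> vol E \<longrightarrow> vol E \<le> 1 \<longrightarrow>
     I circle (\<lambda>t. norm (T t) * f t) \<le> exp (K * (real n * vol E)) * I (circle - E) (\<lambda>t. norm (T t) * f t)"
proof -
  obtain \<epsilon> C' where \<epsilon>: "\<epsilon> > 0" and C': "C' > 0"
    and main: "\<And>n T E Z. n \<ge> 1 \<Longrightarrow> trig_poly n T \<Longrightarrow> E \<in> sets lebesgue \<Longrightarrow> E \<subseteq> circle \<Longrightarrow>
     1 / 2 \<le> vol E \<Longrightarrow> vol E \<le> 1 \<Longrightarrow>
     Z \<in> sets lebesgue \<Longrightarrow> Z \<subseteq> circle \<Longrightarrow> vol Z \<le> \<epsilon> \<Longrightarrow>
     I circle (\<lambda>t. norm (T t)) \<le> exp (C' * real n) * I (circle - (E \<union> Z)) (\<lambda>t. norm (T t))"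
    using remez_large_set by metis
  have cont: "continuous_on UNIV f" and f01: "\<And>t. 0 \<le> f t" "\<And>t. f t \<le> 1" and L: "L > 0"
    using fast_approximableD[OF f] by blast+
  have "\<forall>\<^sub>F n in sequentially. vol {t \<in> circle. f t < exp (- \<mu> n)} \<le> \<epsilon> \<and> 1 \<le> \<mu> n"
    using fast_approximable_eventually[OF f \<epsilon>] by eventually_elim auto
  then obtain n0 where n0: "vol {t \<in> circle. f t < exp (- \<mu> n0)} \<le> \<epsilon>" "1 \<le> \<mu> n0"
    by (auto simp: eventually_sequentially)
  \<comment> \<open>One level, fixed independently of the degree, makes the sublevel set small
    enough to be removed; outside it the passage from 1 to \<open>f\<close> costs the constant
    \<open>exp (a * h)\<close>.\<close>
  define h where "h = \<mu> n0"
  define Z where "Z = {t \<in> circle. f t < exp (- h)}"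
  have Z: "Z \<in> sets lebesgue" "Z \<subseteq> circle" "vol Z \<le> \<epsilon>"
    using n0 sublevel_sets[OF cont] by (auto simp: Z_def h_def)
  \<comment> \<open>A constant loss is affordable because \<open>n * vol E \<ge> 1 / 2\<close>,
    which also accounts for the factor 2.\<close>
  define K where "K = 2 * (C' + a * h)"
  have ah: "a * h > 0" using a_pos n0 by (simp add: h_def)
  have "I circle (\<lambda>t. norm (T t) * f t) \<le> exp (K * (real n * vol E)) * I (circle - E) (\<lambda>t. norm (T t) * f t)"
    if n: "n \<ge> 1" and T: "trig_poly n T" and E: "E \<in> sets lebesgue" "E \<subseteq> circle"
      "1 / 2 \<le> vol E" "vol E \<le> 1" for n T E
  proof -
    have adm: "admissible (\<lambda>t. norm (T t))" by (rule admissible_trig_poly[OF T])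
    have "admissible f" using cont f01 by (simp add: admissible_def)
    then have admf: "admissible (\<lambda>t. norm (T t) * f t)" by (rule admissible_mult[OF adm])
    have "I circle (\<lambda>t. norm (T t) * f t) \<le> 1 powr a * I circle (\<lambda>t. norm (T t))"
      by (rule I_mono[OF admf adm]) (use f01 in \<open>auto simp: mult_left_le\<close>)
    also have "\<dots> \<le> exp (C' * real n) * I (circle - (E \<union> Z)) (\<lambda>t. norm (T t))"
      using main[OF n T E Z] by simp
    also have "I (circle - (E \<union> Z)) (\<lambda>t. norm (T t)) \<le> exp h powr a * I (circle - E) (\<lambda>t. norm (T t) * f t)"
    proof (rule I_mono[OF adm admf])
      fix t assume "t \<in> circle - (E \<union> Z)"
      then have "1 \<le> exp h * f t" by (auto simp: Z_def not_less exp_minus field_simps)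
      from mult_left_mono[OF this, of "norm (T t)"]
      show "norm (T t) \<le> exp h * (norm (T t) * f t)" by (simp add: mult_ac)
    qed (use E Z in auto)
    finally have "I circle (\<lambda>t. norm (T t) * f t) \<le> exp (C' * real n) * (exp h powr a * I (circle - E) (\<lambda>t. norm (T t) * f t))"
      by simp
    also have "\<dots> = exp (C' * real n + a * h) * I (circle - E) (\<lambda>t. norm (T t) * f t)"
      by (simp add: powr_def exp_add mult_ac)
    also have "\<dots> \<le> exp (K * (real n * vol E)) * I (circle - E) (\<lambda>t. norm (T t) * f t)"
    proof (intro mult_right_mono I_nonneg)
      have "a * h * 1 \<le> a * h * real n" using ah n by (intro mult_left_mono) auto
      then have "C' * real n + a * h \<le> K * (real n * (1 / 2))" by (simp add: K_def algebra_simps)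
      also have "\<dots> \<le> K * (real n * vol E)"
        using E ah C' by (intro mult_left_mono) (auto simp: K_def)
      finally show "exp (C' * real n + a * h) \<le> exp (K * (real n * vol E))" by simp
    qed
    finally show ?thesis .
  qed
  then show ?thesis using ah C' by (intro exI[of _ K]) (auto simp: K_def)
qed

text \<open>\<open>m\<close> stands for \<open>\<mu> n\<close>. Returning from \<open>q\<close> to
  \<open>f\<close> loses \<open>exp (D * m)\<close>; this is acceptable for functions dominated by
  \<open>exp (- D * m) * q\<close> up to a suitable root, and the lower bound on \<open>q\<close>
  makes every sufficiently small function one of these.\<close>

definition coarse_substitute :: "(real \<Rightarrow> real) \<Rightarrow> real \<Rightarrow> nat \<Rightarrow> real \<Rightarrow> (real \<Rightarrow> real) \<Rightarrow> bool" where
  "coarse_substitute f D n m q \<longleftrightarrow> continuous_on UNIV q \<and> (\<forall>t. exp (- m) \<le> 2 * q t) \<and>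
     (\<forall>T E. trig_poly n T \<longrightarrow> E \<in> sets lebesgue \<longrightarrow> E \<subseteq> circle \<longrightarrow> vol E \<le> 1 / 2 \<longrightarrow>
       I circle (\<lambda>t. norm (T t) * q t) \<le> exp (D * (real n * vol E)) * I (circle - E) (\<lambda>t. norm (T t) * q t) \<and>
       I (circle - E) (\<lambda>t. norm (T t) * q t) \<le>
         exp (D * (real n * vol E) + D * m) * I (circle - E) (\<lambda>t. norm (T t) * f t))"

text \<open>The function \<open>q\<close> is a polynomial substitute for \<open>f + exp (- \<mu> n)\<close>, whose degree is independent
  of the depth \<open>M\<close> to which \<open>f\<close> has to be followed later on.\<close>

lemma coarse_comparison:
  assumes f: "fast_approximable f \<mu> L"
  shows "\<exists>D>0. \<forall>\<^sub>F n in sequentially. \<exists>q. coarse_substitute f D n (\<mu> n) q"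
proof -
  have cont: "continuous_on UNIV f" and f01: "\<And>t. 0 \<le> f t" "\<And>t. f t \<le> 1" and L: "L > 0"
    using fast_approximableD[OF f] by blast+
  obtain c where c: "\<forall>\<^sub>F n in sequentially. \<exists>e. approximation_error f (c * n) (exp (- 2 * \<mu> n)) e"
    using fast_approximableD(8)[OF f, of 2, OF zero_less_numeral] by blast
  define C1 where "C1 = C * (1 + real c)"
  have C1: "C1 > 0" using C_pos by (simp add: C1_def add_pos_nonneg)
  \<comment> \<open>\<open>C1\<close> serves the term \<open>n * vol E\<close>,
    \<open>C1 * L\<close> the removal of the sublevel set, and \<open>2 * a\<close> the bound
    \<open>q \<le> exp 2 * f\<close> outside it.\<close>
  define D where "D = C1 + C1 * L + 2 * a"
  have D: "D \<ge> C1" "D > 0" "D \<ge> C1 * L + 2 * a" using C1 L a_pos by (auto simp: D_def add_pos_pos)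
  have ev: "\<forall>\<^sub>F n in sequentially. L * \<mu> n / real n < 1 / 2 \<and> 1 \<le> \<mu> n \<and> n \<ge> 1 \<and>
    vol {t \<in> circle. f t < exp (- \<mu> n)} \<le> L * \<mu> n / real n"
    by (rule fast_approximable_eventually[OF f]) simp
  have "\<forall>\<^sub>F n in sequentially. \<exists>q. coarse_substitute f D n (\<mu> n) q"
    using c ev
  proof eventually_elim
    case (elim n)
    then obtain e where e: "smooth_periodic e" "trig_poly (c * n) (\<lambda>t. complex_of_real (f t - e 0 t))"
      "\<And>i t. i \<le> 2 \<Longrightarrow> \<bar>e i t\<bar> \<le> exp (- 2 * \<mu> n)"
      unfolding approximation_error_def by blast
    have \<mu>: "1 \<le> \<mu> n" and n: "n \<ge> 1" using elim by auto
    define \<eta> where "\<eta> = exp (- \<mu> n)"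
    have \<eta>: "\<eta> > 0" by (simp add: \<eta>_def)
    have e_small: "\<bar>e 0 t\<bar> \<le> \<eta> / 2" for t
    proof -
      have "2 \<le> exp (\<mu> n)" using exp_ge_add_one_self[of "\<mu> n"] \<mu> by linarith
      then have "exp (- \<mu> n) \<le> 1 / 2" by (simp add: exp_minus field_simps)
      then have "exp (- \<mu> n) * exp (- \<mu> n) \<le> \<eta> * (1 / 2)" unfolding \<eta>_def by (intro mult_left_mono) auto
      then show ?thesis using e(3)[of 0 t] by (simp flip: exp_add)
    qed
    \<comment> \<open>The added \<open>\<eta>\<close> lifts the approximant above \<open>f\<close>
      and above \<open>\<eta> / 2\<close> without raising its degree.\<close>
    define q where "q t = f t - e 0 t + \<eta>" for t
    have q_low: "\<eta> \<le> 2 * q t" "f t \<le> q t" "q t \<le> f t + 3 / 2 * \<eta>" for t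
      using e_small[of t] f01(1)[of t] \<eta> by (auto simp: q_def abs_le_iff)
    have q0: "0 \<le> q t" for t using q_low(1)[of t] \<eta> by linarith
    have qc: "continuous_on UNIV q"
      unfolding q_def using cont smooth_periodic_continuous[OF e(1)] by (intro continuous_intros)
    have qt: "trig_poly (c * n) (\<lambda>t. complex_of_real (q t))"
      using trig_poly_add[OF e(2) trig_poly_const[of "c * n" "complex_of_real \<eta>"]] by (simp add: q_def)
    define Z where "Z = {t \<in> circle. f t < \<eta>}"
    have Z: "Z \<in> sets lebesgue" "Z \<subseteq> circle"
      using sublevel_sets[OF cont, of \<eta>] by (auto simp: Z_def)
    have "vol Z \<le> L * \<mu> n / real n \<and> L * \<mu> n / real n < 1 / 2"
      using elim(2) unfolding Z_def \<eta>_def by blast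
    then have Zm: "vol Z \<le> L * \<mu> n / real n" "vol Z \<le> 1 / 2" by linarith+
    have "I circle (\<lambda>t. norm (T t) * q t) \<le> exp (D * (real n * vol E)) * I (circle - E) (\<lambda>t. norm (T t) * q t) \<and>
       I (circle - E) (\<lambda>t. norm (T t) * q t) \<le>
         exp (D * (real n * vol E) + D * \<mu> n) * I (circle - E) (\<lambda>t. norm (T t) * f t)"
      if T: "trig_poly n T" and E: "E \<in> sets lebesgue" "E \<subseteq> circle" and Em: "vol E \<le> 1 / 2" for T E
    proof
      have TQ: "trig_poly (n + c * n) (\<lambda>t. T t * complex_of_real (q t))" by (rule trig_poly_mult[OF T qt])
      have nq: "norm (T t * complex_of_real (q t)) = norm (T t) * q t" for t
        using q0[of t] by (simp add: norm_mult)
      have adm: "admissible (\<lambda>t. norm (T t) * q t)"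
        using admissible_trig_poly[OF TQ] unfolding nq .
      have admf: "admissible (\<lambda>t. norm (T t) * f t)"
        by (rule admissible_mult[OF admissible_trig_poly[OF T]]) (use cont f01 in \<open>simp add: admissible_def\<close>)
      have Cn: "C * real (n + c * n) = C1 * real n" by (simp add: C1_def algebra_simps)
      have remez': "I circle (\<lambda>t. norm (T t) * q t) \<le> exp (C1 * real n * vol S) * I (circle - S) (\<lambda>t. norm (T t) * q t)"
        if "S \<in> sets lebesgue" "S \<subseteq> circle" "vol S \<le> 1" for S
        using remez[OF _ TQ that] n unfolding nq Cn by simp
      have "C1 * (real n * vol E) \<le> D * (real n * vol E)"
        using D by (intro mult_right_mono) auto
      then have "exp (C1 * real n * vol E) \<le> exp (D * (real n * vol E))" by (simp add: mult.assoc)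
      from order_trans[OF remez'[OF E] mult_right_mono[OF this I_nonneg]]
      show "I circle (\<lambda>t. norm (T t) * q t) \<le> exp (D * (real n * vol E)) * I (circle - E) (\<lambda>t. norm (T t) * q t)"
        using Em by simp
      have EZ: "vol (E \<union> Z) \<le> vol E + vol Z"
        using E Z by (intro measure_Un_le)
      have "I (circle - E) (\<lambda>t. norm (T t) * q t) \<le> I circle (\<lambda>t. norm (T t) * q t)"
        using E by (intro I_subset adm) auto
      also have "\<dots> \<le> exp (C1 * real n * vol (E \<union> Z)) * I (circle - (E \<union> Z)) (\<lambda>t. norm (T t) * q t)"
        using E Z EZ Em Zm by (intro remez') auto
      also have "\<dots> \<le> exp (C1 * (real n * vol E) + C1 * L * \<mu> n) * (exp 2 powr a * I (circle - E) (\<lambda>t. norm (T t) * f t))"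
      proof (intro mult_mono I_nonneg)
        have "real n * vol (E \<union> Z) \<le> real n * (vol E + L * \<mu> n / real n)"
          using EZ Zm by (intro mult_left_mono) auto
        also have "\<dots> = real n * vol E + L * \<mu> n" using n by (simp add: field_simps)
        finally have "C1 * (real n * vol (E \<union> Z)) \<le> C1 * (real n * vol E + L * \<mu> n)"
          using C1 by (intro mult_left_mono) auto
        then show "exp (C1 * real n * vol (E \<union> Z)) \<le> exp (C1 * (real n * vol E) + C1 * L * \<mu> n)"
          by (simp add: algebra_simps)
        show "I (circle - (E \<union> Z)) (\<lambda>t. norm (T t) * q t) \<le> exp 2 powr a * I (circle - E) (\<lambda>t. norm (T t) * f t)"
        proof (rule I_mono[OF adm admf])
          fix t assume "t \<in> circle - (E \<union> Z)"
          then have "\<eta> \<le> f t" by (auto simp: Z_def)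
          then have "q t \<le> 3 * f t" using q_low(3)[of t] f01(1)[of t] by linarith
          also have "\<dots> \<le> exp 2 * f t" using exp_ge_add_one_self[of 2] f01 by (intro mult_right_mono) auto
          finally have "norm (T t) * q t \<le> norm (T t) * (exp 2 * f t)" by (intro mult_left_mono) auto
          then show "norm (T t) * q t \<le> exp 2 * (norm (T t) * f t)" by (simp add: mult_ac)
        qed (use E Z in auto)
      qed auto
      also have "\<dots> = exp (C1 * (real n * vol E) + (C1 * L * \<mu> n + 2 * a)) * I (circle - E) (\<lambda>t. norm (T t) * f t)"
        by (simp add: powr_def exp_add mult_ac)
      also have "\<dots> \<le> exp (D * (real n * vol E) + D * \<mu> n) * I (circle - E) (\<lambda>t. norm (T t) * f t)"
      proof (intro mult_right_mono I_nonneg)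
        have "2 * a * 1 \<le> 2 * a * \<mu> n" using a_pos \<mu> by (intro mult_left_mono) auto
        then have "C1 * L * \<mu> n + 2 * a \<le> (C1 * L + 2 * a) * \<mu> n" by (simp add: algebra_simps)
        also have "\<dots> \<le> D * \<mu> n" using D \<mu> by (intro mult_right_mono) auto
        finally show "exp (C1 * (real n * vol E) + (C1 * L * \<mu> n + 2 * a)) \<le> exp (D * (real n * vol E) + D * \<mu> n)"
          using \<open>C1 * (real n * vol E) \<le> D * (real n * vol E)\<close> by simp
      qed
      finally show "I (circle - E) (\<lambda>t. norm (T t) * q t) \<le>
         exp (D * (real n * vol E) + D * \<mu> n) * I (circle - E) (\<lambda>t. norm (T t) * f t)" .
    qed
    then show ?case using qc q_low(1) unfolding \<eta>_def coarse_substitute_def by blast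
  qed
  then show ?thesis using D by blast
qed

text \<open>Off the sublevel set \<open>Z\<close> the fine approximant \<open>q2\<close> is within a
  factor 2 of \<open>f\<close>; on \<open>Z\<close> both are dominated by \<open>h * q\<close>.
  Additivity bounds the energies of \<open>q2\<close> and \<open>q\<close> over \<open>E\<close>
  with factors \<open>exp (D2 * x) - 1\<close> and \<open>exp (D * x) - 1\<close>, and
  \<open>h powr a\<close> cancels the loss of returning from \<open>q\<close> to
  \<open>f\<close>.\<close>

lemma remez_small_sets_finite_exponent:
  assumes f: "fast_approximable f \<mu> L" and p: "p \<noteq> \<infinity>"
  shows "\<exists>K>0. \<forall>\<^sub>F n in sequentially. remez_small_sets f K n"
proof -
  have cont: "continuous_on UNIV f" and f01: "\<And>t. 0 \<le> f t" "\<And>t. f t \<le> 1" and L: "L > 0"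
    using fast_approximableD[OF f] by blast+
  obtain D where D: "D > 0" and coarse: "\<forall>\<^sub>F n in sequentially. \<exists>q. coarse_substitute f D n (\<mu> n) q"
    using coarse_comparison[OF f] by blast
  \<comment> \<open>\<open>D / a\<close> makes \<open>h powr a * exp (D * \<mu> n) = 1\<close>. Of
    the remaining 3, one unit is spent on the lower bound of \<open>q\<close> and two on the
    numerical factor 4 in \<open>hq\<close>.\<close>
  define M where "M = 3 + D / a"
  have M: "M \<ge> 3" using D a_pos by (simp add: M_def)
  then have "2 * M > 0" by simp
  from fast_approximableD(8)[OF f this] obtain c where c: "\<forall>\<^sub>F n in sequentially. \<exists>e. approximation_error f (c * n) (exp (- (2 * M) * \<mu> n)) e" by blast
  define D2 where "D2 = C * (1 + real c)"
  have D2: "D2 > 0" using C_pos by (simp add: D2_def add_pos_nonneg)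
  \<comment> \<open>\<open>2 powr a * (2 powr a + 1)\<close> arises from \<open>E - Z\<close> when
    the energy over \<open>E\<close> is estimated, and 1 from \<open>E \<inter> Z\<close>, both as
    multiples of \<open>y - 1\<close>; the leading term in \<open>1 + k * (y - 1)\<close> is the
    part off \<open>E\<close>.\<close>
  define k where "k = 1 + 2 powr a * (2 powr a + 1)"
  have k: "k \<ge> 1" by (simp add: k_def)
  define K where "K = 2 * (D + D2) * real (nat \<lceil>k\<rceil>)"
  have K: "K > 0"
  proof -
    have "real (nat \<lceil>k\<rceil>) \<ge> 1" using k by linarith
    then show ?thesis unfolding K_def using D D2 k by (intro mult_pos_pos) auto
  qed
  have ev: "\<forall>\<^sub>F n in sequentially. L * \<mu> n / real n < 1 / 2 \<and> 1 \<le> \<mu> n \<and> n \<ge> 1 \<and>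
    vol {t \<in> circle. f t < exp (- \<mu> n)} \<le> L * \<mu> n / real n"
    by (rule fast_approximable_eventually[OF f]) simp
  have "\<forall>\<^sub>F n in sequentially. remez_small_sets f K n"
    using coarse c ev
  proof eventually_elim
    case (elim n)
    have \<mu>: "1 \<le> \<mu> n" and n: "n \<ge> 1" using elim by auto
    from elim(1) obtain q where q: "continuous_on UNIV q" "\<And>t. exp (- \<mu> n) \<le> 2 * q t"
      and qI: "\<And>T E. trig_poly n T \<Longrightarrow> E \<in> sets lebesgue \<Longrightarrow> E \<subseteq> circle \<Longrightarrow> vol E \<le> 1 / 2 \<Longrightarrow>
         I circle (\<lambda>t. norm (T t) * q t) \<le> exp (D * (real n * vol E)) * I (circle - E) (\<lambda>t. norm (T t) * q t)"
      and qf: "\<And>T E. trig_poly n T \<Longrightarrow> E \<in> sets lebesgue \<Longrightarrow> E \<subseteq> circle \<Longrightarrow> vol E \<le> 1 / 2 \<Longrightarrow>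
         I (circle - E) (\<lambda>t. norm (T t) * q t) \<le>
         exp (D * (real n * vol E) + D * \<mu> n) * I (circle - E) (\<lambda>t. norm (T t) * f t)"
      unfolding coarse_substitute_def by blast
    have q0: "0 \<le> q t" for t using q(2)[of t] exp_gt_zero[of "- \<mu> n"] by linarith
    from elim(2) obtain e where e: "smooth_periodic e" "trig_poly (c * n) (\<lambda>t. complex_of_real (f t - e 0 t))"
      "\<And>i t. i \<le> 2 \<Longrightarrow> \<bar>e i t\<bar> \<le> exp (- (2 * M) * \<mu> n)"
      unfolding approximation_error_def by blast
    define \<eta> where "\<eta> = exp (- M * \<mu> n)"
    have \<eta>: "\<eta> > 0" by (simp add: \<eta>_def)
    have e_small: "\<bar>e 0 t\<bar> \<le> \<eta> / 2" for t
    proof -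
      have "1 * 1 \<le> M * \<mu> n" using M \<mu> by (intro mult_mono) auto
      then have "2 \<le> exp (M * \<mu> n)" using exp_ge_add_one_self[of "M * \<mu> n"] by linarith
      then have "\<eta> \<le> 1 / 2" by (simp add: \<eta>_def exp_minus field_simps)
      then have "\<eta> * \<eta> \<le> \<eta> * (1 / 2)" using \<eta> by (intro mult_left_mono) auto
      moreover have "\<eta> * \<eta> = exp (- (2 * M) * \<mu> n)" by (simp add: \<eta>_def flip: exp_add)
      ultimately show ?thesis using e(3)[of 0 t] by simp
    qed
    \<comment> \<open>The absolute value is taken because the approximant may be negative where
      \<open>f\<close> is tiny.\<close>
    define q2 where "q2 t = \<bar>f t - e 0 t\<bar>" for t
    define Z where "Z = {t \<in> circle. f t < \<eta>}"
    have Z: "Z \<in> sets lebesgue" "Z \<subseteq> circle" using sublevel_sets[OF cont] by (auto simp: Z_def)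
    define h where "h = exp (- (D / a) * \<mu> n)"
    have h: "h powr a * exp (D * \<mu> n) = 1"
      using a_pos by (simp add: h_def powr_def flip: exp_add)
    have h0: "h \<ge> 0" by (simp add: h_def)
    have hq: "2 * \<eta> \<le> h * q t" for t
    proof -
      have "2 \<le> exp (1::real)" using exp_ge_add_one_self[of "1::real"] by simp
      then have "2 * 2 \<le> exp 1 * exp (1::real)" by (intro mult_mono) auto
      also have "\<dots> \<le> exp (\<mu> n) * exp (\<mu> n)" using \<mu> by (intro mult_mono) auto
      finally have "4 * \<eta> \<le> exp (\<mu> n) * exp (\<mu> n) * \<eta>" using \<eta> by (intro mult_right_mono) auto
      also have "\<dots> = h * exp (- \<mu> n)" by (simp add: \<eta>_def h_def M_def algebra_simps flip: exp_add)
      also have "\<dots> \<le> h * (2 * q t)" using q(2) h0 by (intro mult_left_mono)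
      finally show ?thesis by simp
    qed
    have q2f: "f t \<le> 2 * q2 t \<and> q2 t \<le> 2 * f t" if "\<not> f t < \<eta>" for t
    proof -
      have "e 0 t \<le> f t / 2" "- (f t / 2) \<le> e 0 t" using that e_small[of t] by (simp_all only: abs_le_iff) linarith+
      then show ?thesis using f01(1)[of t] by (simp add: q2_def abs_of_nonneg)
    qed
    have q2Z: "q2 t \<le> h * q t \<and> f t \<le> h * q t" if "f t < \<eta>" for t
    proof -
      have "\<bar>f t - e 0 t\<bar> \<le> f t + \<eta> / 2" using abs_triangle_ineq4[of "f t" "e 0 t"] e_small[of t] f01(1)[of t] by linarith
      then show ?thesis using that hq[of t] \<eta> unfolding q2_def by linarith
    qed
    show ?case unfolding remez_small_sets_def
    proof (intro allI impI)
      fix T E assume T: "trig_poly n T" and E: "E \<in> sets lebesgue" "E \<subseteq> circle" and Em: "vol E \<le> 1 / 2"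
      define x where "x = real n * vol E"
      have x: "x \<ge> 0" by (simp add: x_def)
      have E1: "vol E \<le> 1" using Em by simp
      define \<phi> where "\<phi> = (\<lambda>t. norm (T t) * f t)"
      define \<psi> where "\<psi> = (\<lambda>t. norm (T t) * q t)"
      define \<xi> where "\<xi> = (\<lambda>t. norm (T t) * q2 t)"
      have adm: "admissible \<phi>" "admissible \<psi>" "admissible \<xi>"
        unfolding \<phi>_def \<psi>_def \<xi>_def q2_def
        by (intro admissible_mult[OF admissible_trig_poly[OF T]];
            use cont f01 q(1) q0 smooth_periodic_continuous[OF e(1)] in \<open>auto simp: admissible_def intro!: continuous_intros\<close>)+
      have TQ: "trig_poly (n + c * n) (\<lambda>t. T t * complex_of_real (f t - e 0 t))" by (rule trig_poly_mult[OF T e(2)])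
      have nq: "norm (T t * complex_of_real (f t - e 0 t)) = \<xi> t" for t
        by (simp only: norm_mult norm_of_real \<xi>_def q2_def)
      have split: "I circle \<theta> = I (circle - E) \<theta> + I E \<theta>" if "admissible \<theta>" for \<theta>
      proof -
        have 1: "circle - E \<in> sets lebesgue" by (rule sets.Diff[OF circle_lmeasurable(2) E(1)])
        have 2: "(circle - E) \<union> E = circle" "(circle - E) \<inter> E = {}" using E(2) by blast+
        show ?thesis using I_disjoint_Un[OF that 1 E(1) Diff_subset E(2) 2(2) p] unfolding 2(1) .
      qed
      define X where "X = I (circle - E) \<phi>"
      define Y where "Y = I (circle - E) \<psi>"
      define W where "W = I (circle - E) \<xi>"
      have nn: "X \<ge> 0" "Y \<ge> 0" "W \<ge> 0" by (simp_all add: X_def Y_def W_def I_nonneg)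
      have Cn: "C * real (n + c * n) * vol E = D2 * x" by (simp add: D2_def x_def algebra_simps)
      have "I circle \<xi> \<le> exp (D2 * x) * W"
        using remez[OF _ TQ E E1] n unfolding nq Cn W_def by simp
      then have IE\<xi>: "I E \<xi> \<le> (exp (D2 * x) - 1) * W"
        using split[OF adm(3)] by (simp add: W_def algebra_simps)
      have "I circle \<psi> \<le> exp (D * x) * Y" using qI[OF T E Em] by (simp add: \<psi>_def Y_def x_def)
      then have IE\<psi>: "I E \<psi> \<le> (exp (D * x) - 1) * Y"
        using split[OF adm(2)] by (simp add: Y_def algebra_simps)
      have hY: "h powr a * Y \<le> exp (D * x) * X"
      proof -
        have "h powr a * Y \<le> h powr a * (exp (D * x + D * \<mu> n) * X)"
          using qf[OF T E Em] by (intro mult_left_mono) (auto simp: Y_def X_def \<phi>_def \<psi>_def x_def)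
        also have "\<dots> = (h powr a * exp (D * \<mu> n)) * (exp (D * x) * X)" by (simp add: exp_add mult_ac)
        finally show ?thesis using h by simp
      qed
      have E_Z: "E \<inter> Z \<in> sets lebesgue" "E - Z \<in> sets lebesgue" "(circle - E) \<inter> Z \<in> sets lebesgue"
        "(circle - E) - Z \<in> sets lebesgue" "circle - E \<in> sets lebesgue"
        by (intro sets.Int sets.Diff circle_lmeasurable(2) E(1) Z(1))+
      have 1: "I (E \<inter> Z) \<phi> \<le> h powr a * I E \<psi>"
      proof (rule I_mono[OF adm(1,2)])
        fix t assume "t \<in> E \<inter> Z"
        then have "norm (T t) * f t \<le> norm (T t) * (h * q t)" using q2Z[of t] by (intro mult_left_mono) (auto simp: Z_def)
        then show "\<phi> t \<le> h * \<psi> t" by (simp add: \<phi>_def \<psi>_def mult_ac)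
      qed (use E E_Z h0 in auto)
      have 2: "I (E - Z) \<phi> \<le> 2 powr a * I E \<xi>"
      proof (rule I_mono[OF adm(1,3)])
        fix t assume "t \<in> E - Z"
        then have "norm (T t) * f t \<le> norm (T t) * (2 * q2 t)"
          using q2f[of t] E by (intro mult_left_mono) (auto simp: Z_def)
        then show "\<phi> t \<le> 2 * \<xi> t" by (simp add: \<phi>_def \<xi>_def mult_ac)
      qed (use E E_Z in auto)
      have 3: "I ((circle - E) - Z) \<xi> \<le> 2 powr a * X"
        unfolding X_def
      proof (rule I_mono[OF adm(3,1)])
        fix t assume "t \<in> (circle - E) - Z"
        then have "norm (T t) * q2 t \<le> norm (T t) * (2 * f t)"
          using q2f[of t] by (intro mult_left_mono) (auto simp: Z_def)
        then show "\<xi> t \<le> 2 * \<phi> t" by (simp add: \<phi>_def \<xi>_def mult_ac)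
      qed (use E_Z in auto)
      have 4: "I ((circle - E) \<inter> Z) \<xi> \<le> h powr a * Y"
        unfolding Y_def
      proof (rule I_mono[OF adm(3,2)])
        fix t assume "t \<in> (circle - E) \<inter> Z"
        then have "norm (T t) * q2 t \<le> norm (T t) * (h * q t)" using q2Z[of t] by (intro mult_left_mono) (auto simp: Z_def)
        then show "\<xi> t \<le> h * \<psi> t" by (simp add: \<xi>_def \<psi>_def mult_ac)
      qed (use E_Z h0 in auto)
      have eD: "exp (D * x) \<ge> 1" "exp (D2 * x) \<ge> 1" using D D2 x by auto
      \<comment> \<open>The complement of \<open>E\<close> also meets \<open>Z\<close>, where
        \<open>q2\<close> need not be comparable to \<open>f\<close>; there it is again controlled
        by \<open>h * q\<close>.\<close>
      have "W = I (((circle - E) - Z) \<union> ((circle - E) \<inter> Z)) \<xi>" unfolding W_def by (simp add: Un_Diff_Int)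
      also have "\<dots> \<le> I ((circle - E) - Z) \<xi> + I ((circle - E) \<inter> Z) \<xi>"
        by (rule I_Un[OF adm(3)]) (use E_Z in auto)
      also have "\<dots> \<le> 2 powr a * X + exp (D * x) * X" using 3 4 hY by linarith
      also have "\<dots> \<le> (2 powr a + 1) * (exp (D * x) * X)"
        using mult_right_mono[OF eD(1) nn(1)] mult_left_mono[of X "exp (D * x) * X" "2 powr a"] by (simp add: distrib_right)
      finally have W: "W \<le> (2 powr a + 1) * (exp (D * x) * X)" .
      define y where "y = exp (2 * (D + D2) * x)"
      have y: "y \<ge> 1" using D D2 x by (simp add: y_def)
      \<comment> \<open>The product is \<open>exp ((s + D) * x) - exp (D * x)\<close>, and the
        subtracted term is at least 1.\<close>
      have prod_le: "(exp (s * x) - 1) * exp (D * x) \<le> y - 1" if "s = D \<or> s = D2" for s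
      proof -
        have "(s + D) * x \<le> 2 * (D + D2) * x" using that D D2 x by (intro mult_right_mono) auto
        then have "exp (s * x) * exp (D * x) \<le> y" by (simp add: y_def distrib_right flip: exp_add)
        then show ?thesis unfolding left_diff_distrib using eD(1) by linarith
      qed
      have "I E \<phi> = I ((E - Z) \<union> (E \<inter> Z)) \<phi>" by (simp add: Un_Diff_Int)
      also have "\<dots> \<le> I (E - Z) \<phi> + I (E \<inter> Z) \<phi>"
        by (rule I_Un[OF adm(1)]) (use E E_Z in auto)
      also have "I (E \<inter> Z) \<phi> \<le> (y - 1) * X"
      proof -
        have "h powr a * I E \<psi> \<le> h powr a * ((exp (D * x) - 1) * Y)" using IE\<psi> by (intro mult_left_mono) auto
        also have "\<dots> = (exp (D * x) - 1) * (h powr a * Y)" by simp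
        also have "\<dots> \<le> (exp (D * x) - 1) * (exp (D * x) * X)" using hY eD by (intro mult_left_mono) auto
        also have "\<dots> = ((exp (D * x) - 1) * exp (D * x)) * X" by simp
        also have "\<dots> \<le> (y - 1) * X" using nn(1) by (intro mult_right_mono prod_le) auto
        finally show ?thesis using 1 by linarith
      qed
      also have "I (E - Z) \<phi> \<le> 2 powr a * (2 powr a + 1) * ((y - 1) * X)"
      proof -
        have "I E \<xi> \<le> (exp (D2 * x) - 1) * ((2 powr a + 1) * (exp (D * x) * X))"
          using IE\<xi> W eD by (smt (verit) mult_left_mono)
        also have "\<dots> = (2 powr a + 1) * (((exp (D2 * x) - 1) * exp (D * x)) * X)" by simp
        also have "\<dots> \<le> (2 powr a + 1) * ((y - 1) * X)"
          using nn(1) by (intro mult_left_mono mult_right_mono prod_le) auto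
        finally have "2 powr a * I E \<xi> \<le> 2 powr a * ((2 powr a + 1) * ((y - 1) * X))" by (intro mult_left_mono) auto
        then show ?thesis using 2 unfolding mult.assoc by linarith
      qed
      finally have "I E \<phi> \<le> 2 powr a * (2 powr a + 1) * ((y - 1) * X) + (y - 1) * X" by simp
      then have "I circle \<phi> \<le> (1 + k * (y - 1)) * X"
        using split[OF adm(1)] by (simp add: X_def k_def algebra_simps)
      also have "\<dots> \<le> y ^ nat \<lceil>k\<rceil> * X"
        using y k nn(1) by (intro mult_right_mono one_plus_mult_le_power) auto
      also have "y ^ nat \<lceil>k\<rceil> = exp (K * x)"
        by (simp add: y_def K_def mult_ac flip: exp_of_nat_mult)
      finally show "I circle (\<lambda>t. norm (T t) * f t) \<le> exp (K * (real n * vol E)) * I (circle - E) (\<lambda>t. norm (T t) * f t)"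
        by (simp add: X_def \<phi>_def x_def)
    qed
  qed
  then show ?thesis using K by blast
qed

text \<open>Without additivity the comparison off \<open>E\<close> must lose nothing beyond
  \<open>exp (O(n * vol E))\<close>. Where \<open>f \<ge> \<delta>\<close> it reads
  \<open>0 \<le> Q r \<le> f\<close>; where \<open>f < \<delta>\<close> one has
  \<open>|Q r| \<le> \<delta>\<close>, and this is at most \<open>exp (- D * \<mu> n) * q\<close>,
  which pays for the return from \<open>q\<close> to \<open>f\<close>.\<close>

lemma remez_small_sets_infinite_exponent:
  assumes f: "fast_approximable f \<mu> L" and p: "p = \<infinity>"
  shows "\<exists>K>0. \<forall>\<^sub>F n in sequentially. remez_small_sets f K n"
proof -
  have cont: "continuous_on UNIV f" and f01: "\<And>t. 0 \<le> f t" "\<And>t. f t \<le> 1" and L: "L > 0"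
    using fast_approximableD[OF f] by blast+
  obtain D where D: "D > 0" and coarse: "\<forall>\<^sub>F n in sequentially. \<exists>q. coarse_substitute f D n (\<mu> n) q"
    using coarse_comparison[OF f] by blast
  \<comment> \<open>\<open>exp (6 * \<mu> n) \<ge> 64\<close> covers the 35 of
    \<open>touching_correction\<close>. In the comparison of \<open>\<delta>\<close> with
    \<open>q\<close>, one of the six units is spent on the lower bound of \<open>q\<close>, and the
    other five dominate a factor 2.\<close>
  define M where "M = 6 + D"
  have "2 * M > 0" using D by (simp add: M_def)
  from fast_approximableD(8)[OF f this] obtain c where c: "\<forall>\<^sub>F n in sequentially. \<exists>e. approximation_error f (c * n) (exp (- (2 * M) * \<mu> n)) e" by blast
  \<comment> \<open>Degree \<open>n\<close> of \<open>T\<close>, plus \<open>c * n\<close> of the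
    approximant, plus 1 of the correction, the last estimated by \<open>n\<close>.\<close>
  define D2 where "D2 = C * (2 + real c)"
  have D2: "D2 > 0" using C_pos by (simp add: D2_def add_pos_nonneg)
  have ev: "\<forall>\<^sub>F n in sequentially. L * \<mu> n / real n < 1 / 2 \<and> 1 \<le> \<mu> n \<and> n \<ge> 1 \<and>
    vol {t \<in> circle. f t < exp (- \<mu> n)} \<le> L * \<mu> n / real n"
    by (rule fast_approximable_eventually[OF f]) simp
  have "\<forall>\<^sub>F n in sequentially. remez_small_sets f (D + D2) n"
    using coarse c ev
  proof eventually_elim
    case (elim n)
    have \<mu>: "1 \<le> \<mu> n" and n: "n \<ge> 1" using elim by auto
    from elim(1) obtain q where q: "continuous_on UNIV q" "\<And>t. exp (- \<mu> n) \<le> 2 * q t"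
      and qf: "\<And>T E. trig_poly n T \<Longrightarrow> E \<in> sets lebesgue \<Longrightarrow> E \<subseteq> circle \<Longrightarrow> vol E \<le> 1 / 2 \<Longrightarrow>
         I (circle - E) (\<lambda>t. norm (T t) * q t) \<le>
         exp (D * (real n * vol E) + D * \<mu> n) * I (circle - E) (\<lambda>t. norm (T t) * f t)"
      unfolding coarse_substitute_def by blast
    have q0: "0 \<le> q t" for t using q(2)[of t] exp_gt_zero[of "- \<mu> n"] by linarith
    from elim(2) obtain e where e: "smooth_periodic e" "trig_poly (c * n) (\<lambda>t. complex_of_real (f t - e 0 t))"
      "\<And>i t. i \<le> 2 \<Longrightarrow> \<bar>e i t\<bar> \<le> exp (- (2 * M) * \<mu> n)"
      unfolding approximation_error_def by blast
    define \<eta> where "\<eta> = exp (- (2 * M) * \<mu> n)"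
    define Q where "Q r t = f t - e 0 t + (e 0 r + e 1 r * sin (t - r) - 16 * \<eta> * (1 - cos (t - r)))" for r t
    define \<delta> where "\<delta> = exp (- M * \<mu> n)"
    have \<delta>: "\<delta> > 0" "35 * \<eta> \<le> \<delta>"
    proof -
      have "2 \<le> exp (1::real)" using exp_ge_add_one_self[of 1] by simp
      then have "2 ^ 6 \<le> exp (1::real) ^ 6" by (intro power_mono) auto
      also have "exp (1::real) ^ 6 = exp (6 * 1)" by (simp flip: exp_of_nat_mult)
      also have "\<dots> \<le> exp (M * \<mu> n)" using D \<mu> by (subst exp_le_cancel_iff, intro mult_mono) (auto simp: M_def)
      finally have "35 * \<eta> \<le> exp (M * \<mu> n) * \<eta>" by (intro mult_right_mono) (auto simp: \<eta>_def)
      also have "\<dots> = \<delta>" by (simp add: \<delta>_def \<eta>_def algebra_simps flip: exp_add)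
      finally show "35 * \<eta> \<le> \<delta>" .
    qed (simp add: \<delta>_def)
    have eb: "\<And>i t. i \<le> 2 \<Longrightarrow> \<bar>e i t\<bar> \<le> \<eta>" unfolding \<eta>_def by (rule e(3))
    have Q_le: "Q r t \<le> f t" for r t
      using touching_correction(1)[OF e(1) eb, where r = r and t = t] unfolding Q_def by linarith
    have Q_ge: "f t - \<delta> \<le> Q r t" for r t
      using touching_correction(2)[OF e(1) eb, where r = r and t = t] \<delta>(2) unfolding Q_def by linarith
    have Q_eq: "Q t t = f t" for t by (simp add: Q_def)
    have Qt: "trig_poly ((c + 1) * n) (\<lambda>t. complex_of_real (Q r t))" for r
    proof -
      have 1: "trig_poly (c * n + 1) (\<lambda>t. complex_of_real (f t - e 0 t))" by (rule trig_poly_mono[OF e(2)]) simp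
      have "trig_poly (c * n + 1) (\<lambda>t. complex_of_real (sin (t - r)))" "trig_poly (c * n + 1) (\<lambda>t. complex_of_real (cos (t - r)))"
        by (rule trig_poly_mono[OF trig_poly_sin] trig_poly_mono[OF trig_poly_cos]; simp)+
      from 1 trig_poly_const trig_poly_cmult[OF this(1)] trig_poly_cmult[OF trig_poly_diff[OF trig_poly_const this(2)]]
      have "trig_poly (c * n + 1) (\<lambda>t. complex_of_real (f t - e 0 t) + (complex_of_real (e 0 r) +
          complex_of_real (e 1 r) * complex_of_real (sin (t - r)) - complex_of_real (16 * \<eta>) * (1 - complex_of_real (cos (t - r)))))"
        by (intro trig_poly_add trig_poly_diff)
      then have "trig_poly (c * n + 1) (\<lambda>t. complex_of_real (Q r t))" by (simp add: Q_def)
      then show ?thesis by (rule trig_poly_mono) (use n in simp)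
    qed
    have Qc: "continuous_on UNIV (Q r)" for r
      unfolding Q_def using cont smooth_periodic_continuous[OF e(1)] by (intro continuous_intros)
    define Z where "Z = {t \<in> circle. f t < \<delta>}"
    have \<delta>q: "\<delta> \<le> exp (- D * \<mu> n) * q t" for t
    proof -
      have "2 \<le> exp (\<mu> n)" using exp_ge_add_one_self[of "\<mu> n"] \<mu> by linarith
      then have "2 * \<delta> \<le> exp (\<mu> n) * \<delta>" using \<delta> by (intro mult_right_mono) auto
      also have "\<dots> \<le> exp (5 * \<mu> n) * \<delta>" using \<mu> \<delta> by (intro mult_right_mono) auto
      also have "\<dots> = exp (- D * \<mu> n) * exp (- \<mu> n)" by (simp add: \<delta>_def M_def algebra_simps flip: exp_add)
      also have "\<dots> \<le> exp (- D * \<mu> n) * (2 * q t)" using q(2) by (intro mult_left_mono) auto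
      finally show ?thesis by simp
    qed
    show ?case unfolding remez_small_sets_def
    proof (intro allI impI)
      fix T E assume T: "trig_poly n T" and E: "E \<in> sets lebesgue" "E \<subseteq> circle" and Em: "vol E \<le> 1 / 2"
      define x where "x = real n * vol E"
      have x: "x \<ge> 0" by (simp add: x_def)
      have E1: "vol E \<le> 1" using Em by simp
      have cE: "circle - E \<in> sets lebesgue" "circle - E \<subseteq> circle" using E by auto
      define \<phi> where "\<phi> = (\<lambda>t. norm (T t) * f t)"
      define \<psi> where "\<psi> = (\<lambda>t. norm (T t) * q t)"
      have adm: "admissible \<phi>" "admissible \<psi>" "admissible (\<lambda>t. norm (T t) * \<bar>Q r t\<bar>)" for r
        unfolding \<phi>_def \<psi>_def
        by (intro admissible_mult[OF admissible_trig_poly[OF T]];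
            use cont f01 q(1) q0 Qc in \<open>auto simp: admissible_def intro!: continuous_intros\<close>)+
      define X where "X = I (circle - E) \<phi>"
      define Y where "Y = I (circle - E) \<psi>"
      have nn: "X \<ge> 0" "Y \<ge> 0" by (simp_all add: X_def Y_def I_nonneg)
      have aeX: "AE t in lebesgue. t \<in> circle - E \<longrightarrow> \<phi> t * v t \<le> X"
        using I_le_iff_AE[OF adm(1) cE p nn(1)] by (simp add: X_def)
      have aeY: "AE t in lebesgue. t \<in> circle - E \<longrightarrow> \<psi> t * v t \<le> Y"
        using I_le_iff_AE[OF adm(2) cE p nn(2)] by (simp add: Y_def)
      have YX: "exp (- D * \<mu> n) * Y \<le> exp (D * x) * X"
      proof -
        have "exp (- D * \<mu> n) * Y \<le> exp (- D * \<mu> n) * (exp (D * x + D * \<mu> n) * X)"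
          using qf[OF T E Em] by (intro mult_left_mono) (auto simp: Y_def X_def \<phi>_def \<psi>_def x_def)
        also have "\<dots> = exp (D * x) * X" by (simp add: mult.assoc[symmetric] flip: exp_add)
        finally show ?thesis .
      qed
      have XX: "X \<le> exp (D * x) * X" using nn(1) D x mult_right_mono[of 1 "exp (D * x)" X] by simp
      define V where "V = exp ((D + D2) * x) * X"
      have V0: "V \<ge> 0" using nn by (simp add: V_def)
      have Qr: "AE t in lebesgue. t \<in> circle \<longrightarrow> norm (T t) * \<bar>Q r t\<bar> * v t \<le> V" for r
      proof -
        have "AE t in lebesgue. t \<in> circle - E \<longrightarrow> norm (T t) * \<bar>Q r t\<bar> * v t \<le> exp (D * x) * X"
          using aeX aeY
        proof eventually_elim
          case (elim t)
          show ?case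
          proof
            assume t: "t \<in> circle - E"
            show "norm (T t) * \<bar>Q r t\<bar> * v t \<le> exp (D * x) * X"
            proof (cases "f t < \<delta>")
              case True
              have "\<bar>Q r t\<bar> \<le> \<delta>" using Q_le[of r t] Q_ge[of t r] True f01(1)[of t] by (simp add: abs_le_iff)
              then have "\<bar>Q r t\<bar> \<le> exp (- D * \<mu> n) * q t" using \<delta>q[of t] by linarith
              then have "norm (T t) * \<bar>Q r t\<bar> * v t \<le> norm (T t) * (exp (- D * \<mu> n) * q t) * v t"
                using v_nonneg by (intro mult_right_mono mult_left_mono) auto
              also have "\<dots> = exp (- D * \<mu> n) * (\<psi> t * v t)" by (simp add: \<psi>_def mult_ac)
              also have "\<dots> \<le> exp (- D * \<mu> n) * Y" using elim t by (intro mult_left_mono) auto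
              finally show ?thesis using YX by linarith
            next
              case False
              then have "\<bar>Q r t\<bar> \<le> f t" using Q_le[of r t] Q_ge[of t r] f01(1)[of t] by (simp add: abs_le_iff)
              then have "norm (T t) * \<bar>Q r t\<bar> * v t \<le> \<phi> t * v t"
                unfolding \<phi>_def using v_nonneg by (intro mult_right_mono mult_left_mono) auto
              then show ?thesis using elim t XX by auto
            qed
          qed
        qed
        then have 1: "I (circle - E) (\<lambda>t. norm (T t) * \<bar>Q r t\<bar>) \<le> exp (D * x) * X"
          using I_le_iff_AE[OF adm(3) cE p, of "exp (D * x) * X"] nn by simp
        have TQ: "trig_poly (n + (c + 1) * n) (\<lambda>t. T t * complex_of_real (Q r t))" by (rule trig_poly_mult[OF T Qt])
        have nq: "norm (T t * complex_of_real (Q r t)) = norm (T t) * \<bar>Q r t\<bar>" for t by (simp add: norm_mult)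
        have Cn: "C * real (n + (c + 1) * n) * vol E = D2 * x" by (simp add: D2_def x_def algebra_simps)
        have "I circle (\<lambda>t. norm (T t) * \<bar>Q r t\<bar>) \<le> exp (D2 * x) * I (circle - E) (\<lambda>t. norm (T t) * \<bar>Q r t\<bar>)"
          using remez[OF _ TQ E E1] n unfolding nq Cn by simp
        also have "\<dots> \<le> exp (D2 * x) * (exp (D * x) * X)" using 1 by (intro mult_left_mono) auto
        also have "\<dots> = V" by (simp add: V_def distrib_right exp_add)
        finally show ?thesis using I_le_iff_AE[OF adm(3) _ _ p V0, of circle] by simp
      qed
      \<comment> \<open>The bound for \<open>Q r\<close> has an exceptional null set depending on
        \<open>r\<close>, so it cannot be read at \<open>t = r\<close> directly. Countably many
        \<open>r\<close> share one null set, and continuity in \<open>r\<close> extends the bound to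
        all real \<open>r\<close>, in particular to \<open>r = t\<close>.\<close>
      have "AE t in lebesgue. \<forall>r\<in>\<rat>. t \<in> circle \<longrightarrow> norm (T t) * \<bar>Q r t\<bar> * v t \<le> V"
        by (subst AE_ball_countable) (use Qr countable_rat in auto)
      then have "AE t in lebesgue. t \<in> circle \<longrightarrow> \<phi> t * v t \<le> V"
      proof eventually_elim
        case (elim t)
        show ?case
        proof
          assume t: "t \<in> circle"
          let ?S = "{r. norm (T t) * \<bar>Q r t\<bar> * v t \<le> V}"
          have "closed ?S"
            unfolding Q_def using smooth_periodic_continuous[OF e(1)]
            by (intro closed_Collect_le continuous_intros)
          moreover have "\<rat> \<subseteq> ?S" using elim t by auto
          ultimately have "closure \<rat> \<subseteq> ?S" by (intro closure_minimal)
          then have "t \<in> ?S" using Rats_closure_real by blast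
          then show "\<phi> t * v t \<le> V" using Q_eq f01 by (simp add: \<phi>_def)
        qed
      qed
      then have "I circle \<phi> \<le> V" using I_le_iff_AE[OF adm(1) _ _ p V0, of circle] by simp
      then show "I circle (\<lambda>t. norm (T t) * f t) \<le> exp ((D + D2) * (real n * vol E)) * I (circle - E) (\<lambda>t. norm (T t) * f t)"
        by (simp add: V_def X_def \<phi>_def x_def)
    qed
  qed
  then show ?thesis using D D2 by (intro exI[of _ "D + D2"]) auto
qed

text \<open>Small sets were treated for large \<open>n\<close> only. For smaller degrees
  \<open>T\<close> is regarded as a polynomial of degree \<open>n0\<close>, which costs a factor
  \<open>n0 + 1\<close> in the constant because \<open>max n n0 \<le> (n0 + 1) * n\<close>.\<close>

lemma weighted_remez:
  assumes f: "fast_approximable f \<mu> L"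
  shows "\<exists>K>0. \<forall>n\<ge>1. \<forall>T E. trig_poly n T \<longrightarrow> E \<in> sets lebesgue \<longrightarrow> E \<subseteq> circle \<longrightarrow> vol E \<le> 1 \<longrightarrow>
     I circle (\<lambda>t. norm (T t) * f t) \<le> exp (K * (real n * vol E)) * I (circle - E) (\<lambda>t. norm (T t) * f t)"
proof -
  obtain K1 where K1: "K1 > 0" "\<forall>\<^sub>F n in sequentially. remez_small_sets f K1 n"
    using remez_small_sets_finite_exponent[OF f] remez_small_sets_infinite_exponent[OF f] by blast
  from K1(2) obtain n0 where n0: "\<And>n. n \<ge> n0 \<Longrightarrow> remez_small_sets f K1 n"
    unfolding eventually_sequentially by blast
  obtain K2 where K2: "K2 > 0" and large: "\<And>n T E. n \<ge> 1 \<Longrightarrow> trig_poly n T \<Longrightarrow> E \<in> sets lebesgue \<Longrightarrow> E \<subseteq> circle \<Longrightarrow>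
     1 / 2 \<le> vol E \<Longrightarrow> vol E \<le> 1 \<Longrightarrow>
     I circle (\<lambda>t. norm (T t) * f t) \<le> exp (K2 * (real n * vol E)) * I (circle - E) (\<lambda>t. norm (T t) * f t)"
    using remez_large_sets_weighted[OF f] by blast
  define K where "K = K1 * (real n0 + 1) + K2"
  have K: "K > 0" "K2 \<le> K" "K1 * (real n0 + 1) \<le> K" using K1 K2 by (auto simp: K_def add_pos_pos)
  have "I circle (\<lambda>t. norm (T t) * f t) \<le> exp (K * (real n * vol E)) * I (circle - E) (\<lambda>t. norm (T t) * f t)"
    if n: "n \<ge> 1" and T: "trig_poly n T" and E: "E \<in> sets lebesgue" "E \<subseteq> circle" "vol E \<le> 1" for n T E
  proof -
    obtain y where y: "y \<le> K * (real n * vol E)"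
      "I circle (\<lambda>t. norm (T t) * f t) \<le> exp y * I (circle - E) (\<lambda>t. norm (T t) * f t)"
    proof (cases "1 / 2 \<le> vol E")
      case True
      have "K2 * (real n * vol E) \<le> K * (real n * vol E)" using K by (intro mult_right_mono) auto
      then show ?thesis using that large[OF n T E(1,2) True E(3)] by blast
    next
      case False
      define m where "m = max n n0"
      have "trig_poly m T" using T by (rule trig_poly_mono) (simp add: m_def)
      moreover have "remez_small_sets f K1 m" by (rule n0) (simp add: m_def)
      ultimately have "I circle (\<lambda>t. norm (T t) * f t) \<le> exp (K1 * (real m * vol E)) * I (circle - E) (\<lambda>t. norm (T t) * f t)"
        using E False unfolding remez_small_sets_def by auto
      moreover have "K1 * (real m * vol E) \<le> K * (real n * vol E)"
      proof -
        have "m \<le> (n0 + 1) * n" using n by (cases n) (auto simp: m_def)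
        then have "real m \<le> (real n0 + 1) * real n" by (metis of_nat_1 of_nat_add of_nat_le_iff of_nat_mult)
        then have "K1 * (real m * vol E) \<le> K1 * ((real n0 + 1) * real n * vol E)"
          using K1 by (intro mult_left_mono mult_right_mono) auto
        also have "\<dots> = K1 * (real n0 + 1) * (real n * vol E)" by simp
        also have "\<dots> \<le> K * (real n * vol E)" using K by (intro mult_right_mono) auto
        finally show ?thesis .
      qed
      ultimately show ?thesis using that by blast
    qed
    have "exp y * I (circle - E) (\<lambda>t. norm (T t) * f t) \<le> exp (K * (real n * vol E)) * I (circle - E) (\<lambda>t. norm (T t) * f t)"
      using y(1) I_nonneg by (intro mult_right_mono) auto
    then show ?thesis using y(2) by linarith
  qed
  then show ?thesis using K by blast
qed

lemma weighted_remez_energy: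
  assumes f: "fast_approximable f \<mu> L"
  shows "\<exists>K>0. \<forall>n\<ge>1. \<forall>T E. trig_poly n T \<longrightarrow> E \<in> sets lebesgue \<longrightarrow> E \<subseteq> circle \<longrightarrow> vol E \<le> 1 \<longrightarrow>
     energy p circle (\<lambda>t. (norm (T t) * f t) powr a * v t) \<le>
     ennreal (exp (K * (real n * vol E))) * energy p (circle - E) (\<lambda>t. (norm (T t) * f t) powr a * v t)"
proof -
  obtain K where K: "K > 0" and main: "\<And>n T E. n \<ge> 1 \<Longrightarrow> trig_poly n T \<Longrightarrow> E \<in> sets lebesgue \<Longrightarrow> E \<subseteq> circle \<Longrightarrow>
     vol E \<le> 1 \<Longrightarrow>
     I circle (\<lambda>t. norm (T t) * f t) \<le> exp (K * (real n * vol E)) * I (circle - E) (\<lambda>t. norm (T t) * f t)"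
    using weighted_remez[OF f] by blast
  have "energy p circle (\<lambda>t. (norm (T t) * f t) powr a * v t) \<le>
     ennreal (exp (K * (real n * vol E))) * energy p (circle - E) (\<lambda>t. (norm (T t) * f t) powr a * v t)"
    if n: "n \<ge> 1" and T: "trig_poly n T" and E: "E \<in> sets lebesgue" "E \<subseteq> circle" "vol E \<le> 1" for n T E
  proof -
    have cE: "circle - E \<in> sets lebesgue" using E by auto
    have adm: "admissible (\<lambda>t. norm (T t) * f t)"
      by (rule admissible_mult[OF admissible_trig_poly[OF T]])
         (use fast_approximableD(2,3)[OF f] in \<open>simp add: admissible_def\<close>)
    have "ennreal (I circle (\<lambda>t. norm (T t) * f t)) \<le>
        ennreal (exp (K * (real n * vol E)) * I (circle - E) (\<lambda>t. norm (T t) * f t))"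
      by (rule ennreal_leI[OF main[OF n T E]])
    also have "\<dots> = ennreal (exp (K * (real n * vol E))) * ennreal (I (circle - E) (\<lambda>t. norm (T t) * f t))"
      by (rule ennreal_mult) (simp_all add: I_nonneg)
    finally show ?thesis
      by (simp only: ennreal_I[OF adm circle_lmeasurable(2) order_refl] ennreal_I[OF adm cE Diff_subset])
  qed
  then show ?thesis using K by blast
qed

end

section \<open>Reduction of the theorem to a root of the weight\<close>

lemma Omega_outer_scale:
  assumes F: "Omega_outer A F" and c: "c > 0"
  shows "Omega_outer A (\<lambda>x. c * F x)"
proof -
  obtain d B A1 A2 where d: "derivatives_on {0<..A} F d"
    and B: "B > 0" "\<forall>x\<in>{0<..A}. \<forall>n\<ge>1. \<bar>d n x\<bar> \<le> B ^ n * real n ^ n * F x / x ^ n"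
    and A12: "A1 > 0" "A2 > 0" "\<forall>x\<in>{0<..A}. A2 \<le> \<bar>d 1 x\<bar> * x / F x \<and> \<bar>d 1 x\<bar> * x / F x \<le> A1"
    using F unfolding Omega_outer_def by blast
  have "derivatives_on {0<..A} (\<lambda>x. c * F x) (\<lambda>n x. c * d n x)"
    using d unfolding derivatives_on_def by (auto intro!: DERIV_cmult)
  moreover have "\<forall>x\<in>{0<..A}. \<forall>n\<ge>1. \<bar>c * d n x\<bar> \<le> B ^ n * real n ^ n * (c * F x) / x ^ n"
  proof (intro ballI allI impI)
    fix x n assume "x \<in> {0<..A}" "n \<ge> (1::nat)"
    then have "c * \<bar>d n x\<bar> \<le> c * (B ^ n * real n ^ n * F x / x ^ n)" using B c by (intro mult_left_mono) auto
    then show "\<bar>c * d n x\<bar> \<le> B ^ n * real n ^ n * (c * F x) / x ^ n" using c by (simp add: abs_mult mult_ac)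
  qed
  moreover have "\<forall>x\<in>{0<..A}. A2 \<le> \<bar>c * d 1 x\<bar> * x / (c * F x) \<and> \<bar>c * d 1 x\<bar> * x / (c * F x) \<le> A1"
    using A12(3) c by (simp add: abs_mult)
  moreover have "filterlim (\<lambda>x. c * F x) at_top (at_right 0)"
    using F c unfolding Omega_outer_def by (intro filterlim_tendsto_pos_mult_at_top[OF tendsto_const]) auto
  moreover have "antimono_on {0<..A} (\<lambda>x. c * F x)"
    using F c unfolding Omega_outer_def monotone_on_def by (auto intro!: mult_left_mono)
  moreover have "\<forall>x\<in>{-A..A} - {0}. 0 < c * F x \<and> c * F (- x) = c * F x"
    using F c unfolding Omega_outer_def by auto
  ultimately show ?thesis using B(1) A12(1,2) unfolding Omega_outer_def by blast
qed

theorem theorem5p1: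
  fixes p :: ennreal and \<omega> u :: "real \<Rightarrow> real"
  assumes "0 < p" and "\<omega> \<in> class_Omega" and "u \<in> class_R p"
  shows "\<exists>C::real. C > 0 \<and> (\<forall>n::nat. n \<ge> 1 \<longrightarrow> (\<forall>T. trig_poly n T \<longrightarrow>
           (\<forall>E. E \<in> sets lebesgue \<and> E \<subseteq> circle \<and>
                0 < measure lebesgue E \<and> measure lebesgue E \<le> 1 \<longrightarrow>
              Lp_norm p (\<lambda>t. \<omega> t * u t) circle T
                \<le> ennreal (exp (C * real n * measure lebesgue E))
                  * Lp_norm p (\<lambda>t. \<omega> t * u t) (circle - E) T)))"
proof -
  define a where "a = norm_exponent p"
  have a: "a > 0" using norm_exponent_pos[OF assms(1)] by (simp add: a_def)
  obtain A g F where A: "A > 0" and g: "Omega_inner A g" and F: "Omega_outer A F"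
    and \<omega>: "\<And>t. \<omega> t = (if g t = 0 then 0 else exp (- F (g t)))"
    using assms(2) unfolding class_Omega_def by blast
  \<comment> \<open>The conditions on \<open>F\<close> are invariant under positive scaling. With
    \<open>F / a\<close> in place of \<open>F\<close> one has \<open>f powr a = \<omega>\<close>,
    and the weight can be moved inside the power next to \<open>|T|\<close>.\<close>
  define f where "f = omega_fun (\<lambda>x. (1 / a) * F x) g"
  have f\<omega>: "f t powr a = \<omega> t" for t
    using a by (simp add: f_def omega_fun_def \<omega> powr_def)
  have f0: "f t \<ge> 0" for t by (simp add: f_def omega_fun_def)
  have "1 / a > 0" using a by simp
  from omega_fun_fast_approximable[OF A g Omega_outer_scale[OF F this]]
  obtain \<mu> L where f: "fast_approximable f \<mu> L" unfolding f_def by blast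
  have w: "weight u" using assms(3) by (simp add: class_R_def)
  have "\<exists>C>0. \<forall>n\<ge>1. \<forall>T. trig_poly n T \<longrightarrow>
        (\<forall>E. E \<in> sets lebesgue \<and> E \<subseteq> circle \<and> vol E \<le> 1 \<longrightarrow>
           Lp_norm p u circle T \<le> ennreal (exp (C * real n * vol E)) * Lp_norm p u (circle - E) T)"
    using assms(3) unfolding class_R_def mem_Collect_eq by (rule conjunct2)
  then obtain C0 where C0: "C0 > 0" and R: "\<forall>n\<ge>1. \<forall>T. trig_poly n T \<longrightarrow>
        (\<forall>E. E \<in> sets lebesgue \<and> E \<subseteq> circle \<and> vol E \<le> 1 \<longrightarrow>
           Lp_norm p u circle T \<le> ennreal (exp (C0 * real n * vol E)) * Lp_norm p u (circle - E) T)"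
    by (elim exE conjE)
  \<comment> \<open>A weight is integrable over one period, whereas the locale requires
    integrability on the line; on the circle nothing changes.\<close>
  define v where "v t = indicator circle t * u t" for t
  have v_eq: "v t = u t" if "t \<in> circle" for t using that by (simp add: v_def)
  have int: "integrable lebesgue v"
    using w unfolding weight_def set_integrable_def v_def by (simp add: real_scaleR_def)
  have remez_v: "energy p circle (\<lambda>t. norm (T t) powr norm_exponent p * v t) \<le>
      ennreal (exp (a * C0 * real n * vol E)) * energy p (circle - E) (\<lambda>t. norm (T t) powr norm_exponent p * v t)"
    if n: "n \<ge> 1" and T: "trig_poly n T" and E: "E \<in> sets lebesgue" "E \<subseteq> circle" "vol E \<le> 1" for n T E
  proof -
    have "Lp_norm p u circle T \<le> ennreal (exp (C0 * real n * vol E)) * Lp_norm p u (circle - E) T"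
      using R n T E by blast
    then have "energy p circle (\<lambda>t. norm (T t) powr norm_exponent p * u t) \<le>
      ennreal (exp (norm_exponent p * (C0 * real n * vol E))) * energy p (circle - E) (\<lambda>t. norm (T t) powr norm_exponent p * u t)"
      by (simp only: Lp_norm_le_iff_energy[OF assms(1)])
    moreover have "energy p circle (\<lambda>t. norm (T t) powr norm_exponent p * u t) = energy p circle (\<lambda>t. norm (T t) powr norm_exponent p * v t)"
      by (rule energy_cong) (simp add: v_eq)
    moreover have "energy p (circle - E) (\<lambda>t. norm (T t) powr norm_exponent p * u t) = energy p (circle - E) (\<lambda>t. norm (T t) powr norm_exponent p * v t)"
      by (rule energy_cong) (simp add: v_eq)
    ultimately show ?thesis by (simp only: a_def mult.assoc)
  qed
  have v0: "0 \<le> v t" for t using w by (simp add: v_def weight_def)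
  have rw: "remez_weight p v (a * C0)"
  proof (rule remez_weight.intro)
    show "0 < a * C0" using a C0 by simp
    show "v \<in> borel_measurable lebesgue" using int by auto
  qed (fact assms(1) v0 int remez_v)+
  obtain K where K: "K > 0" and main: "\<forall>n\<ge>1. \<forall>T E. trig_poly n T \<longrightarrow> E \<in> sets lebesgue \<longrightarrow> E \<subseteq> circle \<longrightarrow> vol E \<le> 1 \<longrightarrow>
     energy p circle (\<lambda>t. (norm (T t) * f t) powr norm_exponent p * v t) \<le>
     ennreal (exp (K * (real n * vol E))) * energy p (circle - E) (\<lambda>t. (norm (T t) * f t) powr norm_exponent p * v t)"
    using remez_weight.weighted_remez_energy[OF rw f] by (elim exE conjE)
  have "Lp_norm p (\<lambda>t. \<omega> t * u t) circle T \<le> ennreal (exp (K / a * real n * vol E)) * Lp_norm p (\<lambda>t. \<omega> t * u t) (circle - E) T"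
    if n: "n \<ge> 1" and T: "trig_poly n T" and E: "E \<in> sets lebesgue" "E \<subseteq> circle" "vol E \<le> 1" for n T E
  proof -
    have en: "energy p S (\<lambda>t. norm (T t) powr norm_exponent p * (\<omega> t * u t)) =
        energy p S (\<lambda>t. (norm (T t) * f t) powr norm_exponent p * v t)" if S: "S \<subseteq> circle" for S
    proof (rule energy_cong)
      fix t assume "t \<in> S"
      then have "v t = u t" using S v_eq by blast
      then show "norm (T t) powr norm_exponent p * (\<omega> t * u t) = (norm (T t) * f t) powr norm_exponent p * v t"
        using f\<omega>[of t] f0[of t] by (simp add: powr_mult a_def mult.assoc)
    qed
    have "energy p circle (\<lambda>t. (norm (T t) * f t) powr norm_exponent p * v t) \<le>
     ennreal (exp (K * (real n * vol E))) * energy p (circle - E) (\<lambda>t. (norm (T t) * f t) powr norm_exponent p * v t)"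
      using main n T E by blast
    moreover have "norm_exponent p * (K / a * real n * vol E) = K * (real n * vol E)"
      using a by (simp add: a_def)
    ultimately show ?thesis
      by (simp only: Lp_norm_le_iff_energy[OF assms(1)] en[OF order_refl] en[OF Diff_subset])
  qed
  then show ?thesis using K a by (intro exI[of _ "K / a"]) auto
qed

end
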